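(* Let $\Lambda\subseteq\mathbb{C}_\infty$ be an arbitrary period lattice (a discrete, finitely generated, projective $A$-submodule of $\mathbb{C}_\infty$), and define $$\zeta_\Lambda:=-\sum_{\lambda\in\Lambda\setminus\{0\}}\lambda^{-1}\otimes\lambda\in\mathbb{C}_\infty\overline\otimes\Lambda.$$ For any $A$-linear map $f:\Lambda\to A$, the element $(1\otimes f)\zeta_\Lambda=-\sum_{\lambda\in\Lambda\setminus\{0\}}\lambda^{-1}\otimes f(\lambda)\in\mathbb{C}_\infty\overline\otimes A$ is an analytic function from $X(\mathbb{C}_\infty)\setminus\{\infty\}$ to $\mathbb{C}_\infty$.
   Context: $X$ is a projective, geometrically irreducible, smooth curve over the finite field $\mathbb{F}_q$, $\infty\in X$ is a closed point, and $A$ is the ring of rational functions on $X$ with no poles outside $\infty$. $K_\infty$ is the completion of $K=\mathrm{Frac}(A)$ at $\infty$, and $\mathbb{C}_\infty$ is the completion of an algebraic closure of $K_\infty$, with its absolute value $\|\cdot\|$. Unadorned tensor products are over $\mathbb{F}_q$. For an $\mathbb{F}_q$-vector space $M$ (given the discrete topology), $\mathbb{C}_\infty\overline\otimes M$ is the completion of $\mathbb{C}_\infty\otimes M$ for the sup norm induced by $\mathbb{C}_\infty$: given an $\mathbb{F}_q$-basis $(m_i)_i$ of $M$, its elements are uniquely of the form $\sum_i c_i\otimes m_i$ with $c_i\to0$. The Tate algebra $\mathbb{C}_\infty\overline\otimes A$ is identified with the ring of analytic functions on the "unit disc" $D=\{P\in X(\mathbb{C}_\infty)\setminus\{\infty\}: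 \|a(P)\|\le 1\ \forall a\in A\}$, via $\left(\sum_i c_i\otimes a_i\right)(P)=\sum_i c_i a_i(P)$. Here $X(\mathbb{C}_\infty)\setminus\{\infty\}$ denotes the set of $\mathbb{C}_\infty$-points of $\mathrm{Spec}\,A$, i.e. of $\mathrm{Spec}(\mathbb{C}_\infty\otimes A)$ over $\mathbb C_\infty$. An element of $\mathbb{C}_\infty\overline\otimes A$ is said to be an analytic function from $X(\mathbb{C}_\infty)\setminus\{\infty\}$ to $\mathbb{C}_\infty$ if, as a function on $D$, it is the restriction of a (rigid) analytic function on the analytification of the affine curve $\mathrm{Spec}(\mathbb{C}_\infty\otimes A)$. *)

theory Defs
  imports "HOL-Analysis.Analysis" "HOL-Computational_Algebra.Computational_Algebra"
begin

text \<open>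
  Throughout, the type \<open>'f\<close> is the finite field F_q, the type \<open>'k\<close> is the function field K of the
  curve X, with structure map \<open>i :: 'f \<Rightarrow> 'k\<close>, and the type \<open>'c\<close> is C_infinity, with
  embedding \<open>j :: 'k \<Rightarrow> 'c\<close>.
\<close>

definition field_embedding :: "('a::field \<Rightarrow> 'b::field) \<Rightarrow> bool" where
  "field_embedding h \<longleftrightarrow>
     h 1 = 1 \<and> (\<forall>x y. h (x + y) = h x + h y) \<and> (\<forall>x y. h (x * y) = h x * h y)"


section \<open>The curve, its closed points and the ring A\<close>

text \<open>
  A projective smooth curve over F_q is given by its function field: a finite extension K
  of a rational function field F_q(x).
\<close>

definition rational_expressions :: "('f::field \<Rightarrow> 'k::field) \<Rightarrow> 'k \<Rightarrow> 'k set" where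
  "rational_expressions i x = {poly (map_poly i p) x / poly (map_poly i r) x | p r. True}"

definition curve_function_field :: "('f::field \<Rightarrow> 'k::field) \<Rightarrow> bool" where
  "curve_function_field i \<longleftrightarrow> field_embedding i \<and>
     (\<exists>x. (\<forall>p. p \<noteq> 0 \<longrightarrow> poly (map_poly i p) x \<noteq> 0) \<and>
        (\<exists>B. finite B \<and>
           (\<forall>y. \<exists>r. (\<forall>b\<in>B. r b \<in> rational_expressions i x) \<and> y = (\<Sum>b\<in>B. r b * b))))"

text \<open>
  The finite extensions of F_q are the fields F_q[t]/(p) with p irreducible, and the base change
  of K to such an extension is K[t]/(p). As p is separable, the base change of X is irreducible
  iff p stays irreducible over K.
\<close>

definition geometrically_irreducible :: "('f::field \<Rightarrow> 'k::field) \<Rightarrow> bool" where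
  "geometrically_irreducible i \<longleftrightarrow> (\<forall>p. irreducible p \<longrightarrow> irreducible (map_poly i p))"

text \<open>
  Closed points of X are the places of K over F_q, i.e. its normalized discrete valuations that are
  trivial on F_q. The order of vanishing of 0 is infinite, but is set to the dummy value 0, so
  that distinct elements of \<open>closed_points i\<close> are distinct places.
\<close>

definition closed_points :: "('f::field \<Rightarrow> 'k::field) \<Rightarrow> ('k \<Rightarrow> int) set" where
  "closed_points i = {v. v 0 = 0 \<and> (\<exists>x. x \<noteq> 0 \<and> v x = 1) \<and>
     (\<forall>a. a \<noteq> 0 \<longrightarrow> v (i a) = 0) \<and>
     (\<forall>x y. x \<noteq> 0 \<longrightarrow> y \<noteq> 0 \<longrightarrow> v (x * y) = v x + v y) \<and>
     (\<forall>x y. x \<noteq> 0 \<longrightarrow> y \<noteq> 0 \<longrightarrow> x + y \<noteq> 0 \<longrightarrow> v (x + y) \<ge> min (v x) (v y))}"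

definition ring_A :: "('f::field \<Rightarrow> 'k::field) \<Rightarrow> ('k \<Rightarrow> int) \<Rightarrow> 'k set" where
  "ring_A i infty = {a. \<forall>v \<in> closed_points i - {infty}. v a \<ge> 0}"


section \<open>The field C_infinity\<close>

text \<open>
  The library constrains \<open>norm\<close> to real normed vector spaces, which excludes positive characteristic;
  the absolute value is therefore the distance to 0.
\<close>

class complete_nonarch_field = field + complete_space +
  assumes dist_eq_dist_diff: "dist x y = dist (x - y) 0"
    and dist_mult: "dist (x * y) 0 = dist x 0 * dist y 0"
    and dist_ultrametric: "dist (x + y) 0 \<le> max (dist x 0) (dist y 0)"

definition absval :: "'c::complete_nonarch_field \<Rightarrow> real" where
  "absval x = dist x 0"

definition K_infty :: "('k::field \<Rightarrow> 'c::complete_nonarch_field) \<Rightarrow> 'c set" where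
  "K_infty j = closure (range j)"

definition K_infty_alg :: "('k::field \<Rightarrow> 'c::complete_nonarch_field) \<Rightarrow> 'c set" where
  "K_infty_alg j = {y. \<exists>p. p \<noteq> 0 \<and> (\<forall>n. coeff p n \<in> K_infty j) \<and> poly p y = 0}"

text \<open>
  The type \<open>'c\<close> is complete, so it is the completion of an algebraic closure of K_infinity
  iff the elements algebraic over K_infinity form an algebraically closed field which is dense.
  The absolute value is not normalized: any base \<open>Q > 1\<close> is allowed.
\<close>

definition is_C_infty ::
    "('k::field \<Rightarrow> int) \<Rightarrow> ('k \<Rightarrow> 'c::complete_nonarch_field) \<Rightarrow> bool" where
  "is_C_infty infty j \<longleftrightarrow> field_embedding j \<and>
     (\<exists>Q>1. \<forall>x. x \<noteq> 0 \<longrightarrow> absval (j x) = Q powi (- infty x)) \<and>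
     (\<forall>p. degree p > 0 \<longrightarrow> (\<forall>n. coeff p n \<in> K_infty_alg j) \<longrightarrow>
        (\<exists>y \<in> K_infty_alg j. poly p y = 0)) \<and>
     closure (K_infty_alg j) = UNIV"


section \<open>Period lattices\<close>

text \<open>In this section A acts on \<open>'c\<close> through the embedding \<open>j\<close>.\<close>

definition A_submodule :: "'k set \<Rightarrow> ('k::field \<Rightarrow> 'c::field) \<Rightarrow> 'c set \<Rightarrow> bool" where
  "A_submodule A j L \<longleftrightarrow>
     0 \<in> L \<and> (\<forall>x\<in>L. \<forall>y\<in>L. x + y \<in> L) \<and> (\<forall>a\<in>A. \<forall>x\<in>L. j a * x \<in> L)"

definition A_linear_map ::
    "'k set \<Rightarrow> ('k::field \<Rightarrow> 'c::field) \<Rightarrow> 'c set \<Rightarrow> ('c \<Rightarrow> 'k) \<Rightarrow> bool" where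
  "A_linear_map A j L f \<longleftrightarrow> f ` L \<subseteq> A \<and>
     (\<forall>x\<in>L. \<forall>y\<in>L. f (x + y) = f x + f y) \<and> (\<forall>a\<in>A. \<forall>x\<in>L. f (j a * x) = a * f x)"

definition A_finitely_generated ::
    "'k set \<Rightarrow> ('k::field \<Rightarrow> 'c::field) \<Rightarrow> 'c set \<Rightarrow> bool" where
  "A_finitely_generated A j L \<longleftrightarrow> (\<exists>G. finite G \<and> G \<subseteq> L \<and>
     (\<forall>x\<in>L. \<exists>r. (\<forall>g\<in>G. r g \<in> A) \<and> x = (\<Sum>g\<in>G. j (r g) * g)))"

text \<open>
  L is projective iff the canonical surjection onto L from the free A-module on the set L has an
  A-linear section; \<open>s g x\<close> is the g-th coordinate of the image of x under that section.
\<close>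

definition A_projective :: "'k set \<Rightarrow> ('k::field \<Rightarrow> 'c::field) \<Rightarrow> 'c set \<Rightarrow> bool" where
  "A_projective A j L \<longleftrightarrow> (\<exists>s. (\<forall>g\<in>L. A_linear_map A j L (s g)) \<and>
     (\<forall>x\<in>L. finite {g\<in>L. s g x \<noteq> 0} \<and> (\<Sum>g | g \<in> L \<and> s g x \<noteq> 0. j (s g x) * g) = x))"

definition period_lattice ::
    "'k set \<Rightarrow> ('k::field \<Rightarrow> 'c::complete_nonarch_field) \<Rightarrow> 'c set \<Rightarrow> bool" where
  "period_lattice A j L \<longleftrightarrow>
     A_submodule A j L \<and> discrete L \<and> A_finitely_generated A j L \<and> A_projective A j L"


section \<open>Completed tensor products over F_q\<close>

definition scale_K :: "('f \<Rightarrow> 'k::field) \<Rightarrow> 'f \<Rightarrow> 'k \<Rightarrow> 'k" where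
  "scale_K i a x = i a * x"

definition scale_C :: "('f \<Rightarrow> 'k) \<Rightarrow> ('k \<Rightarrow> 'c::field) \<Rightarrow> 'f \<Rightarrow> 'c \<Rightarrow> 'c" where
  "scale_C i j a x = j (i a) * x"

definition basis_of ::
    "('f::field \<Rightarrow> 'm::ab_group_add \<Rightarrow> 'm) \<Rightarrow> 'm set \<Rightarrow> 'm set \<Rightarrow> bool" where
  "basis_of s B M \<longleftrightarrow> \<not> module.dependent s B \<and> module.span s B = M"

text \<open>
  Given a basis B of M, the element of the completed tensor product of C_infinity and M which is the
  sum of the \<open>x b \<otimes> b\<close> is represented by its family of coefficients \<open>x\<close>, extended by 0 outside B.
\<close>

definition completed_tensor :: "'m set \<Rightarrow> ('m \<Rightarrow> 'c::complete_nonarch_field) set" where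
  "completed_tensor B =
     {x. (\<forall>b. b \<notin> B \<longrightarrow> x b = 0) \<and> (\<forall>e>0. finite {b\<in>B. absval (x b) \<ge> e})}"

definition pure_tensor ::
    "('f::field \<Rightarrow> 'k) \<Rightarrow> ('k \<Rightarrow> 'c::field) \<Rightarrow> ('f \<Rightarrow> 'm::ab_group_add \<Rightarrow> 'm) \<Rightarrow> 'm set \<Rightarrow>
      'c \<Rightarrow> 'm \<Rightarrow> ('m \<Rightarrow> 'c)" where
  "pure_tensor i j s B c m = (\<lambda>b. c * j (i (module.representation s B m b)))"

text \<open>
  Unordered summation for the sup norm: norm convergence is convergence of the
  coefficients that is uniform in \<open>b\<close>.
\<close>

definition has_tensor_sum ::
    "('s \<Rightarrow> 'm \<Rightarrow> 'c::complete_nonarch_field) \<Rightarrow> 's set \<Rightarrow> ('m \<Rightarrow> 'c) \<Rightarrow> bool" where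
  "has_tensor_sum t S z \<longleftrightarrow>
     uniform_limit UNIV (\<lambda>F b. \<Sum>l\<in>F. t l b) z (finite_subsets_at_top S)"

definition tensor_sum ::
    "('s \<Rightarrow> 'm \<Rightarrow> 'c::complete_nonarch_field) \<Rightarrow> 's set \<Rightarrow> ('m \<Rightarrow> 'c)" where
  "tensor_sum t S = (THE z. has_tensor_sum t S z)"

definition zeta_lattice ::
    "('f::field \<Rightarrow> 'k) \<Rightarrow> ('k \<Rightarrow> 'c::complete_nonarch_field) \<Rightarrow> 'c set \<Rightarrow> 'c set \<Rightarrow> ('c \<Rightarrow> 'c)" where
  "zeta_lattice i j BL L =
     (\<lambda>b. - tensor_sum (\<lambda>l. pure_tensor i j (scale_C i j) BL (inverse l) l) (L - {0}) b)"

text \<open>The continuous C_infinity-linear map \<open>1 \<otimes> f\<close>, for \<open>f\<close> from the span of BL to the span of BA.\<close>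

definition one_tensor ::
    "('f::field \<Rightarrow> 'k::field) \<Rightarrow> ('k \<Rightarrow> 'c::complete_nonarch_field) \<Rightarrow> 'c set \<Rightarrow> 'k set \<Rightarrow>
      ('c \<Rightarrow> 'k) \<Rightarrow> ('c \<Rightarrow> 'c) \<Rightarrow> ('k \<Rightarrow> 'c)" where
  "one_tensor i j BL BA f x =
     tensor_sum (\<lambda>b. pure_tensor i j (scale_K i) BA (x b) (f b)) BL"


section \<open>Analytic functions\<close>

text \<open>
  The C_infinity-points of Spec A, as F_q-algebra homomorphisms from A to C_infinity. The
  value of \<open>a\<close> at the point \<open>P\<close> is \<open>P a\<close>.
\<close>

definition affine_points ::
    "('f::field \<Rightarrow> 'k::field) \<Rightarrow> ('k \<Rightarrow> 'c::field) \<Rightarrow> 'k set \<Rightarrow> ('k \<Rightarrow> 'c) set" where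
  "affine_points i j A = {P \<in> extensional A. (\<forall>a. P (i a) = j (i a)) \<and>
     (\<forall>x\<in>A. \<forall>y\<in>A. P (x + y) = P x + P y) \<and> (\<forall>x\<in>A. \<forall>y\<in>A. P (x * y) = P x * P y)}"

definition unit_disc ::
    "('f::field \<Rightarrow> 'k::field) \<Rightarrow> ('k \<Rightarrow> 'c::complete_nonarch_field) \<Rightarrow> 'k set \<Rightarrow> ('k \<Rightarrow> 'c) set" where
  "unit_disc i j A = {P \<in> affine_points i j A. \<forall>a\<in>A. absval (P a) \<le> 1}"

definition tensor_eval ::
    "'k set \<Rightarrow> ('k \<Rightarrow> 'c::complete_nonarch_field) \<Rightarrow> ('k \<Rightarrow> 'c) \<Rightarrow> 'c" where
  "tensor_eval BA x P = (\<Sum>\<^sub>\<infinity>b\<in>BA. x b * P b)"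

inductive_set algebra_generated :: "('f::field \<Rightarrow> 'k::field) \<Rightarrow> 'k set \<Rightarrow> 'k set"
  for i :: "'f \<Rightarrow> 'k" and G :: "'k set" where
  const: "i a \<in> algebra_generated i G"
| gen: "g \<in> G \<Longrightarrow> g \<in> algebra_generated i G"
| add: "x \<in> algebra_generated i G \<Longrightarrow> y \<in> algebra_generated i G \<Longrightarrow> x + y \<in> algebra_generated i G"
| mult: "x \<in> algebra_generated i G \<Longrightarrow> y \<in> algebra_generated i G \<Longrightarrow> x * y \<in> algebra_generated i G"

definition multi_indices :: "'k set \<Rightarrow> ('k \<Rightarrow> nat) set" where
  "multi_indices G = {\<nu>. \<forall>g. g \<notin> G \<longrightarrow> \<nu> g = 0}"

text \<open>
  A finite set G of generators of A embeds Spec A in the affine space with coordinates indexed by G.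
  The analytification of Spec A (base changed to C_infinity) is the increasing union of its
  intersections with the closed polydiscs of radius R; the functions on such an
  intersection are the restrictions of the power series converging on the polydisc. As A is
  geometrically reduced, global sections may be identified with functions on points.
  The notion does not depend on the choice of G.
\<close>

definition rigid_analytic ::
    "('f::field \<Rightarrow> 'k::field) \<Rightarrow> ('k \<Rightarrow> 'c::complete_nonarch_field) \<Rightarrow> 'k set \<Rightarrow>
      (('k \<Rightarrow> 'c) \<Rightarrow> 'c) \<Rightarrow> bool" where
  "rigid_analytic i j A F \<longleftrightarrow>
     (\<exists>G. finite G \<and> algebra_generated i G = A \<and>
       (\<forall>R>0. \<exists>u :: ('k \<Rightarrow> nat) \<Rightarrow> 'c.
          (\<forall>e>0. finite {\<nu> \<in> multi_indices G. absval (u \<nu>) * R ^ (\<Sum>g\<in>G. \<nu> g) \<ge> e}) \<and>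
          (\<forall>P \<in> affine_points i j A. (\<forall>g\<in>G. absval (P g) \<le> R) \<longrightarrow>
             ((\<lambda>\<nu>. u \<nu> * (\<Prod>g\<in>G. P g ^ \<nu> g)) has_sum F P) (multi_indices G))))"

definition analytic_tensor ::
    "('f::field \<Rightarrow> 'k::field) \<Rightarrow> ('k \<Rightarrow> 'c::complete_nonarch_field) \<Rightarrow> 'k set \<Rightarrow> 'k set \<Rightarrow>
      ('k \<Rightarrow> 'c) \<Rightarrow> bool" where
  "analytic_tensor i j A BA x \<longleftrightarrow>
     (\<exists>F. rigid_analytic i j A F \<and> (\<forall>P \<in> unit_disc i j A. F P = tensor_eval BA x P))"

end

theory Submission
  imports Defs "HOL-Real_Asymp.Real_Asymp"
begin

text \<open>
  Write \<open>t\<close> for an element of \<open>A\<close> with \<open>|t| > 1\<close>; if there is none then \<open>A\<close> is finite and every sum is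
  finite. Two facts about the curve are needed. First, \<open>R / wR\<close> is finite for every additive subgroup \<open>R\<close>
  of \<open>K\<close> stable under \<open>w \<noteq> 0\<close>: expansions in powers of \<open>w\<close> with incongruent digits are distinct, while
  clearing denominators bounds their number. Second, an element without poles is constant: a
  subring maximal among those in which \<open>w\<close> is not invertible is a valuation ring, and it is discrete by
  the first fact. Hence \<open>A\<close> is discrete, and comparing balls in \<open>\<Lambda>\<close> of radii \<open>r\<close> and \<open>|t| r\<close> shows that
  they are finite.

  Choose an \<open>F_q\<close>-basis \<open>\<beta>\<close> of \<open>\<Lambda>\<close> in which \<open>\<beta> k\<close> has minimal absolute value outside the span \<open>U\<close> of
  its predecessors. On the unit disc the function is minus the sum of the \<open>\<gamma> k * P (f (\<beta> k))\<close>, where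
  \<open>\<gamma> k\<close> is the sum of \<open>1 / \<lambda>\<close> weighted by the \<open>k\<close>-th coordinate of \<open>\<lambda>\<close>. Summing over cosets of \<open>U\<close> by
  means of \<open>(\<Sum>u\<in>U. 1 / (x + u)) = (\<Prod>u\<in>U - {0}. u) / (\<Prod>u\<in>U. x + u)\<close> shows that \<open>\<gamma> k\<close> decays doubly
  exponentially, whereas \<open>f (\<beta> k)\<close> is a polynomial of degree \<open>k + O(1)\<close> in generators of \<open>A\<close>.
  So the series converges on every polydisc.
\<close>

section \<open>Finite quotients of subgroups of the function field\<close>

text \<open>Off the unit disc the terms \<open>P (f \<lambda>) / \<lambda>\<close> need not tend to
  0, so the sum over \<Lambda> cannot be continued term by term. On the disc, where
  \<open>P (f \<lambda>)\<close> has absolute value at most 1 and depends F_q-linearly on \<lambda>,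
  it can be regrouped along any F_q-basis, and a good basis gives a series that makes sense
  elsewhere. The basis of shortest vectors is good for this reason: no element of \<open>U\<close>
  is longer than \<open>\<beta> k\<close>, \<open>U\<close> has at least \<open>2 ^ k\<close>
  elements, and since \<Lambda> modulo t\<Lambda> is finite, a fixed proportion of them is shorter
  than \<open>\<beta> k\<close> by a factor \<open>|t|\<close>. Each of those gains a factor
  \<open>1 / |t|\<close> in the quotient of products; hence the double exponent. The remaining
  obstacle is that \<open>f\<close> comes with no bound. Digit expansions in powers of
  \<open>t\<close> with finitely many digits are used twice: in \<Lambda>, where
  \<open>A\<close>-linearity of \<open>f\<close> bounds \<open>f (\<beta> k)\<close> by a constant
  times \<open>|t| ^ k\<close>, and in \<open>A\<close>, where this bound becomes a bound on the
  degree.\<close>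

lemma
  assumes "field_embedding h"
  shows field_embedding_1: "h 1 = 1"
    and field_embedding_add: "h (x + y) = h x + h y"
    and field_embedding_mult: "h (x * y) = h x * h y"
    and field_embedding_0: "h 0 = 0"
    and field_embedding_minus: "h (- x) = - h x"
    and field_embedding_diff: "h (x - y) = h x - h y"
    and field_embedding_eq_0_iff: "h x = 0 \<longleftrightarrow> x = 0"
    and field_embedding_inverse: "h (inverse x) = inverse (h x)"
    and field_embedding_power: "h (x ^ n) = h x ^ n"
    and field_embedding_sum: "h (sum g X) = (\<Sum>x\<in>X. h (g x))"
proof -
  show one: "h 1 = 1" and add: "h (x + y) = h x + h y" and mult: "h (x * y) = h x * h y" for x y
    using assms by (auto simp: field_embedding_def)
  have "h 0 + h 0 = h 0 + 0"
    using add[of 0 0] by (simp only: add_0_right)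
  then show zero: "h 0 = 0"
    by (simp only: add_left_cancel)
  show minus: "h (- x) = - h x" for x
    using add[of x "- x"] zero by (simp add: eq_neg_iff_add_eq_0 add.commute)
  show "h (x - y) = h x - h y"
    using add[of x "- y"] minus by simp
  show eq_0: "h x = 0 \<longleftrightarrow> x = 0" for x
    using mult[of x "inverse x"] one zero by (cases "x = 0") auto
  show "h (inverse x) = inverse (h x)"
    using mult[of x "inverse x"] one zero eq_0[of x]
    by (cases "x = 0") (auto simp: inverse_unique)
  show "h (x ^ n) = h x ^ n"
    by (induction n) (auto simp: one mult)
  show "h (sum g X) = (\<Sum>x\<in>X. h (g x))"
    by (induction X rule: infinite_finite_induct) (auto simp: zero add)
qed

lemma field_embedding_compose:
  assumes "field_embedding i" "field_embedding j"
  shows "field_embedding (\<lambda>x. j (i x))"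
  using assms by (auto simp: field_embedding_def)

lemma vector_space_field_embedding:
  assumes "field_embedding h"
  shows "vector_space (\<lambda>a x. h a * x)"
  by unfold_locales
    (auto simp: field_embedding_1 field_embedding_add field_embedding_mult assms algebra_simps)

lemma finite_span:
  fixes scale :: "'f::{field,finite} \<Rightarrow> 'm::ab_group_add \<Rightarrow> 'm"
  assumes "vector_space scale" "finite S"
  shows "finite (module.span scale S)" "card (module.span scale S) \<le> CARD('f) ^ card S"
proof -
  interpret vector_space scale by fact
  have "finite (span S) \<and> card (span S) \<le> CARD('f) ^ card S"
    using \<open>finite S\<close>
  proof induction
    case empty
    show ?case by simp
  next
    case (insert a S)
    let ?g = "\<lambda>(k, x). x + scale k a"
    have "span (insert a S) \<subseteq> ?g ` (UNIV \<times> span S)"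
    proof
      fix x assume "x \<in> span (insert a S)"
      then obtain k where "x - scale k a \<in> span S"
        by (auto simp: span_insert)
      then show "x \<in> ?g ` (UNIV \<times> span S)"
        by (intro image_eqI[of _ _ "(k, x - scale k a)"]) auto
    qed
    moreover have fin: "finite (UNIV \<times> span S :: ('f \<times> 'm) set)"
      using insert.IH by simp
    ultimately have "finite (span (insert a S))"
        "card (span (insert a S)) \<le> card (UNIV \<times> span S :: ('f \<times> 'm) set)"
      by (auto intro: finite_surj surj_card_le)
    then show ?case
      using insert by (auto simp: card_cartesian_product intro: order_trans)
  qed
  then show "finite (span S)" "card (span S) \<le> CARD('f) ^ card S"
    by auto
qed

text \<open>Equal expansions have lowest digits that are congruent modulo \<open>w R\<close>, hence
  equal; these are subtracted, \<open>w\<close> is cancelled, and the induction continues.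
  \<open>horner_sum\<close> takes the lowest digit first.\<close>

lemma inj_on_horner_sum:
  fixes w :: "'k::field"
  assumes w: "w \<noteq> 0" and R: "0 \<in> R" "\<And>x y. x \<in> R \<Longrightarrow> y \<in> R \<Longrightarrow> x - y \<in> R" "\<And>x. x \<in> R \<Longrightarrow> w * x \<in> R"
    and S: "S \<subseteq> R" "\<And>x y. x \<in> S \<Longrightarrow> y \<in> S \<Longrightarrow> x - y \<in> (*) w ` R \<Longrightarrow> x = y"
  shows "inj_on (horner_sum (\<lambda>x. x) w) {xs. set xs \<subseteq> S \<and> length xs = n}"
proof (induction n)
  case (Suc n)
  have add: "x + y \<in> R" if "x \<in> R" "y \<in> R" for x y
    using R(2)[OF that(1) R(2)[OF R(1) that(2)]] by simp
  have in_R: "horner_sum (\<lambda>x. x) w xs \<in> R" if "set xs \<subseteq> S" for xs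
    using that S(1) by (induction xs) (auto intro!: R(1,3) add)
  show ?case
  proof (rule inj_onI, clarsimp)
    fix xs ys :: "'k list"
    assume xs: "set xs \<subseteq> S" "length xs = Suc n" and ys: "set ys \<subseteq> S" "length ys = Suc n"
      and eq: "horner_sum (\<lambda>x. x) w xs = horner_sum (\<lambda>x. x) w ys"
    obtain x xs' where xs': "xs = x # xs'" using xs by (cases xs) auto
    obtain y ys' where ys': "ys = y # ys'" using ys by (cases ys) auto
    have "x - y = w * (horner_sum (\<lambda>x. x) w ys' - horner_sum (\<lambda>x. x) w xs')"
      using eq unfolding xs' ys' by (simp add: algebra_simps)
    moreover have "horner_sum (\<lambda>x. x) w ys' - horner_sum (\<lambda>x. x) w xs' \<in> R"
      using xs ys by (intro R(2) in_R) (auto simp: xs' ys')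
    ultimately have "x = y"
      using S(2)[of x y] xs ys by (auto simp: xs' ys')
    moreover from this have "horner_sum (\<lambda>x. x) w xs' = horner_sum (\<lambda>x. x) w ys'"
      using eq w unfolding xs' ys' by simp
    ultimately show "xs = ys"
      using Suc xs ys unfolding xs' ys' inj_on_def by simp
  qed
qed (simp add: inj_on_def)

text \<open>A separated set of largest size meets every class: an element related to none of its
  members could be added to it. In the application \<open>Q\<close> is congruence modulo
  \<open>w R\<close>.\<close>

lemma exists_maximal_separated:
  assumes bound: "\<And>S. finite S \<Longrightarrow> S \<subseteq> R \<Longrightarrow> (\<And>x y. x \<in> S \<Longrightarrow> y \<in> S \<Longrightarrow> Q x y \<Longrightarrow> x = y) \<Longrightarrow> card S \<le> N"
    and sym: "\<And>x y. Q x y \<Longrightarrow> Q y x" and refl: "\<And>x. x \<in> R \<Longrightarrow> Q x x"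
  shows "\<exists>S. finite S \<and> S \<subseteq> R \<and> (\<forall>x\<in>R. \<exists>y\<in>S. Q x y)"
proof -
  define sep where "sep S \<longleftrightarrow> finite S \<and> S \<subseteq> R \<and> (\<forall>x\<in>S. \<forall>y\<in>S. Q x y \<longrightarrow> x = y)" for S
  have "\<exists>S. sep S \<and> (\<forall>S'. sep S' \<longrightarrow> card S' \<le> card S)"
    by (rule ex_has_greatest_nat[where k = "{}" and b = "Suc N"])
      (auto simp: sep_def intro!: bound le_imp_less_Suc)
  then obtain S where S: "sep S" and max: "\<And>S'. sep S' \<Longrightarrow> card S' \<le> card S"
    by blast
  have "\<exists>y\<in>S. Q x y" if x: "x \<in> R" for x
  proof (rule ccontr)
    assume contr: "\<not> (\<exists>y\<in>S. Q x y)"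
    then have "sep (insert x S)"
      using S x sym unfolding sep_def by blast
    moreover have "x \<notin> S"
      using contr refl[OF x] by blast
    ultimately show False
      using max[of "insert x S"] S by (auto simp: sep_def)
  qed
  then show ?thesis
    using S by (auto simp: sep_def)
qed

text \<open>\<open>(s / N) ^ n\<close> outgrows \<open>C\<close> when \<open>s > N\<close>. The
  constant \<open>C\<close>, which will depend on the digit set, thereby drops out, and
  \<open>N\<close> bounds all digit sets at once.\<close>

lemma power_le_imp_le_of_exponential_bound:
  fixes s N C :: nat
  assumes "\<And>n. s ^ n \<le> C * N ^ n"
  shows "s \<le> N"
proof (rule ccontr)
  assume "\<not> s \<le> N"
  then have "s \<ge> Suc N" by simp
  show False
  proof (cases "N = 0")
    case True
    then show False using assms[of 1] \<open>\<not> s \<le> N\<close> by simp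
  next
    case False
    let ?q = "real s / real N"
    have "?q > 1" using \<open>s \<ge> Suc N\<close> False by (simp add: field_simps)
    then obtain n where n: "real C < ?q ^ n"
      using real_arch_pow by blast
    have "real (s ^ n) \<le> real (C * N ^ n)"
      using assms[of n] by linarith
    then have "?q ^ n \<le> real C"
      using False by (simp add: power_divide field_simps)
    then show False using n by simp
  qed
qed


section \<open>Counting digit expansions by clearing denominators\<close>

lemma poly_map_poly_embedding:
  assumes "field_embedding i"
  shows "poly (map_poly i p) x = (\<Sum>k\<le>degree p. i (coeff p k) * x ^ k)"
proof -
  have "degree (map_poly i p) = degree p"
    by (rule degree_map_poly) (simp add: field_embedding_eq_0_iff assms)
  then show ?thesis
    by (simp add: poly_altdef coeff_map_poly field_embedding_0 assms)
qed

text \<open>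
  Clearing denominators puts all these elements into the space of the \<open>F_q\<close>-combinations of the
  \<open>x ^ k * b\<close> with \<open>k\<close> at most linear in \<open>n\<close>.
\<close>

lemma card_horner_sums_le:
  fixes i :: "'f::{field,finite} \<Rightarrow> 'k::field" and w :: 'k
  assumes curve: "curve_function_field i"
  shows "\<exists>N. \<forall>S. finite S \<longrightarrow>
    (\<exists>C. \<forall>n. card (horner_sum (\<lambda>x. x) w ` {xs. set xs \<subseteq> S \<and> length xs = n}) \<le> C * N ^ n)"
proof -
  have emb: "field_embedding i"
    using curve by (simp add: curve_function_field_def)
  obtain x B where B: "finite B"
    and gen: "\<And>y. \<exists>r. (\<forall>b\<in>B. r b \<in> rational_expressions i x) \<and> y = (\<Sum>b\<in>B. r b * b)"
    using curve by (auto simp: curve_function_field_def)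
  interpret vector_space "\<lambda>a y. i a * y"
    by (rule vector_space_field_embedding) fact
  \<comment> \<open>\<open>W d\<close> collects the combinations of degree at most \<open>d\<close>
    in \<open>x\<close>; its size is at most exponential in \<open>d\<close>.\<close>
  define gens where "gens d = (\<lambda>(k, b). x ^ k * b) ` ({..d} \<times> B)" for d :: nat
  define W where "W d = span (gens d)" for d
  have finite_gens: "finite (gens d)" for d
    using B by (auto simp: gens_def)
  have finite_W: "finite (W d)" for d
    unfolding W_def by (rule finite_span) (fact vector_space_axioms finite_gens)+
  have card_W: "card (W d) \<le> CARD('f) ^ (Suc d * card B)" for d
  proof -
    have "card (gens d) \<le> Suc d * card B"
      unfolding gens_def by (rule order_trans[OF card_image_le]) (auto simp: B card_cartesian_product)
    then have "CARD('f) ^ card (gens d) \<le> CARD('f) ^ (Suc d * card B)"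
      by (intro power_increasing) (auto simp: Suc_le_eq)
    with finite_span(2)[OF vector_space_axioms finite_gens[of d]] show ?thesis
      unfolding W_def by linarith
  qed
  have W_mono: "W d \<subseteq> W d'" if "d \<le> d'" for d d'
    unfolding W_def gens_def using that by (intro span_mono) auto
  have W_add: "y + z \<in> W d" if "y \<in> W d" "z \<in> W d" for y z d
    using that unfolding W_def by (rule span_add)
  have mult_W: "c * z \<in> W d'" if z: "z \<in> W d" and c: "\<And>k b. k \<le> d \<Longrightarrow> b \<in> B \<Longrightarrow> c * (x ^ k * b) \<in> W d'"
    for c z d d'
  proof -
    have "subspace {z. c * z \<in> W d'}"
      unfolding W_def subspace_def
      by (auto simp: span_zero distrib_left mult.left_commute[of c] intro: span_add span_scale)
    moreover have "gens d \<subseteq> {z. c * z \<in> W d'}"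
      using c by (auto simp: gens_def)
    ultimately show ?thesis
      using span_minimal z unfolding W_def by blast
  qed
  have gen_W: "x ^ k * b \<in> W d" if "k \<le> d" "b \<in> B" for k b d
    unfolding W_def gens_def using that by (intro span_base) force
  have x_W: "x ^ k * z \<in> W (k + d)" if z: "z \<in> W d" for k d z
    using z by (rule mult_W) (auto simp: mult.assoc[symmetric] power_add[symmetric] intro: gen_W)
  \<comment> \<open>\<open>bdd c\<close>: multiplication by \<open>c\<close> raises the degree by at
    most a fixed \<open>e\<close>, whatever the degree to start from. Polynomials in
    \<open>x\<close> have this property.\<close>
  define bdd where "bdd c \<longleftrightarrow> (\<exists>e. \<forall>d. \<forall>z\<in>W d. c * z \<in> W (d + e))" for c
  have bdd_poly: "bdd (poly (map_poly i p) x)" for p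
    unfolding bdd_def
  proof (intro exI allI ballI)
    fix d z assume z: "z \<in> W d"
    have "i (coeff p k) * (x ^ k * z) \<in> W (d + degree p)" if "k \<le> degree p" for k
    proof -
      have "x ^ k * z \<in> W (d + degree p)"
        using x_W[OF z, of k] W_mono[of "k + d" "d + degree p"] that by auto
      then show ?thesis
        unfolding W_def by (rule span_scale)
    qed
    then show "poly (map_poly i p) x * z \<in> W (d + degree p)"
      unfolding poly_map_poly_embedding[OF emb] sum_distrib_right W_def
      by (intro span_sum) (auto simp: mult.assoc)
  qed
  have bdd_mult: "bdd (c * c')" if c: "bdd c" and c': "bdd c'" for c c'
  proof -
    obtain e where e: "\<And>d z. z \<in> W d \<Longrightarrow> c * z \<in> W (d + e)"
      using c unfolding bdd_def by blast
    obtain e' where e': "\<And>d z. z \<in> W d \<Longrightarrow> c' * z \<in> W (d + e')"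
      using c' unfolding bdd_def by blast
    have "c * c' * z \<in> W (d + (e' + e))" if "z \<in> W d" for d z
      using e[OF e'[OF that]] by (simp add: mult.assoc add.assoc)
    then show ?thesis
      unfolding bdd_def by blast
  qed
  have bdd_1: "bdd 1"
    unfolding bdd_def by (intro exI[of _ 0]) auto
  \<comment> \<open>\<open>Y y\<close>: some nonzero multiplier of bounded shift is a denominator
    for \<open>y\<close>. Every element of the field will turn out to have one, and finitely many
    elements have a common one.\<close>
  define Y where "Y y \<longleftrightarrow> (\<exists>D d. D \<noteq> 0 \<and> bdd D \<and> D * y \<in> W d)" for y
  have Y_common: "\<exists>D d. D \<noteq> 0 \<and> bdd D \<and> (\<forall>z\<in>Z. D * z \<in> W d)"
    if "finite Z" "\<And>z. z \<in> Z \<Longrightarrow> Y z" for Z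
    using that
  proof induction
    case empty
    show ?case using bdd_1 by (intro exI[of _ 1]) auto
  next
    case (insert a Z)
    have "\<exists>D d. D \<noteq> 0 \<and> bdd D \<and> (\<forall>z\<in>Z. D * z \<in> W d)"
      by (rule insert.IH) (use insert.prems in auto)
    then obtain D d where D: "D \<noteq> 0" "bdd D" "\<And>z. z \<in> Z \<Longrightarrow> D * z \<in> W d"
      by blast
    obtain D' d' where D': "D' \<noteq> 0" "bdd D'" "D' * a \<in> W d'"
      using insert.prems[of a] by (auto simp: Y_def)
    obtain e where e: "\<And>d z. z \<in> W d \<Longrightarrow> D * z \<in> W (d + e)"
      using D unfolding bdd_def by blast
    obtain e' where e': "\<And>d z. z \<in> W d \<Longrightarrow> D' * z \<in> W (d + e')"
      using D' unfolding bdd_def by blast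
    have "D * D' * z \<in> W (d + e' + (d' + e))" if z: "z \<in> insert a Z" for z
    proof (cases "z = a")
      case True
      have "D * D' * z \<in> W (d' + e)"
        using e[OF D'(3)] True by (simp add: mult.assoc)
      then show ?thesis using W_mono[of "d' + e" "d + e' + (d' + e)"] by auto
    next
      case False
      then have "D * D' * z \<in> W (d + e')"
        using e'[OF D(3), of z] z by (simp add: mult.left_commute mult.commute)
      then show ?thesis using W_mono[of "d + e'" "d + e' + (d' + e)"] by auto
    qed
    moreover have "D * D' \<noteq> 0" "bdd (D * D')"
      using D D' bdd_mult by auto
    ultimately show ?case by blast
  qed
  have Y_add: "Y (y + z)" if yz: "Y y" "Y z" for y z
  proof -
    obtain D d where "D \<noteq> 0" "bdd D" "\<forall>v\<in>{y, z}. D * v \<in> W d"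
      using Y_common[of "{y, z}"] yz by auto
    then show ?thesis
      unfolding Y_def by (intro exI[of _ D] exI[of _ d]) (auto simp: distrib_left intro: W_add)
  qed
  have Y_rational: "Y (r * b)" if r: "r \<in> rational_expressions i x" and b: "b \<in> B" for r b
  proof -
    obtain p q where pq: "r = poly (map_poly i p) x / poly (map_poly i q) x"
      using r by (auto simp: rational_expressions_def)
    obtain e where e: "\<And>d z. z \<in> W d \<Longrightarrow> poly (map_poly i p) x * z \<in> W (d + e)"
      using bdd_poly[of p] unfolding bdd_def by blast
    have b: "b \<in> W 0"
      using gen_W[of 0 0 b] b by simp
    show ?thesis
    proof (cases "poly (map_poly i q) x = 0")
      \<comment> \<open>Division by zero: the fraction \<open>r\<close> is 0 here, and 1 serves as
        its denominator.\<close>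
      case True
      then have "r * b = 0" using pq by simp
      then show ?thesis
        unfolding Y_def W_def using bdd_1 by (intro exI[of _ 1]) (auto simp: span_zero)
    next
      case False
      then show ?thesis
        unfolding Y_def using bdd_poly[of q] e[OF b] pq
        by (intro exI[of _ "poly (map_poly i q) x"] exI[of _ e]) auto
    qed
  qed
  have Y_all: "Y y" for y
  proof -
    obtain r where r: "\<And>b. b \<in> B \<Longrightarrow> r b \<in> rational_expressions i x" "y = (\<Sum>b\<in>B. r b * b)"
      using gen by blast
    have "Y (\<Sum>b\<in>B'. r b * b)" if "B' \<subseteq> B" for B'
      using finite_subset[OF that B] that
    proof induction
      case empty
      show ?case
        unfolding Y_def W_def using bdd_1 by (intro exI[of _ 1]) (auto simp: span_zero)
    qed (auto intro!: Y_add Y_rational r)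
    then show ?thesis using r by simp
  qed
  obtain D d0 where D: "D \<noteq> 0" "bdd D" "\<And>b. b \<in> B \<Longrightarrow> D * (w * b) \<in> W d0"
    using Y_common[of "(*) w ` B"] B Y_all by auto
  obtain e0 where e0: "\<And>d z. z \<in> W d \<Longrightarrow> D * z \<in> W (d + e0)"
    using D unfolding bdd_def by blast
  \<comment> \<open>One shift for multiplication by \<open>D\<close> and by \<open>D * w\<close>; it
    depends on \<open>w\<close> but not on the digits.\<close>
  define e where "e = max d0 e0"
  have D_W: "D * z \<in> W (d + e)" if "z \<in> W d" for d z
    using e0[OF that] W_mono[of "d + e0" "d + e"] by (auto simp: e_def)
  have Dw_W: "D * w * z \<in> W (d + e)" if z: "z \<in> W d" for d z
  proof (rule mult_W[OF z])
    fix k b assume k: "k \<le> d" and b: "b \<in> B"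
    have "x ^ k * (D * (w * b)) \<in> W (k + d0)"
      using x_W D(3) b by blast
    also have "W (k + d0) \<subseteq> W (d + e)"
      using k by (intro W_mono) (auto simp: e_def)
    finally show "D * w * (x ^ k * b) \<in> W (d + e)"
      by (simp add: mult_ac)
  qed
  have Dpow_W: "D ^ n * z \<in> W (d + n * e)" if "z \<in> W d" for d n z
  proof (induction n)
    case (Suc n)
    from D_W[OF this] show ?case by (simp add: mult_ac add_ac)
  qed (use that in simp)
  \<comment> \<open>Each further digit costs a factor \<open>D\<close>, hence degree
    \<open>e\<close>, which explains the base. The digit set enters only through \<open>c\<close>,
    and so only into the constant \<open>C\<close>; this is why \<open>N\<close> can be fixed before
    \<open>S\<close>.\<close>
  show ?thesis
  proof (rule exI[of _ "CARD('f) ^ (e * card B)"], intro allI impI)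
    fix S :: "'k set" assume S: "finite S"
    obtain D' c where D': "D' \<noteq> 0" "\<And>s. s \<in> S \<Longrightarrow> D' * s \<in> W c"
      using Y_common[OF S Y_all] by blast
    have mem: "D' * D ^ length xs * horner_sum (\<lambda>x. x) w xs \<in> W (c + length xs * e)"
      if "set xs \<subseteq> S" for xs
      using that
    proof (induction xs)
      case Nil
      show ?case by (simp add: W_def span_zero)
    next
      case (Cons s xs)
      let ?n = "length xs" and ?h = "horner_sum (\<lambda>x. x) w xs"
      \<comment> \<open>The additional factor \<open>D\<close> pays for the multiplication of the
        higher digits by \<open>w\<close>.\<close>
      have "D ^ Suc ?n * (D' * s) + D * w * (D' * D ^ ?n * ?h) \<in> W (c + Suc ?n * e)"
        using Cons Dpow_W[OF D'(2), of s "Suc ?n"] Dw_W[of "D' * D ^ ?n * ?h" "c + ?n * e"]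
        by (intro W_add) (auto simp: add_ac)
      then show ?case
        by (simp add: algebra_simps)
    qed
    have "card (horner_sum (\<lambda>x. x) w ` {xs. set xs \<subseteq> S \<and> length xs = n})
        \<le> CARD('f) ^ (Suc c * card B) * (CARD('f) ^ (e * card B)) ^ n" for n
    proof -
      let ?H = "horner_sum (\<lambda>x. x) w ` {xs. set xs \<subseteq> S \<and> length xs = n}"
      have "inj_on ((*) (D' * D ^ n)) ?H"
        using D D' by (auto simp: inj_on_def)
      moreover have "(*) (D' * D ^ n) ` ?H \<subseteq> W (c + n * e)"
        using mem by auto
      ultimately have "card ?H \<le> card (W (c + n * e))"
        using finite_W card_inj_on_le by blast
      also note card_W
      also have "CARD('f) ^ (Suc (c + n * e) * card B) = CARD('f) ^ (Suc c * card B) * (CARD('f) ^ (e * card B)) ^ n"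
        by (simp add: power_mult[symmetric] power_add[symmetric] algebra_simps)
      finally show ?thesis .
    qed
    then show "\<exists>C. \<forall>n. card (horner_sum (\<lambda>x. x) w ` {xs. set xs \<subseteq> S \<and> length xs = n})
        \<le> C * (CARD('f) ^ (e * card B)) ^ n"
      by blast
  qed
qed

text \<open>A set of incongruent digits has at most \<open>N\<close> elements, by comparing
  \<open>card S ^ n\<close> with the exponential bound, so a largest such set represents all
  classes. This is applied to \<open>A\<close> with \<open>w = t\<close>, and to valuation
  rings.\<close>

lemma finite_quotient:
  fixes i :: "'f::{field,finite} \<Rightarrow> 'k::field" and w :: 'k
  assumes curve: "curve_function_field i" and w: "w \<noteq> 0"
    and R: "0 \<in> R" "\<And>x y. x \<in> R \<Longrightarrow> y \<in> R \<Longrightarrow> x - y \<in> R" "\<And>x. x \<in> R \<Longrightarrow> w * x \<in> R"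
  shows "\<exists>E. finite E \<and> E \<subseteq> R \<and> (\<forall>x\<in>R. \<exists>e\<in>E. \<exists>y\<in>R. x = e + w * y)"
proof -
  obtain N where N: "\<And>S. finite S \<Longrightarrow>
      \<exists>C. \<forall>n. card (horner_sum (\<lambda>x. x) w ` {xs. set xs \<subseteq> S \<and> length xs = n}) \<le> C * N ^ n"
    using card_horner_sums_le[OF curve, of w] by blast
  have neg: "- y \<in> R" if "y \<in> R" for y
    using R(2)[OF R(1) that] by simp
  have "\<exists>E. finite E \<and> E \<subseteq> R \<and> (\<forall>x\<in>R. \<exists>e\<in>E. x - e \<in> (*) w ` R)"
  proof (rule exists_maximal_separated)
    fix S assume S: "finite S" "S \<subseteq> R" and sep: "\<And>x y. x \<in> S \<Longrightarrow> y \<in> S \<Longrightarrow> x - y \<in> (*) w ` R \<Longrightarrow> x = y"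
    obtain C where C: "\<And>n. card (horner_sum (\<lambda>x. x) w ` {xs. set xs \<subseteq> S \<and> length xs = n}) \<le> C * N ^ n"
      using N[OF S(1)] by blast
    have "card S ^ n \<le> C * N ^ n" for n
    proof -
      have "inj_on (horner_sum (\<lambda>x. x) w) {xs. set xs \<subseteq> S \<and> length xs = n}"
        by (rule inj_on_horner_sum[OF w R S(2) sep])
      then show ?thesis
        using C[of n] card_lists_length_eq[OF S(1), of n] by (simp add: card_image)
    qed
    then show "card S \<le> N"
      by (rule power_le_imp_le_of_exponential_bound)
  next
    show "y - x \<in> (*) w ` R" if xy: "x - y \<in> (*) w ` R" for x y
    proof -
      obtain z where "z \<in> R" "x - y = w * z" using xy by blast
      then show ?thesis
        using neg by (intro image_eqI[of _ _ "- z"]) (auto simp: algebra_simps)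
    qed
  qed (use R in force)
  then show ?thesis
    by (fastforce simp: diff_eq_eq add.commute)
qed

section \<open>Existence of places\<close>

lemma map_poly_embedding_mult:
  assumes "field_embedding i"
  shows "map_poly i (p * q) = map_poly i p * map_poly i q"
  by (rule poly_eqI)
    (simp add: coeff_map_poly coeff_mult field_embedding_0 field_embedding_sum field_embedding_mult assms)

lemma degree_map_poly_embedding:
  assumes "field_embedding i"
  shows "degree (map_poly i p) = degree p"
  by (rule degree_map_poly) (simp add: field_embedding_eq_0_iff assms)

section \<open>Maximal subrings omitting an inverse are valuation rings\<close>

definition subring_of_field :: "'k::field set \<Rightarrow> bool" where
  "subring_of_field R \<longleftrightarrow> 1 \<in> R \<and> (\<forall>x\<in>R. \<forall>y\<in>R. x - y \<in> R \<and> x * y \<in> R)"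

lemma
  assumes "subring_of_field R"
  shows subring_1: "1 \<in> R" and subring_0: "0 \<in> R"
    and subring_diff: "x \<in> R \<Longrightarrow> y \<in> R \<Longrightarrow> x - y \<in> R"
    and subring_minus: "x \<in> R \<Longrightarrow> - x \<in> R"
    and subring_add: "x \<in> R \<Longrightarrow> y \<in> R \<Longrightarrow> x + y \<in> R"
    and subring_mult: "x \<in> R \<Longrightarrow> y \<in> R \<Longrightarrow> x * y \<in> R"
    and subring_power: "x \<in> R \<Longrightarrow> x ^ n \<in> R"
    and subring_sum: "(\<And>s. s \<in> S \<Longrightarrow> g s \<in> R) \<Longrightarrow> sum g S \<in> R"
proof -
  show one: "1 \<in> R" and diff: "x \<in> R \<Longrightarrow> y \<in> R \<Longrightarrow> x - y \<in> R"
    and mult: "x \<in> R \<Longrightarrow> y \<in> R \<Longrightarrow> x * y \<in> R" for x y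
    using assms by (auto simp: subring_of_field_def)
  show zero: "0 \<in> R"
    using diff[OF one one] by simp
  show minus: "x \<in> R \<Longrightarrow> - x \<in> R" for x
    using diff[OF zero, of x] by simp
  show add: "x \<in> R \<Longrightarrow> y \<in> R \<Longrightarrow> x + y \<in> R" for x y
    using diff[OF _ minus, of x y] by simp
  show "x \<in> R \<Longrightarrow> x ^ n \<in> R"
    by (induction n) (auto intro: one mult)
  show "(\<And>s. s \<in> S \<Longrightarrow> g s \<in> R) \<Longrightarrow> sum g S \<in> R"
    by (induction S rule: infinite_finite_induct) (auto intro: zero add)
qed

definition adjoin :: "'k::field set \<Rightarrow> 'k \<Rightarrow> 'k set" where
  "adjoin R u = {poly p u | p. \<forall>n. coeff p n \<in> R}"

lemma subring_adjoin:
  assumes R: "subring_of_field R"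
  shows "subring_of_field (adjoin R u)" "R \<subseteq> adjoin R u" "u \<in> adjoin R u"
proof -
  show "subring_of_field (adjoin R u)"
    unfolding subring_of_field_def
  proof (intro conjI ballI)
    show "1 \<in> adjoin R u"
      unfolding adjoin_def using subring_0[OF R] subring_1[OF R]
      by (intro CollectI exI[of _ 1]) (auto simp: coeff_1)
    fix x y assume "x \<in> adjoin R u" "y \<in> adjoin R u"
    then obtain p q where p: "x = poly p u" "\<And>n. coeff p n \<in> R" and q: "y = poly q u" "\<And>n. coeff q n \<in> R"
      by (auto simp: adjoin_def)
    show "x - y \<in> adjoin R u"
      unfolding adjoin_def using p q by (intro CollectI exI[of _ "p - q"]) (auto intro: subring_diff[OF R])
    show "x * y \<in> adjoin R u"
      unfolding adjoin_def using p q
      by (intro CollectI exI[of _ "p * q"]) (auto simp: coeff_mult intro!: subring_sum[OF R] subring_mult[OF R])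
  qed
  show "R \<subseteq> adjoin R u"
  proof
    fix x assume "x \<in> R"
    then show "x \<in> adjoin R u"
      unfolding adjoin_def
      by (intro CollectI exI[of _ "[:x:]"]) (auto simp: coeff_pCons subring_0[OF R] split: nat.splits)
  qed
  show "u \<in> adjoin R u"
    unfolding adjoin_def
    by (intro CollectI exI[of _ "[:0, 1:]"])
      (auto simp: coeff_pCons subring_0[OF R] subring_1[OF R] split: nat.splits)
qed

text \<open>Zorn's lemma, started from F_q[w]; the union of a chain still omits
  \<open>inverse w\<close>. As the ring contains \<open>w\<close> but not its inverse, it will give
  \<open>w\<close> a positive valuation.\<close>

lemma exists_maximal_subring:
  fixes i :: "'f::field \<Rightarrow> 'k::field"
  assumes emb: "field_embedding i" and w: "inverse w \<notin> algebra_generated i {w}"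
  shows "\<exists>R. subring_of_field R \<and> range i \<subseteq> R \<and> w \<in> R \<and> inverse w \<notin> R \<and>
    (\<forall>R'. subring_of_field R' \<longrightarrow> R \<subseteq> R' \<longrightarrow> inverse w \<notin> R' \<longrightarrow> R' = R)"
proof -
  define \<A> where "\<A> = {R. subring_of_field R \<and> range i \<subseteq> R \<and> w \<in> R \<and> inverse w \<notin> R}"
  have "\<exists>M\<in>\<A>. \<forall>X\<in>\<A>. M \<subseteq> X \<longrightarrow> X = M"
  proof (rule subset_Zorn_nonempty)
    let ?R = "algebra_generated i {w}"
    have "x - y \<in> ?R" if x: "x \<in> ?R" and y: "y \<in> ?R" for x y
    proof -
      have "x + i (- 1) * y \<in> ?R"
        using x y by (intro algebra_generated.add algebra_generated.mult algebra_generated.const)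
      then show ?thesis
        by (simp add: field_embedding_minus field_embedding_1 emb)
    qed
    moreover have "1 \<in> ?R"
      using algebra_generated.const[of i 1 "{w}"] by (simp add: field_embedding_1 emb)
    ultimately have "?R \<in> \<A>"
      using w by (auto simp: \<A>_def subring_of_field_def intro: algebra_generated.intros)
    then show "\<A> \<noteq> {}" by blast
  next
    fix \<C> assume \<C>: "\<C> \<noteq> {}" "subset.chain \<A> \<C>"
    have sub: "\<C> \<subseteq> \<A>" and chain: "\<And>R S. R \<in> \<C> \<Longrightarrow> S \<in> \<C> \<Longrightarrow> R \<subseteq> S \<or> S \<subseteq> R"
      using \<C>(2) by (auto simp: subset.chain_def)
    have "x - y \<in> \<Union>\<C> \<and> x * y \<in> \<Union>\<C>" if xy: "x \<in> \<Union>\<C>" "y \<in> \<Union>\<C>" for x y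
    proof -
      obtain R S where RS: "R \<in> \<C>" "x \<in> R" "S \<in> \<C>" "y \<in> S" using xy by blast
      then obtain T where T: "T \<in> \<C>" "x \<in> T" "y \<in> T" using chain by blast
      then have "subring_of_field T" using sub by (auto simp: \<A>_def)
      then show ?thesis using T subring_diff subring_mult by blast
    qed
    then show "\<Union>\<C> \<in> \<A>"
      using \<C>(1) sub unfolding \<A>_def subring_of_field_def by blast
  qed
  then obtain M where M: "M \<in> \<A>" "\<And>X. X \<in> \<A> \<Longrightarrow> M \<subseteq> X \<Longrightarrow> X = M" by blast
  then show ?thesis
    unfolding \<A>_def by (intro exI[of _ M]) blast
qed

text \<open>The descent step in the classical construction of valuation rings. The relation in
  \<open>inverse u\<close> expresses \<open>u ^ n * (1 - w * b)\<close> by lower powers of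
  \<open>u\<close>, and after multiplication of the relation in \<open>u\<close> by
  \<open>1 - w * b\<close> this replaces the leading term.\<close>

lemma reduce_relation_degree:
  fixes u w :: "'k::field"
  assumes R: "subring_of_field R" and w: "w \<in> R" "inverse w \<notin> R" and u: "u \<noteq> 0"
    and p: "\<And>n. coeff p n \<in> R" "poly p u = inverse w"
    and q: "\<And>n. coeff q n \<in> R" "poly q (inverse u) = inverse w"
    and deg: "degree q \<le> degree p"
  shows "\<exists>p'. (\<forall>n. coeff p' n \<in> R) \<and> poly p' u = inverse w \<and> degree p' < degree p"
proof -
  have "w \<noteq> 0" using w by auto
  define n where "n = degree p"
  have "n \<noteq> 0"
  proof
    assume "n = 0"
    then obtain c where "p = [:c:]" using degree_eq_zeroE unfolding n_def by blast
    then show False using p(2) p(1)[of 0] w by simp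
  qed
  obtain b q1 where q1: "q = pCons b q1" by (cases q) auto
  have b: "b \<in> R" using q(1)[of 0] q1 by simp
  have q1_R: "coeff q1 k \<in> R" for k using q(1)[of "Suc k"] q1 by simp
  have deg_q1: "degree q1 \<le> n - 1"
    using deg q1 unfolding n_def by (cases "q1 = 0") auto
  \<comment> \<open>\<open>r\<close> is \<open>q1\<close> reversed, so that
    \<open>poly r u = u ^ (n - 1) * poly q1 (inverse u)\<close>, of degree below
    \<open>n\<close>.\<close>
  define r where "r = (\<Sum>k\<le>degree q1. monom (coeff q1 k) (n - 1 - k))"
  have r_R: "coeff r k \<in> R" for k
    unfolding r_def coeff_sum using q1_R subring_0[OF R] by (intro subring_sum[OF R]) auto
  have deg_r: "degree r < n"
    unfolding r_def using \<open>n \<noteq> 0\<close>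
    by (intro degree_sum_less) (auto intro: le_less_trans[OF degree_monom_le])
  have "u ^ (n - 1) * poly q1 (inverse u) = (\<Sum>k\<le>degree q1. coeff q1 k * (u ^ (n - 1) * inverse u ^ k))"
    by (simp add: poly_altdef sum_distrib_left mult_ac)
  also have "\<dots> = poly r u"
    unfolding r_def poly_sum poly_monom
  proof (rule sum.cong)
    fix k assume "k \<in> {..degree q1}"
    then have "k \<le> n - 1" using deg_q1 by simp
    then have "u ^ (n - 1) = u ^ (n - 1 - k) * u ^ k" by (metis le_add_diff_inverse2 power_add)
    then show "coeff q1 k * (u ^ (n - 1) * inverse u ^ k) = coeff q1 k * u ^ (n - 1 - k)"
      using u by (simp add: power_inverse)
  qed simp
  finally have poly_r: "u * poly r u = u ^ n * poly q1 (inverse u)"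
    using \<open>n \<noteq> 0\<close> by (cases n) (auto simp: mult_ac)
  have "inverse w = b + inverse u * poly q1 (inverse u)"
    using q(2) q1 by simp
  then have poly_q1: "w * poly q1 (inverse u) = u * (1 - w * b)"
    using u \<open>w \<noteq> 0\<close> by (simp add: field_simps)
  then have "u * (w * poly r u) = u * (u ^ n * (1 - w * b))"
    using poly_r by (metis mult.left_commute)
  \<comment> \<open>This is the relation in \<open>inverse u\<close> multiplied by
    \<open>w * u ^ n\<close>, with its constant term \<open>b\<close> moved across.\<close>
  then have wr: "w * poly r u = u ^ n * (1 - w * b)"
    using u by simp
  define a where "a = coeff p n"
  have a: "a \<in> R" using p(1) by (simp add: a_def)
  define p0 where "p0 = p - monom a n"
  have p0: "degree p0 < n"
  proof -
    have "degree p0 \<le> n" "coeff p0 n = 0"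
      unfolding p0_def a_def n_def by (auto intro!: degree_diff_le simp: degree_monom_le)
    then show ?thesis
      using \<open>n \<noteq> 0\<close> by (metis degree_0 le_neq_implies_less leading_coeff_0_iff neq0_conv)
  qed
  have p0_R: "coeff p0 k \<in> R" for k
    unfolding p0_def using p(1) a by (auto intro: subring_diff[OF R])
  have poly_p: "poly p u = poly p0 u + a * u ^ n"
    unfolding p0_def by (simp add: poly_monom)
  \<comment> \<open>Multiplication by \<open>1 - w * b\<close> turns the leading term of
    \<open>p\<close> into \<open>a * (w * poly r u)\<close> and the value \<open>inverse w\<close>
    into \<open>inverse w - b\<close>; \<open>b\<close> is added back.\<close>
  define p' where "p' = [:b:] + smult (1 - w * b) p0 + smult (w * a) r"
  have "poly p' u = b + (1 - w * b) * poly p0 u + a * (w * poly r u)"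
    unfolding p'_def by (simp add: mult_ac)
  also have "\<dots> = b + (1 - w * b) * poly p u"
    unfolding wr poly_p by (simp add: algebra_simps)
  also have "\<dots> = inverse w"
    unfolding p(2) using \<open>w \<noteq> 0\<close> by (simp add: field_simps)
  finally have "poly p' u = inverse w" .
  moreover have "degree p' < n"
    unfolding p'_def using p0 deg_r \<open>n \<noteq> 0\<close>
    by (intro degree_add_less) (auto intro: le_less_trans[OF degree_smult_le])
  moreover have "coeff p' k \<in> R" for k
  proof -
    have "coeff [:b:] k \<in> R"
      using b subring_0[OF R] by (cases k) auto
    then show ?thesis
      unfolding p'_def using p0_R r_R a b w
      by (auto intro!: subring_add[OF R] subring_mult[OF R] subring_diff[OF R] subring_1[OF R])
  qed
  ultimately show ?thesis
    unfolding n_def by blast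
qed

text \<open>Otherwise, by maximality, adjoining \<open>u\<close> or \<open>inverse u\<close>
  produces \<open>inverse w\<close>, which gives relations in both. In a pair of least total degree,
  the relation whose degree is not the smaller one could still be lowered.\<close>

lemma maximal_subring_valuation_ring:
  fixes w :: "'k::field"
  assumes R: "subring_of_field R" and w: "w \<in> R" "inverse w \<notin> R"
    and max: "\<And>R'. subring_of_field R' \<Longrightarrow> R \<subseteq> R' \<Longrightarrow> inverse w \<notin> R' \<Longrightarrow> R' = R"
    and u: "u \<noteq> 0"
  shows "u \<in> R \<or> inverse u \<in> R"
proof (rule ccontr)
  assume contr: "\<not> (u \<in> R \<or> inverse u \<in> R)"
  define rel where "rel p u \<longleftrightarrow> (\<forall>n. coeff p n \<in> R) \<and> poly p u = inverse w" for p u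
  have ex: "\<exists>p. rel p v" if "v \<notin> R" for v
  proof -
    have "inverse w \<in> adjoin R v"
      using max[of "adjoin R v"] subring_adjoin[OF R, of v] that by blast
    then show ?thesis by (auto simp: adjoin_def rel_def)
  qed
  let ?P = "\<lambda>(p, q). rel p u \<and> rel q (inverse u)"
  obtain p0 q0 where "?P (p0, q0)" using ex contr by blast
  then obtain pq where "?P pq" and min: "\<And>y. ?P y \<Longrightarrow>
      degree (fst pq) + degree (snd pq) \<le> degree (fst y) + degree (snd y)"
    using ex_has_least_nat[of ?P "(p0, q0)" "\<lambda>y. degree (fst y) + degree (snd y)"] by blast
  then obtain p q where pq: "rel p u" "rel q (inverse u)"
    and min: "\<And>p' q'. rel p' u \<Longrightarrow> rel q' (inverse u) \<Longrightarrow> degree p + degree q \<le> degree p' + degree q'"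
    by (cases pq) fastforce
  show False
  proof (cases "degree q \<le> degree p")
    case True
    then obtain p' where "rel p' u" "degree p' < degree p"
      using reduce_relation_degree[OF R w u, of p q] pq unfolding rel_def by blast
    then show False using min[OF _ pq(2), of p'] by simp
  next
    case False
    then obtain q' where "rel q' (inverse u)" "degree q' < degree q"
      using reduce_relation_degree[OF R w, of "inverse u" q p] pq u unfolding rel_def by auto
    then show False using min[OF pq(1), of q'] by simp
  qed
qed


section \<open>Finite quotients make a valuation ring discrete\<close>

lemma valuation_ring_one_minus_unit:
  assumes R: "subring_of_field R" and val: "\<And>u. u \<noteq> 0 \<Longrightarrow> u \<in> R \<or> inverse u \<in> R"
    and x: "x \<in> R" "x = 0 \<or> inverse x \<notin> R"
  shows "1 - x \<noteq> 0 \<and> inverse (1 - x) \<in> R"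
proof (cases "x = 0")
  case True
  then show ?thesis using subring_1[OF R] by simp
next
  case False
  have "x \<noteq> 1" using x subring_1[OF R] by auto
  define y where "y = 1 - x"
  have y: "y \<noteq> 0" using \<open>x \<noteq> 1\<close> by (simp add: y_def)
  \<comment> \<open>One of the two quotients of \<open>x\<close> and \<open>1 - x\<close> lies in
    the ring; the second alternative would make \<open>x\<close> a unit.\<close>
  consider "x / y \<in> R" | "y / x \<in> R"
    using val[of "x / y"] False y by fastforce
  then show ?thesis
  proof cases
    case 1
    have "inverse y = 1 + x / y" using y unfolding y_def by (simp add: field_simps)
    then show ?thesis
      using 1 y subring_add[OF R subring_1[OF R] 1] unfolding y_def by simp
  next
    case 2
    have "inverse x = 1 + y / x" using False unfolding y_def by (simp add: field_simps)
    then show ?thesis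
      using x False subring_add[OF R subring_1[OF R] 2] by simp
  qed
qed

text \<open>A nonunit \<open>x = e + w * y\<close> has a nonunit representative \<open>e\<close>. So
  a uniformizer only has to divide \<open>w\<close> and the finitely many nonunits in
  \<open>E\<close>, and since divisibility is total, one of these divides all others.\<close>

lemma valuation_ring_uniformizer:
  fixes w :: "'k::field"
  assumes R: "subring_of_field R" and val: "\<And>u. u \<noteq> 0 \<Longrightarrow> u \<in> R \<or> inverse u \<in> R"
    and w: "w \<in> R" "w \<noteq> 0" "inverse w \<notin> R"
    and E: "finite E" "E \<subseteq> R" "\<And>x. x \<in> R \<Longrightarrow> \<exists>e\<in>E. \<exists>y\<in>R. x = e + w * y"
  shows "\<exists>\<pi>\<in>R. \<pi> \<noteq> 0 \<and> inverse \<pi> \<notin> R \<and> (\<forall>x\<in>R. x = 0 \<or> inverse x \<notin> R \<longrightarrow> x / \<pi> \<in> R)"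
proof -
  \<comment> \<open>Including \<open>w\<close> makes the set nonempty and lets \<open>\<pi>\<close>
    divide \<open>w\<close>.\<close>
  define cand where "cand = {e \<in> insert w E. e \<noteq> 0 \<and> inverse e \<notin> R}"
  have least: "\<exists>\<pi>\<in>X. \<forall>e\<in>X. e / \<pi> \<in> R" if "finite X" "X \<noteq> {}" "0 \<notin> X" for X
    using that
  proof (induction rule: finite_ne_induct)
    case (singleton x)
    then show ?case using subring_1[OF R] by auto
  next
    case (insert x X)
    then obtain \<pi> where \<pi>: "\<pi> \<in> X" "\<And>e. e \<in> X \<Longrightarrow> e / \<pi> \<in> R" by auto
    have nz: "\<pi> \<noteq> 0" "x \<noteq> 0" using \<pi> insert.prems by auto
    consider "x / \<pi> \<in> R" | "\<pi> / x \<in> R"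
      using val[of "x / \<pi>"] nz by fastforce
    then show ?case
    proof cases
      case 1
      then show ?thesis using \<pi> by auto
    next
      case 2
      have "e / x \<in> R" if "e \<in> X" for e
        using subring_mult[OF R \<pi>(2)[OF that] 2] nz by simp
      then show ?thesis using nz subring_1[OF R] by auto
    qed
  qed
  have "cand \<noteq> {}" "finite cand" "0 \<notin> cand"
    using w E by (auto simp: cand_def)
  then obtain \<pi> where \<pi>: "\<pi> \<in> cand" "\<And>e. e \<in> cand \<Longrightarrow> e / \<pi> \<in> R"
    using least[of cand] by blast
  have "x / \<pi> \<in> R" if x: "x \<in> R" "x = 0 \<or> inverse x \<notin> R" for x
  proof -
    obtain e y where e: "e \<in> E" and y: "y \<in> R" and xe: "x = e + w * y"
      using E(3)[OF x(1)] by blast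
    have "w / \<pi> \<in> R" using \<pi> w by (auto simp: cand_def)
    then have wy: "w * y / \<pi> \<in> R" using subring_mult[OF R _ y] by fastforce
    \<comment> \<open>If \<open>e\<close> were a unit, \<open>x * inverse e\<close> would be a
      nonunit, so \<open>1 - x * inverse e = - w * y * inverse e\<close> would be a unit, and then
      \<open>w\<close> as well.\<close>
    have "e = 0 \<or> inverse e \<notin> R"
    proof (rule ccontr)
      assume "\<not> ?thesis"
      then have e': "e \<noteq> 0" "inverse e \<in> R" by auto
      have "x * inverse e \<in> R" using x e' subring_mult[OF R] by blast
      moreover have "x * inverse e = 0 \<or> inverse (x * inverse e) \<notin> R"
      proof (rule ccontr)
        assume "\<not> ?thesis"
        then have nz: "x \<noteq> 0" and "inverse (x * inverse e) \<in> R" by auto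
        then have "inverse (x * inverse e) * inverse e \<in> R"
          using e' subring_mult[OF R] by blast
        moreover have "inverse (x * inverse e) * inverse e = inverse x"
          using e' nz by (simp add: field_simps)
        ultimately have "inverse x \<in> R" by (simp only:)
        then show False using nz x by simp
      qed
      ultimately have *: "1 - x * inverse e \<noteq> 0" "inverse (1 - x * inverse e) \<in> R"
        using valuation_ring_one_minus_unit[OF R val] by auto
      define t where "t = 1 - x * inverse e"
      have "t = - (w * (y * inverse e))"
        using e' xe by (simp add: t_def field_simps)
      then have "w * (- (y * inverse e * inverse t)) = t * inverse t"
        by (simp add: mult.assoc)
      then have "w * (- (y * inverse e * inverse t)) = 1"
        using * by (simp add: t_def)
      then have "inverse w = - (y * inverse e * inverse t)"
        by (rule inverse_unique)
      also have "\<dots> \<in> R"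
        using y e' * unfolding t_def by (intro subring_minus[OF R] subring_mult[OF R])
      finally show False using w by simp
    qed
    then have "e / \<pi> \<in> R"
      using \<pi>(2)[of e] e subring_0[OF R] by (cases "e = 0") (auto simp: cand_def)
    then show ?thesis
      using subring_add[OF R _ wy] xe by (simp add: add_divide_distrib)
  qed
  then show ?thesis
    using \<pi> E w by (intro bexI[of _ \<pi>]) (auto simp: cand_def)
qed

text \<open>Two powers \<open>\<pi> ^ a\<close> and \<open>\<pi> ^ b\<close> with
  \<open>a < b\<close> agree modulo \<open>x\<close>, as there are finitely many classes. If every
  power of \<open>\<pi>\<close> divided \<open>x\<close>, then \<open>\<pi> ^ Suc a\<close> would
  divide \<open>\<pi> ^ a * (1 - \<pi> ^ (b - a))\<close>, and \<open>\<pi>\<close> would be a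
  unit.\<close>

lemma uniformizer_archimedean:
  assumes R: "subring_of_field R" and \<pi>: "\<pi> \<in> R" "\<pi> \<noteq> 0" "inverse \<pi> \<notin> R"
    and E: "finite E" "\<And>y. y \<in> R \<Longrightarrow> \<exists>e\<in>E. \<exists>z\<in>R. y = e + x * z"
  shows "\<exists>n. x / \<pi> ^ n \<notin> R"
proof (rule ccontr)
  assume "\<not> ?thesis"
  then have div: "x / \<pi> ^ n \<in> R" for n by blast
  have "\<exists>e\<in>E. \<exists>z\<in>R. \<pi> ^ n = e + x * z" for n
    using E(2) subring_power[OF R \<pi>(1)] by blast
  then obtain e z where e: "\<And>n. e n \<in> E" and z: "\<And>n. z n \<in> R" and ez: "\<And>n. \<pi> ^ n = e n + x * z n"
    by metis
  have "\<not> inj e"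
    using E(1) e finite_subset[of "range e" E] finite_imageD[of e UNIV] by auto
  then obtain a b where ab: "e a = e b" "a < b"
    by (metis injI linorder_neqE_nat)
  have "\<pi> ^ a - \<pi> ^ b = x * (z a - z b)"
    using ez[of a] ez[of b] ab by (simp add: algebra_simps)
  moreover have "\<pi> ^ b = \<pi> ^ a * \<pi> * \<pi> ^ (b - Suc a)"
    using ab(2) by (metis Suc_leI le_add_diff_inverse power_Suc2 power_add)
  ultimately have "\<pi> ^ a * (1 - \<pi> * \<pi> ^ (b - Suc a)) = x * (z a - z b)"
    by (simp add: algebra_simps)
  then have "\<pi> * (x / \<pi> ^ Suc a * (z a - z b)) = \<pi> * (\<pi> ^ a * (1 - \<pi> * \<pi> ^ (b - Suc a))) / \<pi> ^ Suc a"
    by simp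
  also have "\<dots> = 1 - \<pi> * \<pi> ^ (b - Suc a)"
    using \<pi>(2) by simp
  finally have "1 - \<pi> * \<pi> ^ (b - Suc a) = \<pi> * (x / \<pi> ^ Suc a * (z a - z b))" ..
  then have "1 = \<pi> * (\<pi> ^ (b - Suc a) + x / \<pi> ^ Suc a * (z a - z b))"
    by (simp add: algebra_simps)
  then have "inverse \<pi> = \<pi> ^ (b - Suc a) + x / \<pi> ^ Suc a * (z a - z b)"
    by (metis inverse_unique)
  also have "\<dots> \<in> R"
    using div \<pi> z by (intro subring_add[OF R] subring_mult[OF R] subring_power[OF R] subring_diff[OF R])
  finally show False using \<pi> by simp
qed

text \<open>Every nonzero element is a unit times a unique power of \<open>\<pi>\<close>, whose
  exponent is the valuation. The value at 0 is the dummy prescribed by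
  \<open>closed_points\<close>.\<close>

lemma discrete_valuation_of_uniformizer:
  assumes R: "subring_of_field R" and val: "\<And>u. u \<noteq> 0 \<Longrightarrow> u \<in> R \<or> inverse u \<in> R"
    and \<pi>: "\<pi> \<in> R" "\<pi> \<noteq> 0" "inverse \<pi> \<notin> R" "\<And>x. x \<in> R \<Longrightarrow> x = 0 \<or> inverse x \<notin> R \<Longrightarrow> x / \<pi> \<in> R"
    and arch: "\<And>x. x \<in> R \<Longrightarrow> x \<noteq> 0 \<Longrightarrow> \<exists>n. x / \<pi> ^ n \<notin> R"
  shows "\<exists>v::_ \<Rightarrow> int. v 0 = 0 \<and> v \<pi> = 1 \<and>
    (\<forall>x y. x \<noteq> 0 \<longrightarrow> y \<noteq> 0 \<longrightarrow> v (x * y) = v x + v y) \<and>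
    (\<forall>x y. x \<noteq> 0 \<longrightarrow> y \<noteq> 0 \<longrightarrow> x + y \<noteq> 0 \<longrightarrow> v (x + y) \<ge> min (v x) (v y)) \<and>
    (\<forall>x. x \<noteq> 0 \<longrightarrow> x \<in> R \<longrightarrow> v x \<ge> 0) \<and>
    (\<forall>x. x \<noteq> 0 \<longrightarrow> x \<in> R \<longrightarrow> (v x = 0 \<longleftrightarrow> inverse x \<in> R))"
proof -
  define U where "U = {u \<in> R. u \<noteq> 0 \<and> inverse u \<in> R}"
  have U_mult: "x * y \<in> U" if "x \<in> U" "y \<in> U" for x y
    using that subring_mult[OF R] by (auto simp: U_def)
  have U_inverse: "inverse x \<in> U" if "x \<in> U" for x
    using that by (auto simp: U_def)
  have no_unit: "\<pi> ^ Suc n \<notin> U" for n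
  proof
    assume "\<pi> ^ Suc n \<in> U"
    then have "\<pi> ^ n * inverse (\<pi> ^ Suc n) \<in> R"
      using subring_power[OF R \<pi>(1)] subring_mult[OF R] by (auto simp: U_def)
    moreover have "\<pi> ^ n * inverse (\<pi> ^ Suc n) = inverse \<pi>"
      using \<pi>(2) by (simp add: field_simps)
    ultimately have "inverse \<pi> \<in> R" by (simp only:)
    then show False using \<pi> by simp
  qed
  have factor_R: "\<exists>n. x / \<pi> ^ n \<in> U" if x: "x \<in> R" "x \<noteq> 0" for x
  proof -
    \<comment> \<open>The quotient by the last power of \<open>\<pi>\<close> that divides
      \<open>x\<close> is a unit, since a nonunit could be divided by \<open>\<pi>\<close> once
      more.\<close>
    define n where "n = (LEAST n. x / \<pi> ^ n \<notin> R)"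
    have n: "x / \<pi> ^ n \<notin> R" unfolding n_def using arch[OF x] by (metis LeastI)
    then obtain m where m: "n = Suc m" using x by (cases n) auto
    have mR: "x / \<pi> ^ m \<in> R" using not_less_Least[of m "\<lambda>n. x / \<pi> ^ n \<notin> R"] m unfolding n_def by auto
    have "inverse (x / \<pi> ^ m) \<in> R"
    proof (rule ccontr)
      assume "inverse (x / \<pi> ^ m) \<notin> R"
      then have "x / \<pi> ^ m / \<pi> \<in> R" using \<pi>(4) mR by blast
      then show False using n m by (simp add: field_simps)
    qed
    then show ?thesis using mR x \<pi> by (auto simp: U_def)
  qed
  have factor: "\<exists>n::int. x / \<pi> powi n \<in> U" if x: "x \<noteq> 0" for x
  proof (cases "x \<in> R")
    case True
    then obtain n where "x / \<pi> ^ n \<in> U" using factor_R x by blast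
    then show ?thesis by (intro exI[of _ "int n"]) simp
  next
    case False
    then obtain n where "inverse x / \<pi> ^ n \<in> U" using factor_R val[OF x] x by fastforce
    then have "inverse (inverse x / \<pi> ^ n) \<in> U" by (rule U_inverse)
    then show ?thesis
      using x by (intro exI[of _ "- int n"]) (simp add: power_int_minus field_simps)
  qed
  have unique: "m = n" if x: "x \<noteq> 0" and m: "x / \<pi> powi m \<in> U" and n: "x / \<pi> powi n \<in> U" for x and m n :: int
  proof -
    have False if "a < b" and a: "x / \<pi> powi a \<in> U" and b: "x / \<pi> powi b \<in> U" for a b :: int
    proof -
      have "x / \<pi> powi a * inverse (x / \<pi> powi b) \<in> U"
        using a b by (intro U_mult U_inverse)
      also have "x / \<pi> powi a * inverse (x / \<pi> powi b) = \<pi> powi (b - a)"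
        using x \<pi> by (simp add: power_int_diff field_simps)
      also have "\<dots> = \<pi> ^ Suc (nat (b - a) - 1)"
        using \<open>a < b\<close> by (simp add: power_int_def)
      finally show False using no_unit by blast
    qed
    then show ?thesis using m n by (metis linorder_neqE)
  qed
  define v where "v x = (if x = 0 then 0 else THE n. x / \<pi> powi n \<in> U)" for x
  have v_eq: "v x = n" if "x \<noteq> 0" "x / \<pi> powi n \<in> U" for x n
    unfolding v_def using that unique by (auto intro!: the_equality)
  have v: "x / \<pi> powi v x \<in> U" if "x \<noteq> 0" for x
    using factor[OF that] v_eq[OF that] by blast
  have v_nonneg: "v x \<ge> 0" if x: "x \<in> R" "x \<noteq> 0" for x
  proof -
    obtain n where "x / \<pi> ^ n \<in> U" using factor_R[OF x] by blast
    then have "v x = int n" using x by (intro v_eq) auto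
    then show ?thesis by simp
  qed
  have v_mult: "v (x * y) = v x + v y" if "x \<noteq> 0" "y \<noteq> 0" for x y
  proof (rule v_eq)
    show "x * y / \<pi> powi (v x + v y) \<in> U"
      using U_mult[OF v[OF that(1)] v[OF that(2)]] \<pi> by (simp add: power_int_add)
  qed (use that in simp)
  have v_\<pi>: "v \<pi> = 1"
    using \<pi> subring_1[OF R] by (intro v_eq) (auto simp: U_def)
  have v_powi: "v (\<pi> powi n) = n" for n
    using \<pi> subring_1[OF R] by (intro v_eq) (auto simp: U_def)
  have add_aux: "v (x + y) \<ge> v x" if nz: "x \<noteq> 0" "y \<noteq> 0" "x + y \<noteq> 0" and le: "v x \<le> v y" for x y
  proof -
    \<comment> \<open>\<open>x + y\<close> divided by the smaller of the two powers of
      \<open>\<pi>\<close>; it lies in the ring and therefore has nonnegative valuation.\<close>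
    define r where "r = x / \<pi> powi v x + \<pi> ^ nat (v y - v x) * (y / \<pi> powi v y)"
    have "\<pi> powi v y = \<pi> powi v x * \<pi> ^ nat (v y - v x)"
      using le \<pi> power_int_add[of \<pi> "v x" "v y - v x"] by (simp add: power_int_def)
    then have xy: "x + y = \<pi> powi v x * r"
      unfolding r_def using \<pi> by (simp add: field_simps)
    have "r \<in> R"
      unfolding r_def using v nz \<pi>
      by (intro subring_add[OF R] subring_mult[OF R] subring_power[OF R]) (auto simp: U_def)
    moreover have "r \<noteq> 0" using xy nz by auto
    ultimately show ?thesis
      using v_nonneg[of r] v_mult[of "\<pi> powi v x" r] v_powi \<pi> xy by simp
  qed
  have "v (x + y) \<ge> min (v x) (v y)" if "x \<noteq> 0" "y \<noteq> 0" "x + y \<noteq> 0" for x y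
    using add_aux[of x y] add_aux[of y x] that by (cases "v x \<le> v y") (auto simp: add.commute)
  moreover have "v x = 0 \<longleftrightarrow> inverse x \<in> R" if x: "x \<in> R" "x \<noteq> 0" for x
  proof
    assume "v x = 0" then show "inverse x \<in> R" using v[OF x(2)] by (simp add: U_def)
  next
    assume "inverse x \<in> R" then show "v x = 0" using x by (intro v_eq) (auto simp: U_def)
  qed
  moreover have "v 0 = 0" by (simp add: v_def)
  ultimately show ?thesis
    using v_\<pi> v_mult v_nonneg by (intro exI[of _ v]) auto
qed

text \<open>The valuation of the maximal ring is trivial on constants, because the ring contains the
  field F_q, and positive at \<open>w\<close>, which is a nonunit of the ring.\<close>

lemma exists_zero_of_nonunit:
  fixes i :: "'f::{field,finite} \<Rightarrow> 'k::field"
  assumes curve: "curve_function_field i" and w: "w \<noteq> 0" "inverse w \<notin> algebra_generated i {w}"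
  shows "\<exists>v\<in>closed_points i. v w > 0"
proof -
  have emb: "field_embedding i"
    using curve by (simp add: curve_function_field_def)
  obtain R where R: "subring_of_field R" and iR: "range i \<subseteq> R" and wR: "w \<in> R" "inverse w \<notin> R"
    and max: "\<And>R'. subring_of_field R' \<Longrightarrow> R \<subseteq> R' \<Longrightarrow> inverse w \<notin> R' \<Longrightarrow> R' = R"
    using exists_maximal_subring[OF emb w(2)] by blast
  have val: "u \<in> R \<or> inverse u \<in> R" if "u \<noteq> 0" for u
    using maximal_subring_valuation_ring[OF R wR max that] by blast
  have quot: "\<exists>E. finite E \<and> E \<subseteq> R \<and> (\<forall>y\<in>R. \<exists>e\<in>E. \<exists>z\<in>R. y = e + x * z)"
    if "x \<in> R" "x \<noteq> 0" for x
    using curve that(2) subring_0[OF R] subring_diff[OF R] subring_mult[OF R that(1)]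
    by (rule finite_quotient)
  obtain E where E: "finite E" "E \<subseteq> R" "\<forall>x\<in>R. \<exists>e\<in>E. \<exists>y\<in>R. x = e + w * y"
    using quot[OF wR(1) w(1)] by (elim exE conjE)
  have "\<exists>\<pi>\<in>R. \<pi> \<noteq> 0 \<and> inverse \<pi> \<notin> R \<and> (\<forall>x\<in>R. x = 0 \<or> inverse x \<notin> R \<longrightarrow> x / \<pi> \<in> R)"
    by (rule valuation_ring_uniformizer[OF R _ wR(1) w(1) wR(2) E(1,2)]) (use E(3) val in auto)
  then obtain \<pi> where "\<pi> \<in> R" "\<pi> \<noteq> 0" "inverse \<pi> \<notin> R"
      "\<forall>x\<in>R. x = 0 \<or> inverse x \<notin> R \<longrightarrow> x / \<pi> \<in> R"
    by blast
  then have \<pi>: "\<pi> \<in> R" "\<pi> \<noteq> 0" "inverse \<pi> \<notin> R"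
      "x \<in> R \<Longrightarrow> x = 0 \<or> inverse x \<notin> R \<Longrightarrow> x / \<pi> \<in> R" for x
    by metis+
  have arch: "\<exists>n. x / \<pi> ^ n \<notin> R" if x: "x \<in> R" "x \<noteq> 0" for x
  proof -
    obtain E where "finite E" "\<forall>y\<in>R. \<exists>e\<in>E. \<exists>z\<in>R. y = e + x * z"
      using quot[OF x] by (elim exE conjE)
    then show ?thesis
      by (intro uniformizer_archimedean[OF R \<pi>(1-3)]) auto
  qed
  obtain v :: "'k \<Rightarrow> int" where v: "v 0 = 0" "v \<pi> = 1"
      "\<forall>x y. x \<noteq> 0 \<longrightarrow> y \<noteq> 0 \<longrightarrow> v (x * y) = v x + v y"
      "\<forall>x y. x \<noteq> 0 \<longrightarrow> y \<noteq> 0 \<longrightarrow> x + y \<noteq> 0 \<longrightarrow> v (x + y) \<ge> min (v x) (v y)"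
      "\<forall>x. x \<noteq> 0 \<longrightarrow> x \<in> R \<longrightarrow> v x \<ge> 0"
      "\<forall>x. x \<noteq> 0 \<longrightarrow> x \<in> R \<longrightarrow> (v x = 0 \<longleftrightarrow> inverse x \<in> R)"
    by (atomize_elim, rule discrete_valuation_of_uniformizer[OF R _ \<pi>(1-3)]) (use val \<pi>(4) arch in auto)
  have "v (i a) = 0" if "a \<noteq> 0" for a
  proof -
    have "i a \<noteq> 0" "inverse (i a) = i (inverse a)"
      using that by (auto simp: field_embedding_eq_0_iff field_embedding_inverse emb)
    then show ?thesis
      using v(6)[rule_format, of "i a"] iR by auto
  qed
  then have "v \<in> closed_points i"
    unfolding closed_points_def using v(1-4) \<pi>(2) by blast
  moreover have "v w > 0"
    using v(5)[rule_format, of w] v(6)[rule_format, of w] w wR by simp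
  ultimately show ?thesis by blast
qed

section \<open>Elements without poles are constant\<close>

lemma algebra_generated_inverse_algebraic:
  fixes i :: "'f::field \<Rightarrow> 'k::field"
  assumes emb: "field_embedding i" and z: "z \<noteq> 0" and y: "y \<in> algebra_generated i {inverse z}"
  shows "\<exists>n p. degree p \<le> n \<and> z ^ n * y = poly (map_poly i p) z"
  using y
proof induction
  case (const a)
  show ?case
    by (intro exI[of _ 0] exI[of _ "[:a:]"]) (simp add: map_poly_pCons field_embedding_0 emb)
next
  case (gen g)
  then show ?case
    using z by (intro exI[of _ 1] exI[of _ 1]) (simp add: field_embedding_1 emb)
next
  case (add x y)
  then obtain n p m q where p: "degree p \<le> n" "z ^ n * x = poly (map_poly i p) z"
    and q: "degree q \<le> m" "z ^ m * y = poly (map_poly i q) z" by blast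
  have "z ^ (n + m) * (x + y) = z ^ m * (z ^ n * x) + z ^ n * (z ^ m * y)"
    by (simp add: power_add algebra_simps)
  also have "\<dots> = poly (map_poly i (monom 1 m * p) + map_poly i (monom 1 n * q)) z"
    unfolding p q using emb
    by (simp add: map_poly_embedding_mult map_poly_monom field_embedding_0 field_embedding_1 poly_monom)
  also have "map_poly i (monom 1 m * p) + map_poly i (monom 1 n * q) = map_poly i (monom 1 m * p + monom 1 n * q)"
    by (rule poly_eqI) (simp only: coeff_map_poly coeff_add field_embedding_0 field_embedding_add emb)
  finally show ?case
    using p q
    by (intro exI[of _ "n + m"] exI[of _ "monom 1 m * p + monom 1 n * q"] conjI degree_add_le)
      (auto intro!: order_trans[OF degree_mult_le] simp: degree_monom_eq)
next
  case (mult x y)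
  then obtain n p m q where p: "degree p \<le> n" "z ^ n * x = poly (map_poly i p) z"
    and q: "degree q \<le> m" "z ^ m * y = poly (map_poly i q) z" by blast
  have "z ^ (n + m) * (x * y) = (z ^ n * x) * (z ^ m * y)"
    by (simp add: power_add mult_ac)
  also have "\<dots> = poly (map_poly i (p * q)) z"
    unfolding p q by (simp add: map_poly_embedding_mult emb)
  finally show ?case
    using p q degree_mult_le[of p q] by (intro exI[of _ "n + m"] exI[of _ "p * q"]) auto
qed

text \<open>The minimal polynomial over F_q stays irreducible over the function field, where it has
  the linear factor \<open>[:- z, 1:]\<close>; so it has degree 1.\<close>

lemma algebraic_imp_constant:
  fixes i :: "'f::field \<Rightarrow> 'k::field"
  assumes emb: "field_embedding i" and irr: "geometrically_irreducible i"
    and p: "p \<noteq> 0" "poly (map_poly i p) z = 0"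
  shows "z \<in> range i"
proof -
  obtain p where p: "p \<noteq> 0" "poly (map_poly i p) z = 0"
    and min: "\<And>q. q \<noteq> 0 \<Longrightarrow> poly (map_poly i q) z = 0 \<Longrightarrow> degree p \<le> degree q"
    using ex_has_least_nat[of "\<lambda>p. p \<noteq> 0 \<and> poly (map_poly i p) z = 0" p degree] p by blast
  have nonconst: "degree p \<noteq> 0"
  proof
    assume "degree p = 0"
    then obtain c where c: "p = [:c:]" by (rule degree_eq_zeroE)
    then have "poly (map_poly i p) z = i c" by (simp add: map_poly_pCons field_embedding_0 emb)
    then show False using p c by (simp add: field_embedding_eq_0_iff emb)
  qed
  have "irreducible p"
  proof (rule irreducibleI)
    fix a b assume ab: "p = a * b"
    then have nz: "a \<noteq> 0" "b \<noteq> 0" using p by auto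
    have deg: "degree p = degree a + degree b" using ab nz by (simp add: degree_mult_eq)
    have "poly (map_poly i a) z = 0 \<or> poly (map_poly i b) z = 0"
      using p(2) ab by (simp add: map_poly_embedding_mult emb)
    then have "degree a = 0 \<or> degree b = 0" using min nz deg by fastforce
    then show "a dvd 1 \<or> b dvd 1" using nz by (auto simp: is_unit_iff_degree)
  qed (use p nonconst in \<open>auto simp: is_unit_iff_degree\<close>)
  then have irr: "irreducible (map_poly i p)"
    using irr by (simp add: geometrically_irreducible_def)
  obtain q where q: "map_poly i p = [:- z, 1:] * q"
    using p(2) by (auto simp: poly_eq_0_iff_dvd)
  have "\<not> [:- z, 1:] dvd 1" by (simp add: is_unit_iff_degree)
  then have "q dvd 1" using irreducibleD[OF irr q] by blast
  moreover have "q \<noteq> 0" using irr q by auto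
  ultimately have "degree (map_poly i p) = 1"
    unfolding q by (subst degree_mult_eq) (auto simp: is_unit_iff_degree)
  then have "degree p = 1" by (simp add: degree_map_poly_embedding emb)
  then obtain a b where ab: "p = [:a, b:]" "b \<noteq> 0"
    by (metis degree_eq_zeroE degree_pCons_eq_if nat.inject One_nat_def pCons_cases pCons_0_0 zero_neq_one)
  have "z * i b = - i a"
    using p(2) ab by (simp add: map_poly_pCons field_embedding_0 emb eq_neg_iff_add_eq_0 add.commute)
  moreover have "i b \<noteq> 0"
    using ab by (simp add: field_embedding_eq_0_iff emb)
  ultimately have "z = - i a * inverse (i b)"
    by (simp add: field_simps)
  also have "\<dots> = i (- a * inverse b)"
    by (simp only: field_embedding_mult field_embedding_minus field_embedding_inverse emb)
  finally show ?thesis by blast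
qed

text \<open>If \<open>z\<close> were not a polynomial in \<open>inverse z\<close>, then
  \<open>inverse z\<close> would vanish at some place and \<open>z\<close> would have a pole there.
  So it is one, and clearing denominators makes \<open>z\<close> algebraic over F_q.\<close>

lemma no_poles_imp_constant:
  fixes i :: "'f::{field,finite} \<Rightarrow> 'k::field"
  assumes curve: "curve_function_field i" and irr: "geometrically_irreducible i"
    and no_poles: "\<And>v. v \<in> closed_points i \<Longrightarrow> v z \<ge> 0"
  shows "z \<in> range i"
proof (cases "z = 0")
  case True
  then show ?thesis
    using curve field_embedding_0[of i] by (metis curve_function_field_def rangeI)
next
  case False
  have emb: "field_embedding i"
    using curve by (simp add: curve_function_field_def)
  have "z \<in> algebra_generated i {inverse z}"
  proof (rule ccontr)
    assume "z \<notin> algebra_generated i {inverse z}"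
    then obtain v where v: "v \<in> closed_points i" "v (inverse z) > 0"
      using exists_zero_of_nonunit[OF curve, of "inverse z"] False by auto
    have mult: "v (x * y) = v x + v y" if "x \<noteq> 0" "y \<noteq> 0" for x y
      using v that by (auto simp: closed_points_def)
    have "v z + v (inverse z) = v 1"
      using mult[of z "inverse z"] False by simp
    moreover have "v 1 = 0" using mult[of 1 1] by simp
    ultimately show False using no_poles[OF v(1)] v(2) by simp
  qed
  then obtain n p where p: "degree p \<le> n" "z ^ n * z = poly (map_poly i p) z"
    using algebra_generated_inverse_algebraic[OF emb False] by blast
  \<comment> \<open>As \<open>degree p \<le> n\<close>, the term of degree \<open>n + 1\<close>
    survives, and the relation is not trivial.\<close>
  define q where "q = monom 1 (Suc n) - p"
  have "map_poly i q = map_poly i (monom 1 (Suc n)) - map_poly i p"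
    unfolding q_def by (rule poly_eqI) (simp only: coeff_map_poly coeff_diff field_embedding_0 field_embedding_diff emb)
  then have "poly (map_poly i q) z = 0"
    using p(2) by (simp add: map_poly_monom field_embedding_0 field_embedding_1 emb poly_monom mult.commute)
  moreover have "coeff q (Suc n) = 1"
    using p(1) by (simp add: q_def coeff_eq_0)
  then have "q \<noteq> 0" by auto
  ultimately show ?thesis
    using algebraic_imp_constant[OF emb irr] by blast
qed

section \<open>Summation over nonarchimedean fields\<close>

lemma absval_nonneg [simp]: "absval x \<ge> 0"
  by (simp add: absval_def)

lemma absval_0 [simp]: "absval 0 = 0"
  by (simp add: absval_def)

lemma absval_eq_0_iff [simp]: "absval x = 0 \<longleftrightarrow> x = 0"
  by (simp add: absval_def)

lemma absval_pos: "x \<noteq> 0 \<Longrightarrow> absval x > 0"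
  using absval_nonneg[of x] absval_eq_0_iff[of x] by linarith

lemma absval_mult: "absval (x * y) = absval x * absval y"
  by (simp add: absval_def dist_mult)

lemma absval_1 [simp]: "absval (1 :: 'c::complete_nonarch_field) = 1"
  using absval_mult[of 1 "1 :: 'c"] by (simp add: mult_cancel_left1[of "absval 1", simplified])

lemma absval_add_le: "absval (x + y) \<le> max (absval x) (absval y)"
  by (simp add: absval_def dist_ultrametric)

lemma dist_eq_absval: "dist x y = absval (x - y)"
  unfolding absval_def by (rule dist_eq_dist_diff)

lemma absval_minus [simp]: "absval (- x) = absval x"
  using dist_eq_absval[of 0 x] dist_eq_absval[of x 0] by (simp add: dist_commute)

lemma absval_diff_le: "absval (x - y) \<le> max (absval x) (absval y)"
  using absval_add_le[of x "- y"] by simp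

lemma absval_inverse: "absval (inverse x) = inverse (absval x)"
proof (cases "x = 0")
  case False
  then have "absval x * absval (inverse x) = 1"
    by (simp add: absval_mult[symmetric])
  then show ?thesis
    by (metis inverse_unique)
qed simp

lemma absval_power: "absval (x ^ n) = absval x ^ n"
  by (induction n) (auto simp: absval_mult)

lemma absval_prod: "absval (\<Prod>s\<in>S. f s) = (\<Prod>s\<in>S. absval (f s))"
  by (induction S rule: infinite_finite_induct) (auto simp: absval_mult)

lemma absval_sum_le:
  assumes "\<And>s. s \<in> S \<Longrightarrow> absval (f s) \<le> C" "C \<ge> 0"
  shows "absval (sum f S) \<le> C"
  using assms(1)
proof (induction S rule: infinite_finite_induct)
  case (insert s S)
  then show ?case
    using absval_add_le[of "f s" "sum f S"] by fastforce
qed (use assms(2) in auto)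

text \<open>This instance and the next open up the termwise arithmetic of \<open>has_sum\<close>,
  which is stated for topological groups and semigroups.\<close>

instance complete_nonarch_field < topological_ab_group_add
proof
  fix a b :: 'a
  show "((\<lambda>x. fst x + snd x) \<longlongrightarrow> a + b) (nhds a \<times>\<^sub>F nhds b)"
  proof (rule tendstoI)
    fix e :: real assume e: "e > 0"
    have "eventually (\<lambda>p. dist (fst p) a < e \<and> dist (snd p) b < e) (nhds a \<times>\<^sub>F nhds b)"
      unfolding eventually_prod_filter eventually_nhds_metric
      using e by (intro exI[of _ "\<lambda>x. dist x a < e"] exI[of _ "\<lambda>x. dist x b < e"]) auto
    then show "eventually (\<lambda>p. dist (fst p + snd p) (a + b) < e) (nhds a \<times>\<^sub>F nhds b)"
    proof eventually_elim
      case (elim p)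
      have eq: "fst p + snd p - (a + b) = (fst p - a) + (snd p - b)" by simp
      show ?case
        using elim absval_add_le[of "fst p - a" "snd p - b"]
        unfolding dist_eq_absval eq by (meson le_less_trans max_less_iff_conj)
    qed
  qed
  show "(uminus \<longlongrightarrow> - a) (nhds a)"
  proof (rule tendstoI)
    fix e :: real assume e: "e > 0"
    have "dist (- x) (- a) = dist x a" for x
      unfolding dist_eq_absval using absval_minus[of "x - a"] by (simp only: minus_diff_minus)
    then show "eventually (\<lambda>x. dist (- x) (- a) < e) (nhds a)"
      unfolding eventually_nhds_metric using e by auto
  qed
qed

instance complete_nonarch_field < topological_semigroup_mult
proof
  fix a b :: 'a
  show "((\<lambda>x. fst x * snd x) \<longlongrightarrow> a * b) (nhds a \<times>\<^sub>F nhds b)"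
  proof (rule tendstoI)
    fix e :: real assume e: "e > 0"
    define C where "C = absval a + absval b + 1"
    have C: "C > 0" "absval a \<le> C" "absval b \<le> C" "1 \<le> C"
      unfolding C_def using absval_nonneg[of a] absval_nonneg[of b] by linarith+
    define d where "d = min 1 (e / C)"
    have d: "d > 0" "d \<le> 1" "d * C \<le> e" using e C by (auto simp: d_def min_def field_simps)
    have "eventually (\<lambda>p. dist (fst p) a < d \<and> dist (snd p) b < d) (nhds a \<times>\<^sub>F nhds b)"
      unfolding eventually_prod_filter eventually_nhds_metric
      using d by (intro exI[of _ "\<lambda>x. dist x a < d"] exI[of _ "\<lambda>x. dist x b < d"]) auto
    then show "eventually (\<lambda>p. dist (fst p * snd p) (a * b) < e) (nhds a \<times>\<^sub>F nhds b)"
    proof eventually_elim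
      case (elim p)
      define x y where "x = fst p" and "y = snd p"
      have xy: "absval (x - a) < d" "absval (y - b) < d"
        using elim by (auto simp: dist_eq_absval x_def y_def)
      have "absval x \<le> C"
        using absval_add_le[of "x - a" a] xy d C by auto
      then have "absval x * absval (y - b) \<le> C * absval (y - b)" "absval (x - a) * absval b \<le> absval (x - a) * C"
        using C by (auto intro: mult_left_mono mult_right_mono)
      moreover have "C * absval (y - b) < C * d" "absval (x - a) * C < d * C"
        using xy C by auto
      moreover have "x * y - a * b = x * (y - b) + (x - a) * b" by (simp add: algebra_simps)
      ultimately show ?case
        using absval_add_le[of "x * (y - b)" "(x - a) * b"] d
        unfolding dist_eq_absval x_def[symmetric] y_def[symmetric] absval_mult
        by (auto simp: mult.commute)
    qed
  qed
qed

text \<open>The uniformity that \<open>has_sum_Sigma\<close> asks for when a sum over pairs is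
  computed iteratively. By the ultrametric inequality \<open>d = e\<close> works.\<close>

lemma uniformly_continuous_add_nonarch:
  "uniformly_continuous_on UNIV (\<lambda>(x :: 'c::complete_nonarch_field, y). x + y)"
  unfolding uniformly_continuous_on_def
proof (intro allI impI)
  fix e :: real assume e: "e > 0"
  show "\<exists>d>0. \<forall>x\<in>UNIV. \<forall>x'\<in>UNIV. dist x' x < d \<longrightarrow>
      dist (case x' of (x, y) \<Rightarrow> x + y) (case x of (x, y) \<Rightarrow> (x + y :: 'c)) < e"
  proof (intro exI[of _ e] conjI ballI impI e)
    fix p p' :: "'c \<times> 'c" assume p: "dist p' p < e"
    have "dist (fst p') (fst p) < e" "dist (snd p') (snd p) < e"
      using p dist_fst_le[of p' p] dist_snd_le[of p' p] by auto
    moreover have eq: "fst p' + snd p' - (fst p + snd p) = (fst p' - fst p) + (snd p' - snd p)" by simp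
    ultimately show "dist (case p' of (x, y) \<Rightarrow> x + y) (case p of (x, y) \<Rightarrow> x + y) < e"
      using absval_add_le[of "fst p' - fst p" "snd p' - snd p"]
      unfolding dist_eq_absval case_prod_unfold eq by (meson le_less_trans max_less_iff_conj)
  qed
qed

section \<open>Null families and their sums\<close>

definition vanishing :: "('s \<Rightarrow> 'c::complete_nonarch_field) \<Rightarrow> 's set \<Rightarrow> bool" where
  "vanishing f S \<longleftrightarrow> (\<forall>e>0. finite {s \<in> S. absval (f s) \<ge> e})"

lemma vanishing_subset:
  assumes "vanishing w S" "S' \<subseteq> S"
  shows "vanishing w S'"
  unfolding vanishing_def
proof (intro allI impI)
  fix e :: real assume "e > 0"
  then have "finite {s \<in> S. e \<le> absval (w s)}" using assms(1) by (simp add: vanishing_def)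
  then show "finite {s \<in> S'. e \<le> absval (w s)}"
    by (rule rev_finite_subset) (use assms(2) in auto)
qed

text \<open>Outside the finite set of large terms every finite partial sum is small by the
  ultrametric inequality, so the net of partial sums is Cauchy.\<close>

lemma vanishing_imp_summable:
  fixes f :: "'s \<Rightarrow> 'c::complete_nonarch_field"
  assumes "vanishing f S"
  shows "f summable_on S"
proof -
  have "cauchy_filter (filtermap (sum f) (finite_subsets_at_top S))"
    unfolding cauchy_filter_metric_filtermap
  proof (intro allI impI)
    fix e :: real assume e: "e > 0"
    define F0 where "F0 = {s \<in> S. absval (f s) \<ge> e / 2}"
    have F0: "finite F0" "F0 \<subseteq> S"
      using assms[unfolded vanishing_def, rule_format, of "e / 2"] e by (simp_all add: F0_def)
    define P where "P F \<longleftrightarrow> finite F \<and> F0 \<subseteq> F \<and> F \<subseteq> S" for F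
    have "eventually P (finite_subsets_at_top S)"
      unfolding eventually_finite_subsets_at_top P_def using F0 by blast
    moreover have "dist (sum f F) (sum f G) < e" if "P F" "P G" for F G
    proof -
      have "absval (sum f (F' - F0)) \<le> e / 2" if "P F'" for F'
        using that e by (intro absval_sum_le) (auto simp: P_def F0_def not_le intro: less_imp_le)
      note bound = this[OF \<open>P F\<close>] this[OF \<open>P G\<close>]
      have "sum f F' = sum f F0 + sum f (F' - F0)" if "P F'" for F'
        using that sum.subset_diff[of F0 F' f] by (auto simp: P_def add.commute)
      then have "sum f F - sum f G = sum f (F - F0) - sum f (G - F0)"
        using that by simp
      then show ?thesis
        using absval_diff_le[of "sum f (F - F0)" "sum f (G - F0)"] bound e by (simp add: dist_eq_absval)
    qed
    ultimately show "\<exists>P. eventually P (finite_subsets_at_top S) \<and> (\<forall>x y. P x \<and> P y \<longrightarrow> dist (sum f x) (sum f y) < e)"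
      by blast
  qed
  moreover have "complete (UNIV :: 'c set)"
    by (meson Cauchy_convergent UNIV_I complete_def convergent_def)
  ultimately obtain L where "(sum f \<longlongrightarrow> L) (finite_subsets_at_top S)"
    using complete_uniform[where S = "UNIV :: 'c set"] by (force simp add: filterlim_def)
  then show ?thesis
    using summable_on_def has_sum_def by blast
qed

text \<open>A partial sum that is closer to \<open>z\<close> than \<open>absval z\<close> has
  absolute value at least \<open>absval z\<close>, by the ultrametric inequality.\<close>

lemma absval_has_sum_le:
  assumes z: "(f has_sum z) S" and bound: "\<And>s. s \<in> S \<Longrightarrow> absval (f s) \<le> C" "C \<ge> 0"
  shows "absval z \<le> C"
proof (rule ccontr)
  assume contr: "\<not> absval z \<le> C"
  then have "absval z > 0" using \<open>C \<ge> 0\<close> by linarith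
  then have "eventually (\<lambda>F. dist (sum f F) z < absval z) (finite_subsets_at_top S)"
    using tendstoD[OF z[unfolded has_sum_def]] by simp
  then obtain F where F: "finite F" "F \<subseteq> S" "dist (sum f F) z < absval z"
    unfolding eventually_finite_subsets_at_top by blast
  have "absval z \<le> max (absval (sum f F)) (absval (sum f F - z))"
    using absval_diff_le[of "sum f F" "sum f F - z"] by simp
  moreover have "absval (sum f F) \<le> C"
    using F bound by (intro absval_sum_le) auto
  ultimately show False
    using F(3) contr by (auto simp: dist_eq_absval)
qed

lemma absval_has_sum_diff_le:
  assumes z: "(f has_sum z) S" and F: "finite F" "F \<subseteq> S"
    and bound: "\<And>s. s \<in> S - F \<Longrightarrow> absval (f s) \<le> C" "C \<ge> 0"
  shows "absval (z - sum f F) \<le> C"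
proof (rule absval_has_sum_le)
  show "(f has_sum (z - sum f F)) (S - F)"
    using F by (intro has_sum_Diff z has_sum_finite) auto
qed (use bound in auto)

section \<open>Sums in completed tensor products\<close>

lemma has_tensor_sum_imp_has_sum:
  assumes "has_tensor_sum t S z"
  shows "((\<lambda>s. t s b) has_sum z b) S"
  using tendsto_uniform_limitI[OF assms[unfolded has_tensor_sum_def] UNIV_I, of b]
  by (simp add: has_sum_def)

lemma has_tensor_sum_unique:
  assumes "has_tensor_sum t S z" "has_tensor_sum t S z'"
  shows "z = z'"
  using has_tensor_sum_imp_has_sum[OF assms(1)] has_tensor_sum_imp_has_sum[OF assms(2)]
  by (intro ext) (blast intro: has_sum_unique)

lemma tensor_sum_eq:
  assumes "has_tensor_sum t S z"
  shows "tensor_sum t S = z"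
  unfolding tensor_sum_def using assms has_tensor_sum_unique by blast

text \<open>The finite set of large summands is the same for all coordinates \<open>b\<close>; this
  makes the coordinatewise limit uniform.\<close>

lemma has_tensor_sum_vanishing:
  assumes van: "\<And>e. e > 0 \<Longrightarrow> finite {s \<in> S. \<exists>b. absval (t s b) \<ge> e}"
  shows "has_tensor_sum t S (tensor_sum t S)"
proof -
  define z where "z b = (\<Sum>\<^sub>\<infinity>s\<in>S. t s b)" for b
  have "vanishing (\<lambda>s. t s b) S" for b
    unfolding vanishing_def by (intro allI impI, rule finite_subset[OF _ van]) auto
  then have z: "((\<lambda>s. t s b) has_sum z b) S" for b
    unfolding z_def by (intro has_sum_infsum vanishing_imp_summable)
  have "has_tensor_sum t S z"
    unfolding has_tensor_sum_def
  proof (rule uniform_limitI)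
    fix e :: real assume e: "e > 0"
    define F0 where "F0 = {s \<in> S. \<exists>b. absval (t s b) \<ge> e / 2}"
    have F0: "finite F0" "F0 \<subseteq> S" using van[of "e / 2"] e by (auto simp: F0_def)
    have "dist (\<Sum>s\<in>F. t s b) (z b) < e" if F: "finite F" "F0 \<subseteq> F" "F \<subseteq> S" for F b
    proof -
      have "absval (z b - (\<Sum>s\<in>F. t s b)) \<le> e / 2"
      proof (rule absval_has_sum_diff_le[OF z F(1,3)])
        fix s assume s: "s \<in> S - F"
        then have "s \<notin> F0" using F(2) by blast
        then have "\<not> absval (t s b) \<ge> e / 2" using s unfolding F0_def by blast
        then show "absval (t s b) \<le> e / 2" by simp
      qed (use e in simp)
      then show ?thesis
        using e by (subst dist_commute) (simp add: dist_eq_absval)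
    qed
    then show "\<forall>\<^sub>F F in finite_subsets_at_top S. \<forall>b\<in>UNIV. dist (\<Sum>s\<in>F. t s b) (z b) < e"
      unfolding eventually_finite_subsets_at_top using F0 by blast
  qed
  then show ?thesis
    by (simp add: tensor_sum_eq)
qed

text \<open>A coefficient can be large only on the support of one of the finitely many large
  summands, and these supports are finite.\<close>

lemma tensor_sum_in_completed_tensor:
  assumes van: "\<And>e. e > 0 \<Longrightarrow> finite {s \<in> S. \<exists>b. absval (t s b) \<ge> e}"
    and supp: "\<And>s b. s \<in> S \<Longrightarrow> b \<notin> B \<Longrightarrow> t s b = 0" "\<And>s. s \<in> S \<Longrightarrow> finite {b. t s b \<noteq> 0}"
  shows "tensor_sum t S \<in> completed_tensor B"
proof -
  define z where "z = tensor_sum t S"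
  have z: "((\<lambda>s. t s b) has_sum z b) S" for b
    unfolding z_def by (intro has_tensor_sum_imp_has_sum has_tensor_sum_vanishing van)
  have "z b = 0" if "b \<notin> B" for b
  proof -
    have "((\<lambda>s. t s b) has_sum 0) S"
      using supp(1)[OF _ that] by (intro has_sum_0) auto
    then show ?thesis using z has_sum_unique by blast
  qed
  moreover have "finite {b \<in> B. absval (z b) \<ge> e}" if e: "e > 0" for e
  proof -
    define F0 where "F0 = {s \<in> S. \<exists>b. absval (t s b) \<ge> e / 2}"
    have F0: "finite F0" "F0 \<subseteq> S" using van[of "e / 2"] e by (auto simp: F0_def)
    have "absval (z b) \<le> e / 2" if "b \<notin> (\<Union>s\<in>F0. {b. t s b \<noteq> 0})" for b
    proof (rule absval_has_sum_le[OF z])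
      fix s assume s: "s \<in> S"
      show "absval (t s b) \<le> e / 2"
      proof (cases "s \<in> F0")
        case True
        then show ?thesis using that e by auto
      next
        case False
        then have "\<not> absval (t s b) \<ge> e / 2" using s unfolding F0_def by blast
        then show ?thesis by simp
      qed
    qed (use e in simp)
    then have "{b \<in> B. absval (z b) \<ge> e} \<subseteq> (\<Union>s\<in>F0. {b. t s b \<noteq> 0})"
      using e by fastforce
    moreover have "finite (\<Union>s\<in>F0. {b. t s b \<noteq> 0})"
      using F0 supp by auto
    ultimately show ?thesis by (rule finite_subset)
  qed
  ultimately show ?thesis
    unfolding completed_tensor_def z_def by auto
qed

text \<open>The double family is null on \<open>S \<times> B\<close>: its terms are bounded by
  \<open>w s\<close>, and each \<open>s\<close> involves only finitely many \<open>b\<close>. Both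
  iterated sums therefore equal its sum.\<close>

lemma has_sum_swap_vanishing:
  fixes w :: "'s \<Rightarrow> 'c::complete_nonarch_field"
  assumes van: "vanishing w S"
    and r: "\<And>s b. s \<in> S \<Longrightarrow> b \<in> B \<Longrightarrow> absval (r s b) \<le> 1" "\<And>s. s \<in> S \<Longrightarrow> finite {b \<in> B. r s b \<noteq> 0}"
    and y: "\<And>b. b \<in> B \<Longrightarrow> absval (y b) \<le> 1"
    and z: "\<And>b. b \<in> B \<Longrightarrow> ((\<lambda>s. w s * r s b) has_sum z b) S"
    and g: "\<And>s. s \<in> S \<Longrightarrow> g s = (\<Sum>b | b \<in> B \<and> r s b \<noteq> 0. r s b * y b)"
  shows "\<exists>X. ((\<lambda>b. z b * y b) has_sum X) B \<and> ((\<lambda>s. w s * g s) has_sum X) S"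
proof -
  define h where "h p = (case p of (s, b) \<Rightarrow> w s * r s b * y b)" for p
  have "vanishing h (S \<times> B)"
    unfolding vanishing_def
  proof (intro allI impI)
    fix e :: real assume e: "e > 0"
    have "{p \<in> S \<times> B. absval (h p) \<ge> e} \<subseteq> (SIGMA s:{s \<in> S. absval (w s) \<ge> e}. {b \<in> B. r s b \<noteq> 0})"
    proof
      fix p assume "p \<in> {p \<in> S \<times> B. absval (h p) \<ge> e}"
      then obtain s b where p: "p = (s, b)" and sb: "s \<in> S" "b \<in> B" "e \<le> absval (h (s, b))"
        by auto
      have "absval (h (s, b)) \<le> absval (w s) * 1 * 1"
        unfolding h_def prod.case absval_mult using sb r y by (intro mult_mono mult_nonneg_nonneg) auto
      moreover have "r s b \<noteq> 0" using sb e by (auto simp: h_def)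
      ultimately show "p \<in> (SIGMA s:{s \<in> S. absval (w s) \<ge> e}. {b \<in> B. r s b \<noteq> 0})"
        using sb by (auto simp: p)
    qed
    moreover have "finite (SIGMA s:{s \<in> S. absval (w s) \<ge> e}. {b \<in> B. r s b \<noteq> 0})"
      using van r(2) e by (intro finite_SigmaI) (auto simp: vanishing_def)
    ultimately show "finite {p \<in> S \<times> B. absval (h p) \<ge> e}"
      by (rule finite_subset)
  qed
  then obtain X where X: "(h has_sum X) (S \<times> B)"
    using vanishing_imp_summable unfolding summable_on_def by blast
  have "((\<lambda>s. w s * g s) has_sum X) S"
  proof (rule has_sum_Sigma[OF uniformly_continuous_add_nonarch X])
    fix s assume s: "s \<in> S"
    have "((\<lambda>b. h (s, b)) has_sum (\<Sum>b | b \<in> B \<and> r s b \<noteq> 0. h (s, b))) {b \<in> B. r s b \<noteq> 0}"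
      by (intro has_sum_finite r s)
    then have "((\<lambda>b. h (s, b)) has_sum (\<Sum>b | b \<in> B \<and> r s b \<noteq> 0. h (s, b))) B"
      by (rule has_sum_cong_neutral[THEN iffD1, rotated -1]) (auto simp: h_def)
    then show "((\<lambda>b. h (s, b)) has_sum w s * g s) B"
      by (simp add: g s h_def sum_distrib_left mult.assoc)
  qed
  moreover have "((\<lambda>b. z b * y b) has_sum X) B"
  proof (rule has_sum_Sigma[OF uniformly_continuous_add_nonarch, where f = "\<lambda>p. h (snd p, fst p)"])
    have "bij_betw (\<lambda>p. (snd p, fst p)) (B \<times> S) (S \<times> B)"
      by (rule bij_betwI[where g = "\<lambda>p. (snd p, fst p)"]) auto
    from has_sum_reindex_bij_betw[OF this, of h X]
    show "((\<lambda>p. h (snd p, fst p)) has_sum X) (B \<times> S)"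
      using X by simp
  next
    fix b assume "b \<in> B"
    then show "((\<lambda>s. h (snd (b, s), fst (b, s))) has_sum z b * y b) S"
      using has_sum_cmult_left[OF z, of b "y b"] by (simp add: h_def)
  qed
  ultimately show ?thesis by blast
qed

text \<open>Will collect the terms that belong to the same monomial.\<close>

lemma has_sum_fibres:
  fixes h :: "'s \<Rightarrow> 'c::complete_nonarch_field"
  assumes h: "(h has_sum X) S" and p: "p ` S \<subseteq> N"
    and u: "\<And>n. n \<in> N \<Longrightarrow> (h has_sum u n) {s \<in> S. p s = n}"
  shows "(u has_sum X) N"
proof (rule has_sum_Sigma[OF uniformly_continuous_add_nonarch])
  have "bij_betw snd (SIGMA n:N. {s \<in> S. p s = n}) S"
    using p by (force simp: bij_betw_def inj_on_def)
  from has_sum_reindex_bij_betw[OF this, of h X]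
  show "((\<lambda>x. h (snd x)) has_sum X) (SIGMA n:N. {s \<in> S. p s = n})"
    using h by simp
next
  fix n assume "n \<in> N"
  then show "((\<lambda>s. h (snd (n, s))) has_sum u n) {s \<in> S. p s = n}"
    using u by simp
qed

text \<open>The F_q-linear \<open>h\<close> is expanded along the basis and the sums are exchanged.
  It will serve three functionals: a coordinate of \<open>f x\<close>, the value \<open>P x\<close>,
  and the composite \<open>P (f x)\<close>.\<close>

lemma has_sum_basis_swap:
  fixes s :: "'f::field \<Rightarrow> 'm::ab_group_add \<Rightarrow> 'm" and e :: "'f \<Rightarrow> 'c::complete_nonarch_field"
  assumes vs: "vector_space s" and B: "basis_of s B M"
    and e: "field_embedding e" "\<And>a. absval (e a) \<le> 1"
    and h: "\<And>x y. x \<in> M \<Longrightarrow> y \<in> M \<Longrightarrow> h (x + y) = h x + h y" "\<And>a x. x \<in> M \<Longrightarrow> h (s a x) = e a * h x"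
      "\<And>b. b \<in> B \<Longrightarrow> absval (h b) \<le> 1"
    and w: "vanishing w S" "\<And>l. l \<in> S \<Longrightarrow> m l \<in> M"
    and z: "\<And>b. b \<in> B \<Longrightarrow> ((\<lambda>l. w l * e (module.representation s B (m l) b)) has_sum z b) S"
  shows "\<exists>X. ((\<lambda>b. z b * h b) has_sum X) B \<and> ((\<lambda>l. w l * h (m l)) has_sum X) S"
proof (rule has_sum_swap_vanishing[OF w(1) _ _ h(3) z])
  interpret vector_space s by fact
  have ind: "independent B" and span_B: "span B = M"
    using B by (auto simp: basis_of_def)
  have nz: "e (representation B v b) \<noteq> 0 \<longleftrightarrow> representation B v b \<noteq> 0" for v b
    by (simp add: field_embedding_eq_0_iff e)
  have set_eq: "{b \<in> B. e (representation B v b) \<noteq> 0} = {b. representation B v b \<noteq> 0}" for v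
    using representation_ne_zero[of B v] unfolding nz by blast
  have sum_M: "h (\<Sum>b\<in>F. s (c b) b) = (\<Sum>b\<in>F. e (c b) * h b) \<and> (\<Sum>b\<in>F. s (c b) b) \<in> M"
    if "finite F" "F \<subseteq> B" for F c
    using that
  proof induction
    case empty
    have "0 \<in> M" using span_zero[of B] span_B by simp
    then have "h (s 0 0) = e 0 * h 0" by (rule h(2))
    then show ?case using \<open>0 \<in> M\<close> by (simp add: field_embedding_0 e)
  next
    case (insert b F)
    have "b \<in> M" using insert.prems span_base[of b B] span_B by auto
    then have "s (c b) b \<in> M" using span_scale[of b B "c b"] span_B by auto
    then show ?case
      using insert h(1)[of "s (c b) b" "\<Sum>b\<in>F. s (c b) b"] h(2)[OF \<open>b \<in> M\<close>]
        span_add[of "s (c b) b" B "\<Sum>b\<in>F. s (c b) b"] span_B by auto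
  qed
  show "absval (e (representation B (m l) b)) \<le> 1" for l b
    by (rule e)
  show "finite {b \<in> B. e (representation B (m l) b) \<noteq> 0}" for l
    unfolding set_eq by (rule finite_representation)
  show "h (m l) = (\<Sum>b | b \<in> B \<and> e (representation B (m l) b) \<noteq> 0. e (representation B (m l) b) * h b)"
    if "l \<in> S" for l
  proof -
    have "m l \<in> span B" using w(2)[OF that] span_B by simp
    then have "m l = (\<Sum>b | representation B (m l) b \<noteq> 0. s (representation B (m l) b) b)"
      by (simp add: sum_nonzero_representation_eq ind)
    moreover have "{b. representation B (m l) b \<noteq> 0} \<subseteq> B"
      using representation_ne_zero by blast
    ultimately show ?thesis
      unfolding set_eq using sum_M[OF finite_representation, of B "m l" "representation B (m l)"] by simp
  qed
qed

section \<open>Lattices stable under an expanding scalar\<close>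

text \<open>The left side is the logarithmic derivative of \<open>\<Prod>u\<in>U. X + u\<close> at
  \<open>x\<close>. The derivative has degree below \<open>card U\<close> and takes one and the same
  value on the group \<open>U\<close>, so it is constant.\<close>

lemma sum_inverse_translates:
  fixes x :: "'k::field"
  assumes U: "finite U" "0 \<in> U" "\<And>u v. u \<in> U \<Longrightarrow> v \<in> U \<Longrightarrow> u - v \<in> U" and x: "x \<notin> U"
  shows "(\<Sum>u\<in>U. inverse (x + u)) = (\<Prod>u\<in>U - {0}. u) / (\<Prod>u\<in>U. x + u)"
proof -
  have neg: "- u \<in> U" if "u \<in> U" for u
    using U(3)[OF U(2) that] by simp
  have nz: "x + u \<noteq> 0" if "u \<in> U" for u
    using neg[OF that] x by (metis add.right_inverse add_right_imp_eq add.commute eq_neg_iff_add_eq_0)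
  \<comment> \<open>The derivative of the product, by the product rule.\<close>
  define N where "N = (\<Sum>u\<in>U. \<Prod>v\<in>U - {u}. [:v, 1:])"
  have poly_N: "poly N z = (\<Sum>u\<in>U. \<Prod>v\<in>U - {u}. z + v)" for z
    unfolding N_def by (simp add: poly_sum poly_prod add.commute)
  have "card U > 0" using U by (auto simp: card_gt_0_iff)
  have deg: "degree N < card U"
    unfolding N_def
  proof (rule degree_sum_less)
    fix u assume u: "u \<in> U"
    have "degree (\<Prod>v\<in>U - {u}. [:v, 1:]) \<le> (\<Sum>v\<in>U - {u}. degree [:v, 1:])"
      using U degree_prod_sum_le[of "U - {u}" "\<lambda>v. [:v, 1:]"] by (simp add: o_def)
    also have "\<dots> = card U - 1" using u U by simp
    finally show "degree (\<Prod>v\<in>U - {u}. [:v, 1:]) < card U"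
      using \<open>card U > 0\<close> by linarith
  qed fact
  have const: "poly N z = poly [:\<Prod>u\<in>U - {0}. u:] z" if z: "z \<in> U" for z
  proof -
    \<comment> \<open>For \<open>z\<close> in \<open>U\<close> only the product without the factor
      at \<open>- z\<close> survives, and its factors run through the nonzero elements of
      \<open>U\<close>.\<close>
    have "poly N z = (\<Prod>v\<in>U - {- z}. z + v) + (\<Sum>u\<in>U - {- z}. \<Prod>v\<in>U - {u}. z + v)"
      unfolding poly_N using U neg[OF z] by (intro sum.remove)
    also have "(\<Sum>u\<in>U - {- z}. \<Prod>v\<in>U - {u}. z + v) = 0"
    proof (rule sum.neutral, rule ballI)
      fix u assume "u \<in> U - {- z}"
      then show "(\<Prod>v\<in>U - {u}. z + v) = 0"
        using U neg[OF z] by (intro prod_zero) (auto intro!: bexI[of _ "- z"])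
    qed
    also have "(\<Prod>v\<in>U - {- z}. z + v) = (\<Prod>u\<in>U - {0}. u)"
    proof (rule prod.reindex_bij_witness[where i = "\<lambda>u. u - z" and j = "\<lambda>v. z + v"])
      fix v assume "v \<in> U - {- z}"
      then show "z + v \<in> U - {0}"
        using U(3)[OF _ neg[OF z], of v] by (auto simp: add.commute add_eq_0_iff)
    qed (use U z in auto)
    finally show ?thesis by simp
  qed
  have "N = [:\<Prod>u\<in>U - {0}. u:]"
    by (rule poly_eqI_degree[OF const deg]) (use \<open>card U > 0\<close> in auto)
  then have N: "(\<Sum>u\<in>U. \<Prod>v\<in>U - {u}. x + v) = (\<Prod>u\<in>U - {0}. u)"
    using poly_N[of x] by simp
  have "(\<Sum>u\<in>U. inverse (x + u)) = (\<Sum>u\<in>U. (\<Prod>v\<in>U - {u}. x + v) / (\<Prod>v\<in>U. x + v))"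
  proof (rule sum.cong)
    fix u assume u: "u \<in> U"
    have "(\<Prod>v\<in>U. x + v) = (x + u) * (\<Prod>v\<in>U - {u}. x + v)"
      using U u by (intro prod.remove)
    moreover have "(\<Prod>v\<in>U - {u}. x + v) \<noteq> 0" using nz U by auto
    ultimately show "inverse (x + u) = (\<Prod>v\<in>U - {u}. x + v) / (\<Prod>v\<in>U. x + v)"
      using nz[OF u] by (simp add: inverse_eq_divide)
  qed simp
  then show ?thesis
    by (simp add: N sum_divide_distrib[symmetric])
qed

text \<open>\<open>U\<close> itself contributes nothing, and \<open>\<phi>\<close> is constant on
  each other coset, where the formula for translates applies. In its denominator every
  \<open>w + u\<close> has absolute value at least \<open>\<rho>\<close>.\<close>

lemma absval_weighted_sum_inverse_le:
  fixes U V :: "'c::complete_nonarch_field set"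
  assumes V: "finite V" "\<And>u v. u \<in> V \<Longrightarrow> v \<in> V \<Longrightarrow> u - v \<in> V"
    and U: "U \<subseteq> V" "0 \<in> U" "\<And>u v. u \<in> U \<Longrightarrow> v \<in> U \<Longrightarrow> u - v \<in> U"
    and \<phi>: "\<And>u. u \<in> U \<Longrightarrow> \<phi> u = 0" "\<And>u v. v \<in> V \<Longrightarrow> u \<in> U \<Longrightarrow> \<phi> (v + u) = \<phi> v" "\<And>v. absval (\<phi> v) \<le> 1"
    and \<rho>: "\<rho> > 0" "\<And>v. v \<in> V - U \<Longrightarrow> \<rho> \<le> absval v"
  shows "absval (\<Sum>v\<in>V - {0}. inverse v * \<phi> v) \<le> (\<Prod>u\<in>U - {0}. absval u) / \<rho> ^ card U"
proof -
  have finU: "finite U" using U V finite_subset by blast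
  have neg: "- u \<in> U" if "u \<in> U" for u
    using U(3)[OF U(2) that] by simp
  have addU: "u + v \<in> U" if "u \<in> U" "v \<in> U" for u v
    using U(3)[OF that(1) neg[OF that(2)]] by simp
  have add_V: "v + u \<in> V - U" if "v \<in> V - U" "u \<in> U" for u v
    using that V(2)[of v "- u"] neg[of u] U(1) U(3)[of "v + u" u] by auto
  define q where "q v = (+) v ` U" for v :: 'c
  have fibre: "{v \<in> V - U. q v = q w} = (+) w ` U" if w: "w \<in> V - U" for w
  proof (intro equalityI subsetI)
    fix v assume "v \<in> {v \<in> V - U. q v = q w}"
    then have "v + 0 \<in> q w" using U(2) unfolding q_def by blast
    then show "v \<in> (+) w ` U" by (simp add: q_def)
  next
    fix v assume "v \<in> (+) w ` U"
    then obtain u where u: "u \<in> U" "v = w + u" by blast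
    have "q v = q w"
      unfolding q_def u(2)
    proof (intro equalityI subsetI)
      fix y assume "y \<in> (+) (w + u) ` U"
      then show "y \<in> (+) w ` U" using addU[OF u(1)] by (auto simp: add.assoc)
    next
      fix y assume "y \<in> (+) w ` U"
      then obtain u' where "u' \<in> U" "y = w + u'" by blast
      then show "y \<in> (+) (w + u) ` U"
        using U(3)[OF _ u(1), of u'] by (intro image_eqI[of _ _ "u' - u"]) auto
    qed
    then show "v \<in> {v \<in> V - U. q v = q w}" using add_V[OF w u(1)] u by auto
  qed
  have "(\<Sum>v\<in>V - {0}. inverse v * \<phi> v) = (\<Sum>v\<in>V - U. inverse v * \<phi> v)"
    using V(1) U \<phi>(1) by (intro sum.mono_neutral_right) auto
  also have "\<dots> = (\<Sum>C\<in>q ` (V - U). \<Sum>v\<in>{v \<in> V - U. q v = C}. inverse v * \<phi> v)"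
    using V(1) by (intro sum.image_gen) auto
  finally have eq: "(\<Sum>v\<in>V - {0}. inverse v * \<phi> v) = \<dots>" .
  have coset: "absval (\<Sum>v\<in>{v \<in> V - U. q v = q w}. inverse v * \<phi> v) \<le> (\<Prod>u\<in>U - {0}. absval u) / \<rho> ^ card U"
    if w: "w \<in> V - U" for w
  proof -
    have "(\<Sum>v\<in>{v \<in> V - U. q v = q w}. inverse v * \<phi> v) = (\<Sum>u\<in>U. inverse (w + u) * \<phi> (w + u))"
      unfolding fibre[OF w] by (subst sum.reindex) (auto simp: inj_on_def)
    also have "\<dots> = (\<Sum>u\<in>U. inverse (w + u)) * \<phi> w"
      using w \<phi>(2) by (simp add: sum_distrib_right)
    also have "(\<Sum>u\<in>U. inverse (w + u)) = (\<Prod>u\<in>U - {0}. u) / (\<Prod>u\<in>U. w + u)"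
      using w by (intro sum_inverse_translates finU U) auto
    finally have "absval (\<Sum>v\<in>{v \<in> V - U. q v = q w}. inverse v * \<phi> v) =
        (\<Prod>u\<in>U - {0}. absval u) / (\<Prod>u\<in>U. absval (w + u)) * absval (\<phi> w)"
      by (simp add: absval_mult absval_inverse absval_prod divide_inverse)
    also have "\<dots> \<le> (\<Prod>u\<in>U - {0}. absval u) / (\<Prod>u\<in>U. absval (w + u)) * 1"
      using \<phi>(3) by (intro mult_left_mono) (auto intro!: divide_nonneg_nonneg prod_nonneg)
    also have "\<dots> \<le> (\<Prod>u\<in>U - {0}. absval u) / \<rho> ^ card U"
    proof -
      have "(\<Prod>u\<in>U. \<rho>) \<le> (\<Prod>u\<in>U. absval (w + u))"
        using \<rho> add_V[OF w] by (intro prod_mono) auto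
      then show ?thesis
        using \<rho>(1) by (auto intro!: divide_left_mono prod_nonneg mult_pos_pos intro: less_le_trans[of 0 "\<rho> ^ card U"])
    qed
    finally show ?thesis .
  qed
  show ?thesis
    unfolding eq
  proof (rule absval_sum_le)
    fix C assume "C \<in> q ` (V - U)"
    then show "absval (\<Sum>v\<in>{v \<in> V - U. q v = C}. inverse v * \<phi> v) \<le> (\<Prod>u\<in>U - {0}. absval u) / \<rho> ^ card U"
      using coset by blast
  qed (use \<rho>(1) in \<open>auto intro!: divide_nonneg_nonneg prod_nonneg\<close>)
qed

text \<open>Common setting for \<Lambda> and the image of \<open>A\<close>: a discrete F_q-space on
  which \<open>t\<close> acts as an expansion with finite cokernel, represented by
  \<open>E\<close>.\<close>

locale t_lattice =
  fixes e :: "'f::{field,finite} \<Rightarrow> 'c::complete_nonarch_field" and t :: 'c and L E :: "'c set"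
  assumes emb: "field_embedding e"
    and absval_const: "\<And>a. a \<noteq> 0 \<Longrightarrow> absval (e a) = 1"
    and t: "absval t > 1"
    and L_0: "0 \<in> L" and L_add: "\<And>x y. x \<in> L \<Longrightarrow> y \<in> L \<Longrightarrow> x + y \<in> L"
    and L_const: "\<And>a x. x \<in> L \<Longrightarrow> e a * x \<in> L" and L_t: "\<And>x. x \<in> L \<Longrightarrow> t * x \<in> L"
    and discrete: "\<exists>\<delta>>0. \<forall>x\<in>L. x \<noteq> 0 \<longrightarrow> \<delta> \<le> absval x"
    and E: "finite E" "E \<subseteq> L" "\<And>x. x \<in> L \<Longrightarrow> \<exists>\<epsilon>\<in>E. \<exists>y\<in>L. x = \<epsilon> + t * y"
begin

sublocale vector_space "\<lambda>a x. e a * x"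
  by (rule vector_space_field_embedding) (rule emb)

lemma subspace_L: "subspace L"
  unfolding subspace_def using L_0 L_add L_const by blast

lemma L_diff: "x - y \<in> L" if "x \<in> L" "y \<in> L"
  using subspace_diff[OF subspace_L that] .

lemma absval_const_le: "absval (e a) \<le> 1"
  using absval_const[of a] by (cases "a = 0") (auto simp: field_embedding_0 emb)

section \<open>Finiteness of balls and digit expansions\<close>

definition ball_L :: "real \<Rightarrow> 'c set" where
  "ball_L r = {x \<in> L. absval x \<le> r}"

lemma subspace_ball_L:
  assumes "r \<ge> 0"
  shows "subspace (ball_L r)"
  unfolding subspace_def ball_L_def
proof (intro conjI ballI allI)
  fix x y assume "x \<in> {x \<in> L. absval x \<le> r}" "y \<in> {x \<in> L. absval x \<le> r}"
  then show "x + y \<in> {x \<in> L. absval x \<le> r}"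
    using absval_add_le[of x y] L_add by auto
next
  fix a x assume "x \<in> {x \<in> L. absval x \<le> r}"
  then show "e a * x \<in> {x \<in> L. absval x \<le> r}"
    using L_const absval_const_le[of a] mult_right_mono[OF absval_const_le, of "absval x" a]
    by (auto simp: absval_mult)
qed (use assms L_0 in auto)

text \<open>The large ball is covered by the classes \<open>\<epsilon> + t L\<close>; on each of
  them, a translation followed by division by \<open>t\<close> maps injectively into the small
  ball.\<close>

lemma card_ball_L_mult:
  assumes fin: "finite (ball_L r)"
  shows "finite (ball_L (absval t * r))" "card (ball_L (absval t * r)) \<le> card E * card (ball_L r)"
proof -
  define F where "F \<epsilon> = {x \<in> ball_L (absval t * r). \<exists>y\<in>L. x = \<epsilon> + t * y}" for \<epsilon>
  have t0: "t \<noteq> 0" using t by auto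
  have F: "finite (F \<epsilon>) \<and> card (F \<epsilon>) \<le> card (ball_L r)" for \<epsilon>
  proof (cases "F \<epsilon> = {}")
    case False
    then obtain x0 y0 where x0: "x0 \<in> ball_L (absval t * r)" "y0 \<in> L" "x0 = \<epsilon> + t * y0"
      by (auto simp: F_def)
    let ?g = "\<lambda>x. (x - x0) / t"
    have "inj_on ?g (F \<epsilon>)" using t0 by (auto simp: inj_on_def)
    moreover have "?g ` F \<epsilon> \<subseteq> ball_L r"
    proof
      fix z assume "z \<in> ?g ` F \<epsilon>"
      then obtain x y where x: "x \<in> ball_L (absval t * r)" "y \<in> L" "x = \<epsilon> + t * y" "z = (x - x0) / t"
        by (auto simp: F_def)
      have "z = t * (y - y0) / t" using x x0 by (simp add: algebra_simps)
      then have "z = y - y0" using t0 by simp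
      have "absval (x - x0) \<le> absval t * r"
        using x x0 absval_diff_le[of x x0] by (auto simp: ball_L_def)
      moreover have "t * z = x - x0" using x(4) t0 by simp
      ultimately have "absval t * absval z \<le> absval t * r" by (metis absval_mult)
      then have "absval z \<le> r" using t by simp
      with \<open>z = y - y0\<close> show "z \<in> ball_L r" using x x0 L_diff by (auto simp: ball_L_def)
    qed
    ultimately show ?thesis
      using fin inj_on_finite card_inj_on_le by blast
  qed simp
  have sub: "ball_L (absval t * r) \<subseteq> (\<Union>\<epsilon>\<in>E. F \<epsilon>)"
    using E(3) by (auto simp: F_def ball_L_def)
  have fin': "finite (\<Union>\<epsilon>\<in>E. F \<epsilon>)" using E(1) F by auto
  have card: "card (\<Union>\<epsilon>\<in>E. F \<epsilon>) \<le> card E * card (ball_L r)"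
    using card_UN_le[OF E(1), of F] sum_bounded_above[of E "\<lambda>\<epsilon>. card (F \<epsilon>)" "card (ball_L r)"] F
    by simp
  show "finite (ball_L (absval t * r))"
    using sub fin' by (rule finite_subset)
  show "card (ball_L (absval t * r)) \<le> card E * card (ball_L r)"
    using card_mono[OF fin' sub] card by (rule order_trans)
qed

text \<open>A ball below the discreteness bound is trivial, and scaling the radius by
  \<open>absval t\<close> keeps balls finite and reaches every radius.\<close>

lemma finite_ball_L: "finite (ball_L r)"
proof -
  obtain \<delta> where \<delta>: "\<delta> > 0" "\<And>x. x \<in> L \<Longrightarrow> x \<noteq> 0 \<Longrightarrow> \<delta> \<le> absval x"
    using discrete by blast
  have fin: "finite (ball_L (absval t ^ n * (\<delta> / 2)))" for n
  proof (induction n)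
    case 0
    have "ball_L (\<delta> / 2) \<subseteq> {0}" using \<delta> by (fastforce simp: ball_L_def)
    then show ?case by (simp add: finite_subset)
  next
    case (Suc n)
    from card_ball_L_mult(1)[OF this] show ?case by (simp add: mult.assoc)
  qed
  obtain n where "r / (\<delta> / 2) < absval t ^ n" using real_arch_pow[OF t] by blast
  then have "r \<le> absval t ^ n * (\<delta> / 2)" using \<delta>(1) by (simp add: field_simps)
  then have "ball_L r \<subseteq> ball_L (absval t ^ n * (\<delta> / 2))" by (auto simp: ball_L_def)
  then show ?thesis using fin finite_subset by blast
qed

lemma vanishing_inverse:
  assumes "\<And>x. absval (\<phi> x) \<le> 1"
  shows "vanishing (\<lambda>x. inverse x * \<phi> x) (L - {0})"
  unfolding vanishing_def
proof (intro allI impI)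
  fix \<epsilon> :: real assume \<epsilon>: "\<epsilon> > 0"
  have "{x \<in> L - {0}. \<epsilon> \<le> absval (inverse x * \<phi> x)} \<subseteq> ball_L (1 / \<epsilon>)"
  proof
    fix x assume x: "x \<in> {x \<in> L - {0}. \<epsilon> \<le> absval (inverse x * \<phi> x)}"
    then have "\<epsilon> \<le> inverse (absval x) * absval (\<phi> x)"
      by (simp add: absval_mult absval_inverse)
    also have "\<dots> \<le> inverse (absval x) * 1"
      by (intro mult_left_mono assms) simp
    finally have "\<epsilon> \<le> inverse (absval x)" by simp
    moreover have "absval x > 0" using x by (intro absval_pos) auto
    ultimately have "absval x \<le> 1 / \<epsilon>" using \<epsilon> by (simp add: field_simps)
    then show "x \<in> ball_L (1 / \<epsilon>)"
      using x by (simp add: ball_L_def)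
  qed
  then show "finite {x \<in> L - {0}. \<epsilon> \<le> absval (inverse x * \<phi> x)}"
    using finite_ball_L finite_subset by blast
qed

lemma exists_digits:
  "\<exists>D M. finite D \<and> D \<subseteq> L \<and> M > 0 \<and> (\<forall>n. \<forall>x\<in>L. absval x \<le> M * absval t ^ n \<longrightarrow>
     (\<exists>\<epsilon>. (\<forall>a. \<epsilon> a \<in> D) \<and> x = (\<Sum>a\<le>n. t ^ a * \<epsilon> a)))"
proof -
  define M where "M = Max (insert 1 (absval ` E))"
  have M: "M \<ge> 1" "\<And>\<epsilon>. \<epsilon> \<in> E \<Longrightarrow> absval \<epsilon> \<le> M"
    unfolding M_def using E(1) by auto
  define D where "D = E \<union> ball_L M"
  have t0: "t \<noteq> 0" using t by auto
  have "\<exists>\<epsilon>. (\<forall>a. \<epsilon> a \<in> D) \<and> x = (\<Sum>a\<le>n. t ^ a * \<epsilon> a)" if "x \<in> L" "absval x \<le> M * absval t ^ n" for n x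
    using that
  proof (induction n arbitrary: x)
    case 0
    then show ?case
      by (intro exI[of _ "\<lambda>_. x"]) (auto simp: D_def ball_L_def)
  next
    case (Suc n)
    obtain \<epsilon>0 y where y: "\<epsilon>0 \<in> E" "y \<in> L" "x = \<epsilon>0 + t * y"
      using E(3)[OF Suc.prems(1)] by blast
    have "1 \<le> absval t ^ Suc n" using t by (intro one_le_power) auto
    then have "M * 1 \<le> M * absval t ^ Suc n" using M(1) by (intro mult_left_mono) auto
    then have "absval (x - \<epsilon>0) \<le> M * absval t ^ Suc n"
      using absval_diff_le[of x \<epsilon>0] Suc.prems M(2)[OF y(1)] by auto
    then have "absval t * absval y \<le> absval t * (M * absval t ^ n)"
      using y(3) by (simp add: absval_mult mult_ac)
    then have "absval y \<le> M * absval t ^ n"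
      using t by simp
    then obtain \<epsilon> where \<epsilon>: "\<And>a. \<epsilon> a \<in> D" "y = (\<Sum>a\<le>n. t ^ a * \<epsilon> a)"
      using Suc.IH[OF y(2)] by blast
    have "x = (\<Sum>a\<le>Suc n. t ^ a * case_nat \<epsilon>0 \<epsilon> a)"
      unfolding sum.atMost_Suc_shift y(3) \<epsilon>(2) by (simp add: sum_distrib_left mult_ac)
    moreover have "case_nat \<epsilon>0 \<epsilon> a \<in> D" for a
      using \<epsilon> y(1) by (cases a) (auto simp: D_def)
    ultimately show ?case by blast
  qed
  moreover have "finite D" "D \<subseteq> L"
    using E finite_ball_L by (auto simp: D_def ball_L_def)
  ultimately show ?thesis
    using M(1) by (intro exI[of _ D] exI[of _ M]) auto
qed

lemma absval_t_power_unbounded: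
  assumes "x \<noteq> 0"
  shows "\<exists>n. absval (t ^ n * x) > r"
proof -
  obtain n where "r / absval x < absval t ^ n" using real_arch_pow[OF t] by blast
  then show ?thesis
    using assms by (intro exI[of _ n]) (simp add: absval_mult absval_power field_simps absval_pos)
qed

lemma t_power_L: "t ^ n * x \<in> L" if "x \<in> L"
  using that L_t by (induction n) (auto simp: mult.assoc)

section \<open>Bases of successive minima\<close>

lemma no_finite_t_stable:
  assumes "finite U" "\<And>u. u \<in> U \<Longrightarrow> t * u \<in> U" "x \<in> U"
  shows "x = 0"
proof (rule ccontr)
  assume x: "x \<noteq> 0"
  have U: "t ^ n * x \<in> U" for n
    using assms by (induction n) (auto simp: mult.assoc)
  obtain n where "absval (t ^ n * x) > Max (absval ` U)"
    using absval_t_power_unbounded[OF x] by blast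
  moreover have "absval (t ^ n * x) \<le> Max (absval ` U)"
    using assms(1) U by (intro Max_ge) auto
  ultimately show False by simp
qed

text \<open>These are successive minima of \<open>L\<close> over F_q; among vectors of equal length
  the choice is free.\<close>

definition reduced_basis :: "(nat \<Rightarrow> 'c) \<Rightarrow> bool" where
  "reduced_basis \<beta> \<longleftrightarrow> (\<forall>k. \<beta> k \<in> L - span (\<beta> ` {..<k}) \<and>
     (\<forall>y \<in> L - span (\<beta> ` {..<k}). absval (\<beta> k) \<le> absval y))"

lemma finite_span_lessThan: "finite (span (\<beta> ` {..<k::nat}))"
  by (rule finite_span(1)) (use vector_space_axioms in auto)

text \<open>Powers of \<open>t\<close> move a nonzero vector out of any finite span, and the minimum
  outside the span is attained because balls are finite.\<close>

lemma exists_reduced_basis: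
  assumes "L \<noteq> {0}"
  shows "\<exists>\<beta>. reduced_basis \<beta>"
  unfolding reduced_basis_def
proof (rule dependent_wellorder_choice)
  fix k :: nat and \<beta> :: "nat \<Rightarrow> 'c"
  let ?U = "span (\<beta> ` {..<k})"
  obtain x where x: "x \<in> L" "x \<noteq> 0" using assms L_0 by auto
  have "\<exists>y. y \<in> L - ?U"
  proof -
    obtain n where n: "absval (t ^ n * x) > Max (absval ` ?U)"
      using absval_t_power_unbounded[OF x(2)] by blast
    have "t ^ n * x \<notin> ?U"
    proof
      assume "t ^ n * x \<in> ?U"
      then have "absval (t ^ n * x) \<le> Max (absval ` ?U)"
        using finite_span_lessThan by (intro Max_ge) auto
      then show False using n by simp
    qed
    then show ?thesis using t_power_L[OF x(1)] by blast
  qed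
  then obtain y where y: "y \<in> L - ?U" by blast
  define X where "X = ball_L (absval y) - ?U"
  have X: "finite X" "X \<noteq> {}" using y finite_ball_L by (auto simp: X_def ball_L_def)
  then obtain z where z: "z \<in> X" "\<And>x. x \<in> X \<Longrightarrow> absval z \<le> absval x"
    using ex_is_arg_min_if_finite[OF X, of absval] by (auto simp: is_arg_min_linorder)
  have "absval z \<le> absval x" if "x \<in> L - ?U" for x
    using z(2)[of x] z(1) that by (cases "absval x \<le> absval y") (auto simp: X_def ball_L_def)
  then show "\<exists>r. r \<in> L - ?U \<and> (\<forall>y\<in>L - ?U. absval r \<le> absval y)"
    using z(1) by (intro exI[of _ z]) (auto simp: X_def ball_L_def)
next
  fix r :: 'c and f g :: "nat \<Rightarrow> 'c" and x :: nat
  assume "\<And>y. y < x \<Longrightarrow> f y = g y"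
  then have "f ` {..<x} = g ` {..<x}" by auto
  then show "(r \<in> L - span (f ` {..<x}) \<and> (\<forall>y\<in>L - span (f ` {..<x}). absval r \<le> absval y)) =
    (r \<in> L - span (g ` {..<x}) \<and> (\<forall>y\<in>L - span (g ` {..<x}). absval r \<le> absval y))"
    by simp
qed

context
  fixes \<beta> assumes red: "reduced_basis \<beta>"
begin

lemma reduced_basis_in: "\<beta> k \<in> L" and reduced_basis_notin: "\<beta> k \<notin> span (\<beta> ` {..<k})"
  and reduced_basis_le: "y \<in> L \<Longrightarrow> y \<notin> span (\<beta> ` {..<k}) \<Longrightarrow> absval (\<beta> k) \<le> absval y"
  using red by (auto simp: reduced_basis_def)

lemma inj_reduced_basis: "inj \<beta>"
proof (rule linorder_injI)
  fix k l :: nat assume "k < l"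
  then have "\<beta> k \<in> span (\<beta> ` {..<l})" by (intro span_base) auto
  then show "\<beta> k \<noteq> \<beta> l" using reduced_basis_notin by metis
qed

lemma reduced_basis_nonzero: "\<beta> k \<noteq> 0"
  using reduced_basis_notin[of k] span_zero by metis

lemma reduced_basis_mono: "absval (\<beta> k) \<le> absval (\<beta> l)" if "k \<le> l"
proof (rule reduced_basis_le[OF reduced_basis_in])
  have "span (\<beta> ` {..<k}) \<subseteq> span (\<beta> ` {..<l})" using that by (intro span_mono) auto
  then show "\<beta> l \<notin> span (\<beta> ` {..<k})" using reduced_basis_notin by blast
qed

lemma span_reduced_basis_subset: "span (\<beta> ` {..<k}) \<subseteq> ball_L (absval (\<beta> k))"
proof (rule span_minimal)
  show "\<beta> ` {..<k} \<subseteq> ball_L (absval (\<beta> k))"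
    using reduced_basis_in reduced_basis_mono by (auto simp: ball_L_def)
qed (rule subspace_ball_L, simp)

lemma independent_reduced_basis: "independent (range \<beta>)"
proof -
  have fin: "independent (\<beta> ` {..<k})" for k
  proof (induction k)
    case (Suc k)
    from independent_insertI[OF reduced_basis_notin this] show ?case by (simp add: lessThan_Suc)
  qed (simp add: independent_empty)
  have "independent (\<Union>k. \<beta> ` {..<k})"
  proof (rule independent_Union_directed)
    fix c d assume "c \<in> range (\<lambda>k. \<beta> ` {..<k})" "d \<in> range (\<lambda>k. \<beta> ` {..<k})"
    then obtain k l where "c = \<beta> ` {..<k}" "d = \<beta> ` {..<l}" by auto
    then show "c \<subseteq> d \<or> d \<subseteq> c" by (cases "k \<le> l") (auto intro!: image_mono)
  qed (use fin in auto)
  moreover have "(\<Union>k. \<beta> ` {..<k}) = range \<beta>" by auto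
  ultimately show ?thesis by simp
qed

text \<open>A vector of \<open>L\<close> outside the span would be at least as long as every
  \<open>\<beta> k\<close>, which would put infinitely many vectors into one finite ball.\<close>

lemma span_reduced_basis: "span (range \<beta>) = L"
proof (intro equalityI subsetI)
  fix x assume "x \<in> span (range \<beta>)"
  then show "x \<in> L"
    using span_minimal[OF _ subspace_L, of "range \<beta>"] reduced_basis_in by auto
next
  fix x assume x: "x \<in> L"
  show "x \<in> span (range \<beta>)"
  proof (rule ccontr)
    assume "x \<notin> span (range \<beta>)"
    then have "x \<notin> span (\<beta> ` {..<k})" for k
      using span_mono[of "\<beta> ` {..<k}" "range \<beta>"] by auto
    then have "range \<beta> \<subseteq> ball_L (absval x)"
      using reduced_basis_in reduced_basis_le[OF x] by (auto simp: ball_L_def)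
    then have "finite (range \<beta>)" using finite_ball_L finite_subset by blast
    then show False using inj_reduced_basis finite_imageD[of \<beta> UNIV] by auto
  qed
qed

text \<open>A finite nonzero span is not stable under \<open>t\<close>, so it contains some
  \<open>u\<close> with \<open>t * u\<close> outside, and \<open>t * u\<close> bounds the next
  minimum.\<close>

lemma reduced_basis_growth: "absval (\<beta> k) \<le> absval t ^ k * absval (\<beta> 0)"
proof (induction k)
  case (Suc k)
  let ?U = "span (\<beta> ` {..<Suc k})"
  have "absval (\<beta> (Suc k)) \<le> absval t * absval (\<beta> k)"
  proof (rule ccontr)
    assume contr: "\<not> ?thesis"
    have "t * u \<in> ?U" if u: "u \<in> ?U" for u
    proof (rule ccontr)
      assume notin: "t * u \<notin> ?U"
      have "?U \<subseteq> ball_L (absval (\<beta> k))"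
      proof (rule span_minimal)
        show "\<beta> ` {..<Suc k} \<subseteq> ball_L (absval (\<beta> k))"
          using reduced_basis_in reduced_basis_mono by (auto simp: ball_L_def)
      qed (rule subspace_ball_L, simp)
      then have u': "u \<in> L" "absval u \<le> absval (\<beta> k)" using u by (auto simp: ball_L_def)
      have "absval (\<beta> (Suc k)) \<le> absval (t * u)"
        using reduced_basis_le[OF L_t[OF u'(1)] notin] .
      also have "\<dots> \<le> absval t * absval (\<beta> k)"
        unfolding absval_mult using u'(2) by (intro mult_left_mono) auto
      finally show False using contr by simp
    qed
    moreover have "\<beta> 0 \<in> ?U" by (intro span_base) auto
    ultimately show False
      using no_finite_t_stable[OF finite_span_lessThan, of \<beta> "Suc k" "\<beta> 0"] reduced_basis_nonzero by blast
  qed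
  also have "\<dots> \<le> absval t * (absval t ^ k * absval (\<beta> 0))"
    using Suc.IH by (intro mult_left_mono) auto
  finally show ?case by simp
qed simp

text \<open>Each new basis vector adds a disjoint coset, so the size at least doubles.\<close>

lemma card_span_reduced_basis: "2 ^ k \<le> card (span (\<beta> ` {..<k}))"
proof (induction k)
  case (Suc k)
  let ?U = "span (\<beta> ` {..<k})"
  have "?U \<subseteq> span (\<beta> ` {..<Suc k})"
    by (intro span_mono image_mono) auto
  moreover have "\<beta> k \<in> span (\<beta> ` {..<Suc k})"
    by (intro span_base) auto
  ultimately have sub: "?U \<union> (+) (\<beta> k) ` ?U \<subseteq> span (\<beta> ` {..<Suc k})"
    using span_add by blast
  have "?U \<inter> (+) (\<beta> k) ` ?U = {}"
    using reduced_basis_notin[of k] span_add_eq2 by auto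
  then have "card (?U \<union> (+) (\<beta> k) ` ?U) = card ?U + card ?U"
    using finite_span_lessThan by (subst card_Un_disjoint) (auto simp: card_image inj_on_def)
  then have "2 * card ?U \<le> card (span (\<beta> ` {..<Suc k}))"
    using card_mono[OF finite_span_lessThan sub] by simp
  then show ?case using Suc.IH by simp
qed simp

section \<open>Decay of the coefficients along a reduced basis\<close>

definition coord :: "nat \<Rightarrow> 'c \<Rightarrow> 'c" where
  "coord k x = e (representation (range \<beta>) x (\<beta> k))"

lemma absval_coord_le: "absval (coord k x) \<le> 1"
  by (simp add: coord_def absval_const_le)

text \<open>The coefficient at \<open>\<beta> k\<close> of the sum of all
  \<open>inverse x \<otimes> x\<close>, that is, of minus the zeta element.\<close>

definition dual_sum :: "nat \<Rightarrow> 'c" where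
  "dual_sum k = (\<Sum>\<^sub>\<infinity>x\<in>L - {0}. inverse x * coord k x)"

lemma dual_sum: "((\<lambda>x. inverse x * coord k x) has_sum dual_sum k) (L - {0})"
  unfolding dual_sum_def
  by (intro has_sum_infsum vanishing_imp_summable vanishing_inverse absval_coord_le)

text \<open>
  The coordinate functional vanishes on the span \<open>U\<close> of the preceding basis vectors, so the sum splits
  into sums over cosets of \<open>U\<close>, and each of those has numerator the product of the nonzero elements
  of \<open>U\<close>, most of which are much smaller than \<open>\<beta> k\<close>.
\<close>

lemma absval_dual_sum_le:
  "absval (dual_sum k) \<le> (\<Prod>u\<in>span (\<beta> ` {..<k}) - {0}. absval u) / absval (\<beta> k) ^ card (span (\<beta> ` {..<k}))"
    (is "_ \<le> ?C0")
proof -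
  let ?U = "span (\<beta> ` {..<k})"
  define C where "C = ?C0"
  have U_fin: "finite ?U" by (rule finite_span_lessThan)
  have C_pos: "C > 0"
    unfolding C_def
    by (intro divide_pos_pos prod_pos zero_less_power absval_pos reduced_basis_nonzero ballI) auto
  \<comment> \<open>Beyond the radius \<open>1 / C\<close> each single term is at most
    \<open>C\<close>; the radius \<open>absval (\<beta> k)\<close> is there for \<open>V\<close> to
    contain the span.\<close>
  define V where "V = ball_L (max (absval (\<beta> k)) (1 / C))"
  have V: "finite V" "subspace V"
    unfolding V_def by (auto intro: finite_ball_L subspace_ball_L simp: le_max_iff_disj)
  have UV: "?U \<subseteq> V"
    using span_reduced_basis_subset[of k] by (auto simp: V_def ball_L_def le_max_iff_disj)
  have VL: "V \<subseteq> L" by (auto simp: V_def ball_L_def)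
  have "absval (dual_sum k - (\<Sum>x\<in>V - {0}. inverse x * coord k x)) \<le> C"
  proof (rule absval_has_sum_diff_le[OF dual_sum])
    fix x assume x: "x \<in> L - {0} - (V - {0})"
    then have "1 / C < absval x" by (auto simp: V_def ball_L_def)
    moreover have "absval x > 0" using x by (intro absval_pos) auto
    ultimately have "inverse (absval x) \<le> C"
      using C_pos by (simp add: field_simps)
    moreover have "absval (inverse x * coord k x) \<le> inverse (absval x) * 1"
      unfolding absval_mult absval_inverse by (intro mult_left_mono absval_coord_le) simp
    ultimately show "absval (inverse x * coord k x) \<le> C" by linarith
  qed (use V VL C_pos in auto)
  moreover have "absval (\<Sum>x\<in>V - {0}. inverse x * coord k x) \<le> C"
    unfolding C_def
  proof (rule absval_weighted_sum_inverse_le)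
    fix u assume u: "u \<in> ?U"
    have "representation (range \<beta>) u = representation (\<beta> ` {..<k}) u"
      using independent_reduced_basis u by (intro representation_extend) auto
    moreover have "\<beta> k \<notin> \<beta> ` {..<k}" 
      using reduced_basis_notin[of k] span_base[of "\<beta> k" "\<beta> ` {..<k}"] by blast
    then have "representation (\<beta> ` {..<k}) u (\<beta> k) = 0"
      using representation_ne_zero[of "\<beta> ` {..<k}" u "\<beta> k"] by blast
    ultimately show *: "coord k u = 0" by (simp add: coord_def field_embedding_0 emb)
    fix v assume v: "v \<in> V"
    have "u \<in> span (range \<beta>)" "v \<in> span (range \<beta>)"
      using u v UV VL by (auto simp: span_reduced_basis)
    then show "coord k (v + u) = coord k v"
      using independent_reduced_basis *
      by (simp add: coord_def representation_add field_embedding_add emb)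
  next
    fix v assume "v \<in> V - ?U"
    then show "absval (\<beta> k) \<le> absval v" using reduced_basis_le VL by auto
  qed (use V UV reduced_basis_nonzero absval_coord_le in
      \<open>auto simp: span_zero intro!: absval_pos intro: subspace_diff span_diff\<close>)
  ultimately have "absval (dual_sum k) \<le> C"
    using absval_add_le[of "dual_sum k - (\<Sum>x\<in>V - {0}. inverse x * coord k x)" "\<Sum>x\<in>V - {0}. inverse x * coord k x"]
    by auto
  then show ?thesis by (simp add: C_def)
qed

text \<open>Vectors shorter than \<open>\<beta> k\<close> lie in the span of its predecessors. So
  the span contains the ball of radius \<open>absval (\<beta> k) / absval t\<close>, which has at
  least \<open>2 ^ k / card E\<close> elements by \<open>card_ball_L_mult\<close>. Each of its
  nonzero elements, counted by \<open>m\<close>, gains a factor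
  \<open>inverse (absval t)\<close>.\<close>

lemma absval_dual_sum_decay:
  "\<exists>m. 2 ^ k \<le> card E * Suc m \<and> absval (dual_sum k) \<le> inverse (absval (\<beta> 0)) * inverse (absval t) ^ m"
proof -
  let ?U = "span (\<beta> ` {..<k})" and ?\<rho> = "absval (\<beta> k)"
  define S where "S = ball_L (?\<rho> / absval t) - {0}"
  have \<rho>: "?\<rho> > 0" by (intro absval_pos reduced_basis_nonzero)
  have U_fin: "finite ?U" by (rule finite_span_lessThan)
  have S_U: "S \<subseteq> ?U - {0}"
  proof
    fix x assume x: "x \<in> S"
    then have "absval x \<le> ?\<rho> / absval t" by (simp add: S_def ball_L_def)
    also have "\<dots> < ?\<rho> / 1"
      using \<rho> t by (intro divide_strict_left_mono) auto
    finally have "\<not> ?\<rho> \<le> absval x" by simp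
    then show "x \<in> ?U - {0}"
      using reduced_basis_le[of x k] x by (auto simp: S_def ball_L_def)
  qed
  have "2 ^ k \<le> card (ball_L ?\<rho>)"
    using card_span_reduced_basis[of k] card_mono[OF finite_ball_L span_reduced_basis_subset[of k]] by simp
  also have "\<dots> \<le> card E * card (ball_L (?\<rho> / absval t))"
  proof -
    have "t \<noteq> 0" using t by auto
    then show ?thesis
      using card_ball_L_mult(2)[OF finite_ball_L, of "?\<rho> / absval t"] by simp
  qed
  also have "card (ball_L (?\<rho> / absval t)) = Suc (card S)"
  proof -
    have "0 \<in> ball_L (?\<rho> / absval t)" using L_0 by (simp add: ball_L_def)
    then show ?thesis unfolding S_def by (rule card.remove[OF finite_ball_L])
  qed
  finally have "2 ^ k \<le> card E * Suc (card S)" .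
  moreover have "absval (dual_sum k) \<le> inverse (absval (\<beta> 0)) * inverse (absval t) ^ card S"
  proof -
    \<comment> \<open>The denominator has one factor more than the numerator, belonging to the
      element 0; it is the source of \<open>inverse (absval (\<beta> 0))\<close>.\<close>
    have "card ?U = Suc (card (?U - {0}))"
      using U_fin span_zero by (intro card.remove) auto
    then have "absval (dual_sum k) \<le> (\<Prod>u\<in>?U - {0}. absval u) / (?\<rho> * ?\<rho> ^ card (?U - {0}))"
      using absval_dual_sum_le[of k] by simp
    also have "\<dots> = inverse ?\<rho> * (\<Prod>u\<in>?U - {0}. absval u / ?\<rho>)"
      by (simp add: prod_dividef field_simps)
    also have "(\<Prod>u\<in>?U - {0}. absval u / ?\<rho>) = (\<Prod>u\<in>?U - {0} - S. absval u / ?\<rho>) * (\<Prod>u\<in>S. absval u / ?\<rho>)"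
      using U_fin S_U by (intro prod.subset_diff) auto
    also have "\<dots> \<le> 1 * (\<Prod>u\<in>S. inverse (absval t))"
    proof (intro mult_mono prod_mono prod_le_1 conjI)
      fix u assume "u \<in> ?U - {0} - S"
      then show "absval u / ?\<rho> \<le> 1"
        using span_reduced_basis_subset[of k] \<rho> by (auto simp: ball_L_def)
    next
      fix u assume "u \<in> S"
      then show "absval u / ?\<rho> \<le> inverse (absval t)"
        using \<rho> t by (auto simp: S_def ball_L_def field_simps)
    qed (auto intro!: prod_nonneg)
    finally have "absval (dual_sum k) \<le> inverse ?\<rho> * inverse (absval t) ^ card S"
      using \<rho> by simp
    also have "inverse ?\<rho> \<le> inverse (absval (\<beta> 0))"
      using reduced_basis_mono[of 0 k] by (intro le_imp_inverse_le absval_pos reduced_basis_nonzero) auto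
    finally show ?thesis by (simp add: mult_right_mono)
  qed
  ultimately show ?thesis by blast
qed

lemma dual_sum_superexponential_decay:
  assumes R: "R \<ge> 1"
  shows "(\<lambda>k. absval (dual_sum k) * R ^ (k + c)) \<longlonglongrightarrow> 0"
proof (rule tendsto_sandwich[OF _ _ tendsto_const])
  \<comment> \<open>Chosen so that \<open>2 ^ k \<le> card E * Suc m\<close> becomes
    \<open>exp (a * 2 ^ k) \<le> absval t ^ Suc m\<close>. The exponent \<open>Suc m\<close> in
    place of \<open>m\<close> puts the factor \<open>absval t\<close> into \<open>K\<close>.\<close>
  define a where "a = ln (absval t) / card E"
  have "card E > 0" using E(1) E(3)[OF L_0] by (auto simp: card_gt_0_iff)
  then have a: "a > 0" using t by (simp add: a_def)
  define K where "K = inverse (absval (\<beta> 0)) * absval t * R ^ c"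
  have "absval (dual_sum k) * R ^ (k + c) \<le> K * exp (ln R * k - a * 2 ^ k)" for k
  proof -
    obtain m where m: "2 ^ k \<le> card E * Suc m" "absval (dual_sum k) \<le> inverse (absval (\<beta> 0)) * inverse (absval t) ^ m"
      using absval_dual_sum_decay by blast
    have "(2::real) ^ k \<le> real (card E) * real (Suc m)"
      using m(1) by (metis of_nat_le_iff of_nat_mult of_nat_numeral of_nat_power)
    then have "a * 2 ^ k \<le> a * (real (card E) * real (Suc m))"
      using a by (intro mult_left_mono) auto
    also have "\<dots> = ln (absval t) * Suc m"
      using \<open>card E > 0\<close> by (simp add: a_def del: of_nat_Suc)
    finally have "exp (a * 2 ^ k) \<le> exp (ln (absval t) * Suc m)" by simp
    also have "\<dots> = absval t ^ Suc m"
      using t by (subst exp_of_nat2_mult) auto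
    finally have "inverse (absval t ^ Suc m) \<le> inverse (exp (a * 2 ^ k))"
      by (intro le_imp_inverse_le) auto
    then have "absval t * inverse (absval t ^ Suc m) \<le> absval t * exp (- (a * 2 ^ k))"
      using t by (intro mult_left_mono) (auto simp: exp_minus)
    moreover have "absval t * inverse (absval t ^ Suc m) = inverse (absval t) ^ m"
    proof -
      have "t \<noteq> 0" using t by auto
      then show ?thesis by (simp add: power_inverse)
    qed
    ultimately have pow: "inverse (absval t) ^ m \<le> absval t * exp (- (a * 2 ^ k))"
      by simp
    have "absval (dual_sum k) * R ^ (k + c) \<le> inverse (absval (\<beta> 0)) * (absval t * exp (- (a * 2 ^ k))) * R ^ (k + c)"
      using m(2) pow R
      by (intro mult_right_mono order_trans[OF m(2)] mult_left_mono) auto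
    also have "\<dots> = inverse (absval (\<beta> 0)) * (absval t * exp (- (a * 2 ^ k))) * (exp (ln R * k) * R ^ c)"
      using R by (subst exp_of_nat2_mult) (auto simp: power_add)
    also have "\<dots> = K * exp (ln R * k - a * 2 ^ k)"
      by (simp add: K_def exp_diff exp_minus field_simps)
    finally show ?thesis .
  qed
  then show "eventually (\<lambda>k. absval (dual_sum k) * R ^ (k + c) \<le> K * exp (ln R * k - a * 2 ^ k)) sequentially"
    by simp
  define b where "b = ln R"
  have "(\<lambda>k::nat. K * exp (b * k - a * 2 ^ k)) \<longlonglongrightarrow> 0"
    using a by real_asymp
  then show "(\<lambda>k::nat. K * exp (ln R * k - a * 2 ^ k)) \<longlonglongrightarrow> 0"
    by (simp add: b_def)
qed (use R in auto)

end

end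

section \<open>Digit expansions and analytic functions\<close>

definition is_subalgebra :: "('f::field \<Rightarrow> 'k::field) \<Rightarrow> 'k set \<Rightarrow> bool" where
  "is_subalgebra i A \<longleftrightarrow> range i \<subseteq> A \<and> (\<forall>x\<in>A. \<forall>y\<in>A. x + y \<in> A \<and> x * y \<in> A)"

lemma is_subalgebra_algebra_generated:
  assumes A: "is_subalgebra i A" and G: "G \<subseteq> A"
  shows "algebra_generated i G \<subseteq> A"
proof
  fix x assume "x \<in> algebra_generated i G"
  then show "x \<in> A"
    by induction (use A G in \<open>auto simp: is_subalgebra_def\<close>)
qed

lemma
  assumes emb: "field_embedding i" and A: "is_subalgebra i A"
  shows is_subalgebra_power: "x \<in> A \<Longrightarrow> x ^ n \<in> A"
    and is_subalgebra_sum: "(\<And>s. s \<in> S \<Longrightarrow> g s \<in> A) \<Longrightarrow> sum g S \<in> A"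
    and is_subalgebra_0: "0 \<in> A" and is_subalgebra_minus: "x \<in> A \<Longrightarrow> - x \<in> A"
proof -
  have "i 0 \<in> A" "i 1 \<in> A" "i (- 1) \<in> A" using A by (auto simp: is_subalgebra_def)
  then have *: "0 \<in> A" "1 \<in> A" "- 1 \<in> A"
    by (simp_all add: field_embedding_0 field_embedding_1 field_embedding_minus emb)
  then show "0 \<in> A" by simp
  show "x \<in> A \<Longrightarrow> x ^ n \<in> A"
    using * A by (induction n) (auto simp: is_subalgebra_def)
  show "(\<And>s. s \<in> S \<Longrightarrow> g s \<in> A) \<Longrightarrow> sum g S \<in> A"
    using * A by (induction S rule: infinite_finite_induct) (auto simp: is_subalgebra_def)
  show "- x \<in> A" if "x \<in> A"
  proof -
    have "(- 1) * x \<in> A" using * A that unfolding is_subalgebra_def by blast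
    then show ?thesis by simp
  qed
qed

lemma affine_point_digits:
  assumes emb: "field_embedding i" "field_embedding j" and A: "is_subalgebra i A" and P: "P \<in> affine_points i j A"
    and t: "t \<in> A" and \<epsilon>: "\<And>c. \<epsilon> c \<in> A"
  shows "P (\<Sum>c\<le>n::nat. t ^ c * \<epsilon> c) = (\<Sum>c\<le>n. P t ^ c * P (\<epsilon> c))"
proof -
  have add: "\<And>x y. x \<in> A \<Longrightarrow> y \<in> A \<Longrightarrow> P (x + y) = P x + P y"
    and mult: "\<And>x y. x \<in> A \<Longrightarrow> y \<in> A \<Longrightarrow> P (x * y) = P x * P y"
    and const: "\<And>a. P (i a) = j (i a)"
    using P by (auto simp: affine_points_def)
  have "P 1 = 1" using const[of 1] by (simp add: field_embedding_1 emb)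
  then have pow: "P (t ^ c) = P t ^ c" for c
    using is_subalgebra_power[OF emb(1) A t] t by (induction c) (auto simp: mult)
  have mem: "t ^ c * \<epsilon> c \<in> A" for c
    using is_subalgebra_power[OF emb(1) A t] \<epsilon> A by (auto simp: is_subalgebra_def)
  show ?thesis
    using mem is_subalgebra_power[OF emb(1) A t] \<epsilon>
    by (induction n) (auto simp: add mult pow is_subalgebra_sum[OF emb(1) A] simp del: power_Suc)
qed

text \<open>The exponent of the monomial \<open>t ^ c * \<epsilon>\<close> in the coordinates indexed by \<open>insert t D\<close>.\<close>

definition digit_index :: "'k \<Rightarrow> nat \<Rightarrow> 'k \<Rightarrow> ('k \<Rightarrow> nat)" where
  "digit_index t c \<epsilon> = (\<lambda>g. (if g = t then c else 0) + (if g = \<epsilon> then 1 else 0))"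

text \<open>The two exponents are added because \<open>\<epsilon>\<close> may equal
  \<open>t\<close>; the total degree is \<open>Suc c\<close> in either case.\<close>

lemma digit_index:
  assumes G: "finite G" "t \<in> G" "\<epsilon> \<in> G"
  shows "digit_index t c \<epsilon> \<in> multi_indices G" "(\<Sum>g\<in>G. digit_index t c \<epsilon> g) = Suc c"
    "(\<Prod>g\<in>G. P g ^ digit_index t c \<epsilon> g) = (P t :: 'c::comm_monoid_mult) ^ c * P \<epsilon>"
proof -
  show "digit_index t c \<epsilon> \<in> multi_indices G"
    using G by (auto simp: digit_index_def multi_indices_def)
  show "(\<Sum>g\<in>G. digit_index t c \<epsilon> g) = Suc c"
    using G by (simp add: digit_index_def sum.distrib)
  have "(\<Prod>g\<in>G. P g ^ digit_index t c \<epsilon> g) =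
      (\<Prod>g\<in>G. if g = t then P g ^ c else 1) * (\<Prod>g\<in>G. if g = \<epsilon> then P g else 1)"
    unfolding prod.distrib[symmetric] digit_index_def by (intro prod.cong) (auto simp: mult.commute)
  also have "\<dots> = P t ^ c * P \<epsilon>"
    using G by (simp add: mult.commute)
  finally show "(\<Prod>g\<in>G. P g ^ digit_index t c \<epsilon> g) = P t ^ c * P \<epsilon>" .
qed

text \<open>\<open>P (a k)\<close> is a sum of monomials of degree at most \<open>k + c0 + 1\<close>
  in the coordinates \<open>insert t D\<close>. By the decay, the terms indexed by \<open>k\<close>
  and a digit position form a null family on every polydisc. Summed by \<open>k\<close> it gives the
  function, summed by monomial the power series.\<close>

lemma rigid_analytic_digit_series:
  fixes i :: "'f::field \<Rightarrow> 'k::field" and j :: "'k \<Rightarrow> 'c::complete_nonarch_field"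
  assumes emb: "field_embedding i" "field_embedding j" and A: "is_subalgebra i A"
    and t: "t \<in> A" and D: "finite D" "D \<subseteq> A"
    and gen: "\<And>a. a \<in> A \<Longrightarrow> \<exists>n \<epsilon>. (\<forall>c. \<epsilon> c \<in> D) \<and> a = (\<Sum>c\<le>n::nat. t ^ c * \<epsilon> c)"
    and a: "\<And>k. \<exists>\<epsilon>. (\<forall>c. \<epsilon> c \<in> D) \<and> a k = (\<Sum>c\<le>k + c0. t ^ c * \<epsilon> c)"
    and decay: "\<And>R c. R \<ge> 1 \<Longrightarrow> (\<lambda>k. absval (\<gamma> k) * R ^ (k + c)) \<longlonglongrightarrow> 0"
  shows "rigid_analytic i j A (\<lambda>P. \<Sum>\<^sub>\<infinity>k. \<gamma> k * P (a k))"
proof -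
  define G where "G = insert t D"
  have G: "finite G" "t \<in> G" "D \<subseteq> G" "G \<subseteq> A" using t D by (auto simp: G_def)
  have alg_G: "algebra_generated i G = A"
  proof (intro equalityI subsetI)
    fix x assume "x \<in> A"
    then obtain n \<epsilon> where \<epsilon>: "\<And>c. \<epsilon> c \<in> D" "x = (\<Sum>c\<le>n::nat. t ^ c * \<epsilon> c)"
      using gen by blast
    have "1 \<in> algebra_generated i G"
      using algebra_generated.const[of i 1 G] by (simp add: field_embedding_1 emb)
    then have "t ^ c \<in> algebra_generated i G" for c
      using G(2) by (induction c) (auto intro: algebra_generated.intros)
    then have mem: "t ^ c * \<epsilon> c \<in> algebra_generated i G" for c
      using \<epsilon>(1) G(3) by (blast intro: algebra_generated.intros)
    have "(\<Sum>c\<le>n. t ^ c * \<epsilon> c) \<in> algebra_generated i G"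
      using mem[of 0] by (induction n) (auto intro: algebra_generated.add mem simp del: power_Suc)
    then show "x \<in> algebra_generated i G" using \<epsilon> by simp
  qed (use is_subalgebra_algebra_generated[OF A G(4)] in auto)
  obtain \<epsilon> where \<epsilon>: "\<And>k c. \<epsilon> k c \<in> D" "\<And>k. a k = (\<Sum>c\<le>k + c0. t ^ c * \<epsilon> k c)"
    using a by metis
  define S where "S = (SIGMA k:UNIV. {..k + c0})"
  define p where "p s = (case s of (k, c) \<Rightarrow> digit_index t c (\<epsilon> k c))" for s
  \<comment> \<open>A monomial can occur for infinitely many \<open>k\<close>, so its coefficient is
    itself a series. It is the same for all radii.\<close>
  define u where "u \<nu> = (\<Sum>\<^sub>\<infinity>s\<in>{s \<in> S. p s = \<nu>}. \<gamma> (fst s))" for \<nu>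
  have \<epsilon>G: "\<epsilon> k c \<in> G" for k c using \<epsilon>(1) G(3) by blast
  have p: "p ` S \<subseteq> multi_indices G" "(\<Sum>g\<in>G. p s g) = Suc (snd s)" for s
    using digit_index(1,2)[OF G(1,2) \<epsilon>G] by (auto simp: p_def case_prod_unfold)
  have finite_k: "finite {k. \<delta> \<le> absval (\<gamma> k) * R ^ (k + c)}" if "R \<ge> 1" "\<delta> > 0" for R \<delta> c
  proof -
    have "eventually (\<lambda>k. absval (\<gamma> k) * R ^ (k + c) < \<delta>) sequentially"
      using decay[OF that(1), of c] that(2) by (rule order_tendstoD)
    then obtain N where "\<And>k. k \<ge> N \<Longrightarrow> absval (\<gamma> k) * R ^ (k + c) < \<delta>"
      by (auto simp: eventually_sequentially)
    then have "{k. \<delta> \<le> absval (\<gamma> k) * R ^ (k + c)} \<subseteq> {..<N}" by (force simp: not_le)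
    then show ?thesis by (rule finite_subset) simp
  qed
  have finite_S: "finite {s \<in> S. \<delta> \<le> absval (\<gamma> (fst s)) * R ^ (fst s + c)}" if "R \<ge> 1" "\<delta> > 0" for R \<delta> c
  proof (rule finite_subset)
    show "{s \<in> S. \<delta> \<le> absval (\<gamma> (fst s)) * R ^ (fst s + c)} \<subseteq> (SIGMA k:{k. \<delta> \<le> absval (\<gamma> k) * R ^ (k + c)}. {..k + c0})"
      by (auto simp: S_def)
  qed (use finite_k[OF that] in auto)
  have "vanishing (\<lambda>s. \<gamma> (fst s)) S"
    unfolding vanishing_def using finite_S[of 1] by simp
  then have "vanishing (\<lambda>s. \<gamma> (fst s)) {s \<in> S. p s = \<nu>}" for \<nu>
    by (rule vanishing_subset) auto
  then have u: "((\<lambda>s. \<gamma> (fst s)) has_sum u \<nu>) {s \<in> S. p s = \<nu>}" for \<nu>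
    unfolding u_def by (intro has_sum_infsum vanishing_imp_summable)
  show ?thesis
    unfolding rigid_analytic_def
  proof (intro exI[of _ G] exI[of _ u] conjI allI ballI impI G(1) alg_G)
    fix R :: real assume R: "R > 0"
    \<comment> \<open>Powers of \<open>R'\<close> do not decrease with the exponent, so the bound in
      degree \<open>k + c0 + 1\<close> covers monomials of lower degree.\<close>
    define R' where "R' = max 1 R"
    have R': "R' \<ge> 1" "R \<le> R'" by (auto simp: R'_def)
    have R_le: "R ^ Suc (snd s) \<le> R' ^ (fst s + Suc c0)" if "s \<in> S" for s
    proof -
      have "R ^ Suc (snd s) \<le> R' ^ Suc (snd s)" using R R' by (intro power_mono) auto
      also have "\<dots> \<le> R' ^ (fst s + Suc c0)"
        using that R' by (intro power_increasing) (auto simp: S_def)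
      finally show ?thesis .
    qed
    show "finite {\<nu> \<in> multi_indices G. absval (u \<nu>) * R ^ (\<Sum>g\<in>G. \<nu> g) \<ge> \<delta>}" if \<delta>: "\<delta> > 0" for \<delta>
    proof (rule finite_subset)
      \<comment> \<open>The half turns the weak inequality that passes to infinite sums into a
        strict one.\<close>
      let ?X = "{s \<in> S. \<delta> / 2 \<le> absval (\<gamma> (fst s)) * R' ^ (fst s + Suc c0)}"
      show "finite (p ` ?X)"
        by (intro finite_imageI finite_S R') (use \<delta> in simp)
      show "{\<nu> \<in> multi_indices G. absval (u \<nu>) * R ^ (\<Sum>g\<in>G. \<nu> g) \<ge> \<delta>} \<subseteq> p ` ?X"
      proof (rule subsetI, rule ccontr)
        fix \<nu> assume \<nu>: "\<nu> \<in> {\<nu> \<in> multi_indices G. absval (u \<nu>) * R ^ (\<Sum>g\<in>G. \<nu> g) \<ge> \<delta>}" and notin: "\<nu> \<notin> p ` ?X"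
        define r where "r = R ^ (\<Sum>g\<in>G. \<nu> g)"
        have r: "r > 0" using R by (simp add: r_def)
        have "absval (u \<nu>) \<le> \<delta> / 2 / r"
        proof (rule absval_has_sum_le[OF u])
          fix s assume s: "s \<in> {s \<in> S. p s = \<nu>}"
          then have "absval (\<gamma> (fst s)) * r \<le> absval (\<gamma> (fst s)) * R' ^ (fst s + Suc c0)"
            using R_le[of s] p(2)[of s] unfolding r_def by (intro mult_left_mono) auto
          also have "\<dots> < \<delta> / 2"
          proof (rule ccontr)
            assume "\<not> ?thesis"
            then have "s \<in> ?X" using s by auto
            then show False using notin s by blast
          qed
          finally show "absval (\<gamma> (fst s)) \<le> \<delta> / 2 / r"
            using r by (simp add: pos_le_divide_eq)
        qed (use \<delta> r in auto)
        then have "absval (u \<nu>) * r \<le> \<delta> / 2" using r by (simp add: pos_le_divide_eq)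
        then show False using \<nu> \<delta> by (simp add: r_def)
      qed
    qed
    show "((\<lambda>\<nu>. u \<nu> * (\<Prod>g\<in>G. P g ^ \<nu> g)) has_sum (\<Sum>\<^sub>\<infinity>k. \<gamma> k * P (a k))) (multi_indices G)"
      if P: "P \<in> affine_points i j A" "\<forall>g\<in>G. absval (P g) \<le> R" for P
    proof -
      define M where "M \<nu> = (\<Prod>g\<in>G. P g ^ \<nu> g)" for \<nu>
      define h where "h s = \<gamma> (fst s) * M (p s)" for s
      have "vanishing h S"
        unfolding vanishing_def
      proof (intro allI impI)
        fix \<delta> :: real assume \<delta>: "\<delta> > 0"
        have "absval (h s) \<le> absval (\<gamma> (fst s)) * R' ^ (fst s + Suc c0)" if s: "s \<in> S" for s
        proof -
          have "absval (M (p s)) \<le> (\<Prod>g\<in>G. R ^ p s g)"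
            unfolding M_def absval_prod absval_power using P(2) by (intro prod_mono) (auto intro: power_mono)
          also have "\<dots> = R ^ Suc (snd s)"
            by (simp only: power_sum[symmetric] p(2))
          finally have "absval (M (p s)) \<le> R' ^ (fst s + Suc c0)" using R_le[OF s] by linarith
          then show ?thesis unfolding h_def absval_mult by (intro mult_left_mono) auto
        qed
        then have "{s \<in> S. \<delta> \<le> absval (h s)} \<subseteq> {s \<in> S. \<delta> \<le> absval (\<gamma> (fst s)) * R' ^ (fst s + Suc c0)}"
          by fastforce
        then show "finite {s \<in> S. \<delta> \<le> absval (h s)}"
          using finite_S[OF R'(1) \<delta>] by (rule finite_subset)
      qed
      then obtain Y where Y: "(h has_sum Y) S"
        using vanishing_imp_summable unfolding summable_on_def by blast
      have "((\<lambda>\<nu>. u \<nu> * M \<nu>) has_sum Y) (multi_indices G)"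
      proof (rule has_sum_fibres[OF Y p(1)])
        fix \<nu>
        have "((\<lambda>s. \<gamma> (fst s) * M \<nu>) has_sum u \<nu> * M \<nu>) {s \<in> S. p s = \<nu>}"
          by (intro has_sum_cmult_left u)
        then show "(h has_sum u \<nu> * M \<nu>) {s \<in> S. p s = \<nu>}"
          by (rule has_sum_cong[THEN iffD1, rotated]) (auto simp: h_def)
      qed
      moreover have "((\<lambda>k. \<gamma> k * P (a k)) has_sum Y) UNIV"
      proof (rule has_sum_Sigma[OF uniformly_continuous_add_nonarch Y[unfolded S_def]])
        fix k
        have "\<epsilon> k c \<in> A" for c using \<epsilon>(1) D(2) by blast
        then have "P (a k) = (\<Sum>c\<le>k + c0. P t ^ c * P (\<epsilon> k c))"
          unfolding \<epsilon>(2) by (intro affine_point_digits[OF emb A P(1) t])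
        also have "\<dots> = (\<Sum>c\<le>k + c0. M (p (k, c)))"
          unfolding M_def p_def prod.case by (intro sum.cong digit_index(3)[OF G(1,2) \<epsilon>G, symmetric] refl)
        finally show "((\<lambda>c. h (k, c)) has_sum \<gamma> k * P (a k)) {..k + c0}"
          by (intro has_sum_finiteI) (auto simp: h_def sum_distrib_left)
      qed
      then have "(\<Sum>\<^sub>\<infinity>k. \<gamma> k * P (a k)) = Y" by (rule infsumI)
      ultimately show ?thesis by (simp add: M_def)
    qed
  qed
qed

section \<open>The zeta element of a period lattice\<close>

locale lattice_functional =
  fixes i :: "'f::{field,finite} \<Rightarrow> 'k::field"
    and j :: "'k \<Rightarrow> 'c::complete_nonarch_field"
    and infty :: "'k \<Rightarrow> int"
    and A BA :: "'k set"
    and \<Lambda> BL :: "'c set"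
    and f :: "'c \<Rightarrow> 'k"
  assumes curve: "curve_function_field i" "geometrically_irreducible i"
    and infty: "infty \<in> closed_points i"
    and A: "A = ring_A i infty"
    and C_infty: "is_C_infty infty j"
    and lattice: "period_lattice A j \<Lambda>"
    and bases: "basis_of (scale_C i j) BL \<Lambda>" "basis_of (scale_K i) BA A"
    and f: "A_linear_map A j \<Lambda> f"
begin

section \<open>The ring A and its absolute value\<close>

lemma emb_i: "field_embedding i"
  using curve by (simp add: curve_function_field_def)

lemma emb_j: "field_embedding j"
  using C_infty by (simp add: is_C_infty_def)

lemma emb_const: "field_embedding (\<lambda>a. j (i a))"
  by (rule field_embedding_compose[OF emb_i emb_j])

lemma absval_j: "\<exists>Q>1. \<forall>x. x \<noteq> 0 \<longrightarrow> absval (j x) = Q powi (- infty x)"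
  using C_infty by (simp add: is_C_infty_def)

lemma absval_const: "a \<noteq> 0 \<Longrightarrow> absval (j (i a)) = 1"
  using absval_j infty by (auto simp: closed_points_def field_embedding_eq_0_iff emb_i)

lemma absval_const_le: "absval (j (i a)) \<le> 1"
  using absval_const[of a] by (cases "a = 0") (auto simp: field_embedding_0 emb_i emb_j)

lemma subalgebra_A: "is_subalgebra i A"
  unfolding is_subalgebra_def
proof (intro conjI ballI subsetI)
  fix x assume "x \<in> range i"
  then obtain a where a: "x = i a" by blast
  have "v (i a) \<ge> 0" if "v \<in> closed_points i" for v
    using that by (cases "a = 0") (auto simp: closed_points_def field_embedding_0 emb_i)
  then show "x \<in> A" by (auto simp: a A ring_A_def)
next
  fix x y assume x: "x \<in> A" and y: "y \<in> A"
  have "v (x + y) \<ge> 0 \<and> v (x * y) \<ge> 0" if v: "v \<in> closed_points i - {infty}" for v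
  proof -
    have nonneg: "v x \<ge> 0" "v y \<ge> 0" using x y v by (auto simp: A ring_A_def)
    have "v 0 = 0" using v by (auto simp: closed_points_def)
    moreover have "v (x + y) \<ge> min (v x) (v y)" if "x \<noteq> 0" "y \<noteq> 0" "x + y \<noteq> 0"
      using v that by (auto simp: closed_points_def)
    moreover have "v (x * y) = v x + v y" if "x \<noteq> 0" "y \<noteq> 0"
      using v that by (auto simp: closed_points_def)
    ultimately show ?thesis
      using nonneg by (cases "x = 0"; cases "y = 0"; cases "x + y = 0") auto
  qed
  then show "x + y \<in> A" "x * y \<in> A" by (auto simp: A ring_A_def)
qed

lemmas A_power = is_subalgebra_power[OF emb_i subalgebra_A]
  and A_sum = is_subalgebra_sum[OF emb_i subalgebra_A]
  and A_0 = is_subalgebra_0[OF emb_i subalgebra_A]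

lemma A_const: "i a \<in> A" and A_add: "x \<in> A \<Longrightarrow> y \<in> A \<Longrightarrow> x + y \<in> A"
  and A_mult: "x \<in> A \<Longrightarrow> y \<in> A \<Longrightarrow> x * y \<in> A"
  using subalgebra_A by (auto simp: is_subalgebra_def)

lemma A_diff: "x \<in> A \<Longrightarrow> y \<in> A \<Longrightarrow> x - y \<in> A"
  using A_add[OF _ is_subalgebra_minus[OF emb_i subalgebra_A], of x y] by simp

text \<open>Absolute value at most 1 means no pole at infinity, and elements of \<open>A\<close>
  have no poles elsewhere.\<close>

lemma A_bounded_constant:
  assumes a: "a \<in> A" "absval (j a) \<le> 1"
  shows "a \<in> range i"
proof (rule no_poles_imp_constant[OF curve])
  fix v assume v: "v \<in> closed_points i"
  show "v a \<ge> 0"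
  proof (cases "v = infty")
    case True
    show ?thesis
    proof (rule ccontr)
      assume neg: "\<not> v a \<ge> 0"
      have "infty 0 = 0" using infty by (auto simp: closed_points_def)
      then have "a \<noteq> 0" using neg True by auto
      then obtain Q where Q: "Q > 1" "absval (j a) = Q powi (- infty a)" using absval_j by blast
      have "Q powi (- infty a) = Q ^ nat (- infty a)" using neg True by (simp add: power_int_def)
      also have "\<dots> > 1" using Q neg True by (intro one_less_power) auto
      finally show False using a Q by simp
    qed
  next
    case False
    then show ?thesis using v a by (auto simp: A ring_A_def)
  qed
qed

text \<open>A nonzero element of smaller absolute value would be a nonzero constant, and those have
  absolute value 1. This is the discreteness of \<open>A\<close>.\<close>

lemma absval_A_ge: "1 \<le> absval (j a)" if a: "a \<in> A" "a \<noteq> 0"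
proof (rule ccontr)
  assume contr: "\<not> ?thesis"
  then obtain c where "a = i c" using A_bounded_constant[OF a(1)] by auto
  moreover from this have "c \<noteq> 0" using a(2) field_embedding_0[OF emb_i] by auto
  ultimately show False using absval_const contr by simp
qed

lemma scale_C_eq: "scale_C i j = (\<lambda>a x. j (i a) * x)" and scale_K_eq: "scale_K i = (\<lambda>a x. i a * x)"
  by (auto simp: scale_C_def scale_K_def fun_eq_iff)

lemma vector_space_C: "vector_space (scale_C i j)" and vector_space_K: "vector_space (scale_K i)"
  unfolding scale_C_eq scale_K_eq by (rule vector_space_field_embedding emb_const emb_i)+

section \<open>The period lattice and its balls\<close>

lemma \<Lambda>_0: "0 \<in> \<Lambda>" and \<Lambda>_add: "x \<in> \<Lambda> \<Longrightarrow> y \<in> \<Lambda> \<Longrightarrow> x + y \<in> \<Lambda>"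
  and \<Lambda>_mult: "a \<in> A \<Longrightarrow> x \<in> \<Lambda> \<Longrightarrow> j a * x \<in> \<Lambda>"
  using lattice by (auto simp: period_lattice_def A_submodule_def)

lemma \<Lambda>_sum: "(\<And>s. s \<in> S \<Longrightarrow> g s \<in> \<Lambda>) \<Longrightarrow> sum g S \<in> \<Lambda>"
  by (induction S rule: infinite_finite_induct) (auto intro: \<Lambda>_0 \<Lambda>_add)

lemma f_A: "x \<in> \<Lambda> \<Longrightarrow> f x \<in> A" and f_add: "x \<in> \<Lambda> \<Longrightarrow> y \<in> \<Lambda> \<Longrightarrow> f (x + y) = f x + f y"
  and f_mult: "a \<in> A \<Longrightarrow> x \<in> \<Lambda> \<Longrightarrow> f (j a * x) = a * f x"
  using f by (auto simp: A_linear_map_def)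

lemma f_0: "f 0 = 0"
proof -
  have "f 0 + f 0 = f 0 + 0" using f_add[OF \<Lambda>_0 \<Lambda>_0] by (simp only: add_0_right)
  then show ?thesis by (simp only: add_left_cancel)
qed

lemma f_sum: "(\<And>s. s \<in> S \<Longrightarrow> g s \<in> \<Lambda>) \<Longrightarrow> f (sum g S) = (\<Sum>s\<in>S. f (g s))"
  by (induction S rule: infinite_finite_induct) (auto simp: f_0 f_add \<Lambda>_sum)

lemma \<Lambda>_separated: "\<exists>\<delta>>0. \<forall>x\<in>\<Lambda>. x \<noteq> 0 \<longrightarrow> \<delta> \<le> absval x"
proof -
  have "discrete \<Lambda>" using lattice by (simp add: period_lattice_def)
  then obtain T where T: "open T" "T \<inter> \<Lambda> = {0}"
    using discreteD[OF _ \<Lambda>_0] by (auto simp: isolated_in_def)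
  then have "0 \<in> T" by auto
  with T(1) obtain \<delta> where \<delta>: "\<delta> > 0" "\<forall>y. dist y 0 < \<delta> \<longrightarrow> y \<in> T"
    unfolding open_dist by (elim ballE exE conjE) auto
  have "\<delta> \<le> absval x" if "x \<in> \<Lambda>" "x \<noteq> 0" for x
  proof (rule ccontr)
    assume "\<not> \<delta> \<le> absval x"
    then have "x \<in> T \<inter> \<Lambda>" using \<delta>(2) that by (simp add: absval_def)
    then show False using T(2) that by simp
  qed
  then show ?thesis using \<delta>(1) by blast
qed

lemma finite_A_quotient:
  assumes t: "t \<in> A" "1 < absval (j t)"
  shows "\<exists>E. finite E \<and> E \<subseteq> A \<and> (\<forall>x\<in>A. \<exists>e\<in>E. \<exists>y\<in>A. x = e + t * y)"
proof (rule finite_quotient[OF curve(1) _ A_0])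
  show "t \<noteq> 0" using t by (auto simp: field_embedding_0 emb_j)
qed (use A_diff A_mult t in auto)

lemma t_lattice_A:
  assumes t: "t \<in> A" "1 < absval (j t)"
  shows "\<exists>E. t_lattice (\<lambda>a. j (i a)) (j t) (j ` A) E"
proof -
  obtain E where E: "finite E" "E \<subseteq> A" "\<forall>x\<in>A. \<exists>e\<in>E. \<exists>y\<in>A. x = e + t * y"
    using finite_A_quotient[OF t] by (elim exE conjE)
  have "t_lattice (\<lambda>a. j (i a)) (j t) (j ` A) (j ` E)"
  proof
    show "\<exists>\<delta>>0. \<forall>x\<in>j ` A. x \<noteq> 0 \<longrightarrow> \<delta> \<le> absval x"
      using absval_A_ge by (intro exI[of _ 1]) (auto simp: field_embedding_eq_0_iff emb_j)
    show "0 \<in> j ` A" using A_0 field_embedding_0[OF emb_j] by (intro image_eqI[of _ _ 0]) auto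
    show "x + y \<in> j ` A" if "x \<in> j ` A" "y \<in> j ` A" for x y
      using that A_add by (auto simp: field_embedding_add[OF emb_j, symmetric])
    show "j (i a) * x \<in> j ` A" if "x \<in> j ` A" for a x
      using that A_mult A_const by (auto simp: field_embedding_mult[OF emb_j, symmetric])
    show "j t * x \<in> j ` A" if "x \<in> j ` A" for x
      using that A_mult[OF t(1)] by (auto simp: field_embedding_mult[OF emb_j, symmetric])
    show "\<exists>\<epsilon>\<in>j ` E. \<exists>y\<in>j ` A. x = \<epsilon> + j t * y" if x: "x \<in> j ` A" for x
    proof -
      obtain a where a: "a \<in> A" "x = j a" using x by blast
      then obtain e y where "e \<in> E" "y \<in> A" "a = e + t * y" using E(3) by blast
      then show ?thesis
        using a(2) by (intro bexI[of _ "j e"] bexI[of _ "j y"])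
          (auto simp: field_embedding_add field_embedding_mult emb_j)
    qed
  qed (use E t emb_const absval_const in auto)
  then show ?thesis by blast
qed

text \<open>Representatives of \<Lambda> modulo t\<Lambda> are the combinations of generators whose
  coefficients represent \<open>A\<close> modulo \<open>t A\<close>.\<close>

lemma t_lattice_\<Lambda>:
  assumes t: "t \<in> A" "1 < absval (j t)"
  shows "\<exists>E. t_lattice (\<lambda>a. j (i a)) (j t) \<Lambda> E"
proof -
  obtain E where E: "finite E" "E \<subseteq> A" "\<forall>x\<in>A. \<exists>e\<in>E. \<exists>y\<in>A. x = e + t * y"
    using finite_A_quotient[OF t] by (elim exE conjE)
  obtain G where G: "finite G" "G \<subseteq> \<Lambda>" "\<forall>x\<in>\<Lambda>. \<exists>r. (\<forall>g\<in>G. r g \<in> A) \<and> x = (\<Sum>g\<in>G. j (r g) * g)"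
    using lattice by (auto simp: period_lattice_def A_finitely_generated_def)
  \<comment> \<open>Coefficient families are taken extensional on \<open>G\<close>, which makes
    their set finite.\<close>
  define E' where "E' = (\<lambda>r. \<Sum>g\<in>G. j (r g) * g) ` (G \<rightarrow>\<^sub>E E)"
  have sum_\<Lambda>: "(\<Sum>g\<in>G. j (r g) * g) \<in> \<Lambda>" if "\<And>g. g \<in> G \<Longrightarrow> r g \<in> A" for r
    using that G(2) by (intro \<Lambda>_sum \<Lambda>_mult) auto
  have "t_lattice (\<lambda>a. j (i a)) (j t) \<Lambda> E'"
  proof
    show "finite E'" unfolding E'_def using E G by (intro finite_imageI finite_PiE) auto
    show "E' \<subseteq> \<Lambda>"
      unfolding E'_def using E(2) by (auto intro!: sum_\<Lambda>)
    show "\<exists>\<epsilon>\<in>E'. \<exists>y\<in>\<Lambda>. x = \<epsilon> + j t * y" if x: "x \<in> \<Lambda>" for x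
    proof -
      obtain r where r: "\<And>g. g \<in> G \<Longrightarrow> r g \<in> A" "x = (\<Sum>g\<in>G. j (r g) * g)"
        using G(3) x by blast
      have "\<exists>e y. e \<in> E \<and> y \<in> A \<and> r g = e + t * y" if "g \<in> G" for g
        using E(3) r(1)[OF that] by blast
      then obtain e y where ey: "\<And>g. g \<in> G \<Longrightarrow> e g \<in> E \<and> y g \<in> A \<and> r g = e g + t * y g"
        by metis
      have "x = (\<Sum>g\<in>G. j (e g) * g) + j t * (\<Sum>g\<in>G. j (y g) * g)"
        unfolding r(2) sum_distrib_left sum.distrib[symmetric]
        using ey by (intro sum.cong refl) (simp add: field_embedding_add field_embedding_mult emb_j algebra_simps)
      moreover have "(\<Sum>g\<in>G. j (e g) * g) = (\<Sum>g\<in>G. j (restrict e G g) * g)"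
        by (intro sum.cong) auto
      moreover have "restrict e G \<in> G \<rightarrow>\<^sub>E E" using ey by auto
      ultimately show ?thesis
        unfolding E'_def using ey sum_\<Lambda>[of y] by blast
    qed
  qed (use t emb_const absval_const \<Lambda>_separated \<Lambda>_0 \<Lambda>_add \<Lambda>_mult A_const in auto)
  then show ?thesis by blast
qed

lemma A_eq_constants:
  assumes "\<not> (\<exists>t\<in>A. 1 < absval (j t))"
  shows "A = range i"
  using assms A_bounded_constant A_const by (force simp: not_less)

text \<open>If no element of \<open>A\<close> expands, \<open>A\<close> is the finite field and
  \<Lambda>, being finitely generated, is finite itself.\<close>

lemma finite_\<Lambda>_ball: "finite {x \<in> \<Lambda>. absval x \<le> r}"
proof (cases "\<exists>t\<in>A. 1 < absval (j t)")
  case True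
  then obtain t E where "t_lattice (\<lambda>a. j (i a)) (j t) \<Lambda> E"
    using t_lattice_\<Lambda> by blast
  then interpret t_lattice "\<lambda>a. j (i a)" "j t" \<Lambda> E .
  show ?thesis using finite_ball_L[of r] by (simp add: ball_L_def)
next
  case False
  then have finA: "finite A" using A_eq_constants by simp
  obtain G where G: "finite G" "G \<subseteq> \<Lambda>" "\<forall>x\<in>\<Lambda>. \<exists>r. (\<forall>g\<in>G. r g \<in> A) \<and> x = (\<Sum>g\<in>G. j (r g) * g)"
    using lattice by (auto simp: period_lattice_def A_finitely_generated_def)
  have "\<Lambda> \<subseteq> (\<lambda>r. \<Sum>g\<in>G. j (r g) * g) ` (G \<rightarrow>\<^sub>E A)"
  proof
    fix x assume "x \<in> \<Lambda>"
    then obtain r where r: "\<And>g. g \<in> G \<Longrightarrow> r g \<in> A" "x = (\<Sum>g\<in>G. j (r g) * g)"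
      using G(3) by blast
    then show "x \<in> (\<lambda>r. \<Sum>g\<in>G. j (r g) * g) ` (G \<rightarrow>\<^sub>E A)"
      by (intro image_eqI[of _ _ "restrict r G"]) auto
  qed
  moreover have "finite ((\<lambda>r. \<Sum>g\<in>G. j (r g) * g) ` (G \<rightarrow>\<^sub>E A))"
    using G(1) finA by (intro finite_imageI finite_PiE) auto
  ultimately have "finite \<Lambda>" by (rule finite_subset)
  then show ?thesis by simp
qed

lemma vanishing_inverse_\<Lambda>: "vanishing inverse (\<Lambda> - {0})"
  unfolding vanishing_def
proof (intro allI impI)
  fix \<epsilon> :: real assume \<epsilon>: "\<epsilon> > 0"
  have "{x \<in> \<Lambda> - {0}. \<epsilon> \<le> absval (inverse x)} \<subseteq> {x \<in> \<Lambda>. absval x \<le> 1 / \<epsilon>}"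
  proof
    fix x assume x: "x \<in> {x \<in> \<Lambda> - {0}. \<epsilon> \<le> absval (inverse x)}"
    then have "absval x > 0" by (intro absval_pos) auto
    moreover have "\<epsilon> \<le> inverse (absval x)" using x by (simp add: absval_inverse)
    ultimately have "absval x \<le> 1 / \<epsilon>" using \<epsilon> by (simp add: field_simps)
    then show "x \<in> {x \<in> \<Lambda>. absval x \<le> 1 / \<epsilon>}" using x by simp
  qed
  then show "finite {x \<in> \<Lambda> - {0}. \<epsilon> \<le> absval (inverse x)}"
    using finite_\<Lambda>_ball by (rule finite_subset)
qed

section \<open>The zeta element and its image under the functional\<close>

abbreviation rep_\<Lambda> :: "'c \<Rightarrow> 'c \<Rightarrow> 'c" where
  "rep_\<Lambda> x b \<equiv> j (i (module.representation (scale_C i j) BL x b))"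

abbreviation rep_A :: "'k \<Rightarrow> 'k \<Rightarrow> 'c" where
  "rep_A x b \<equiv> j (i (module.representation (scale_K i) BA x b))"

lemma j_i_eq_0_iff: "j (i a) = 0 \<longleftrightarrow> a = 0"
  by (simp add: field_embedding_eq_0_iff emb_i emb_j)

text \<open>Coordinates are constants, of absolute value at most 1, so \<open>w l\<close> bounds the
  pure tensor in all coordinates simultaneously.\<close>

lemma tensor_sum_pure:
  assumes w: "vanishing w S" and s: "vector_space s"
  shows "has_tensor_sum (\<lambda>l. pure_tensor i j s B (w l) (m l)) S
      (tensor_sum (\<lambda>l. pure_tensor i j s B (w l) (m l)) S)"
    and "tensor_sum (\<lambda>l. pure_tensor i j s B (w l) (m l)) S \<in> completed_tensor B"
proof -
  interpret vector_space s by fact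
  have van: "finite {l \<in> S. \<exists>b. \<epsilon> \<le> absval (pure_tensor i j s B (w l) (m l) b)}" if "\<epsilon> > 0" for \<epsilon>
  proof (rule finite_subset)
    show "{l \<in> S. \<exists>b. \<epsilon> \<le> absval (pure_tensor i j s B (w l) (m l) b)} \<subseteq> {l \<in> S. \<epsilon> \<le> absval (w l)}"
    proof clarsimp
      fix l b assume "\<epsilon> \<le> absval (pure_tensor i j s B (w l) (m l) b)"
      also have "\<dots> \<le> absval (w l) * 1"
        unfolding pure_tensor_def absval_mult by (intro mult_left_mono absval_const_le) simp
      finally show "\<epsilon> \<le> absval (w l)" by simp
    qed
  qed (use w that in \<open>auto simp: vanishing_def\<close>)
  then show "has_tensor_sum (\<lambda>l. pure_tensor i j s B (w l) (m l)) S
      (tensor_sum (\<lambda>l. pure_tensor i j s B (w l) (m l)) S)"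
    by (rule has_tensor_sum_vanishing)
  show "tensor_sum (\<lambda>l. pure_tensor i j s B (w l) (m l)) S \<in> completed_tensor B"
  proof (rule tensor_sum_in_completed_tensor[OF van])
    fix l b assume "b \<notin> B"
    then show "pure_tensor i j s B (w l) (m l) b = 0"
      using representation_ne_zero[of B "m l" b] by (auto simp: pure_tensor_def j_i_eq_0_iff)
  next
    fix l
    show "finite {b. pure_tensor i j s B (w l) (m l) b \<noteq> 0}"
      by (rule finite_subset[OF _ finite_representation[of B "m l"]]) (auto simp: pure_tensor_def j_i_eq_0_iff)
  qed
qed

text \<open>Here and in \<open>zA\<close> the sign is dropped: they are minus the zeta element and
  minus its image.\<close>

definition z\<Lambda> :: "'c \<Rightarrow> 'c" where
  "z\<Lambda> = tensor_sum (\<lambda>l. pure_tensor i j (scale_C i j) BL (inverse l) l) (\<Lambda> - {0})"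

definition zA :: "'k \<Rightarrow> 'c" where
  "zA = tensor_sum (\<lambda>l. pure_tensor i j (scale_K i) BA (inverse l) (f l)) (\<Lambda> - {0})"

lemma zeta_eq: "zeta_lattice i j BL \<Lambda> = (\<lambda>b. - z\<Lambda> b)"
  by (simp add: zeta_lattice_def z\<Lambda>_def)

lemma has_tensor_sum_z\<Lambda>: "has_tensor_sum (\<lambda>l. pure_tensor i j (scale_C i j) BL (inverse l) l) (\<Lambda> - {0}) z\<Lambda>"
  and z\<Lambda>_completed: "z\<Lambda> \<in> completed_tensor BL"
  unfolding z\<Lambda>_def by (rule tensor_sum_pure[OF vanishing_inverse_\<Lambda> vector_space_C])+

lemma has_tensor_sum_zA: "has_tensor_sum (\<lambda>l. pure_tensor i j (scale_K i) BA (inverse l) (f l)) (\<Lambda> - {0}) zA"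
  and zA_completed: "zA \<in> completed_tensor BA"
  unfolding zA_def by (rule tensor_sum_pure[OF vanishing_inverse_\<Lambda> vector_space_K])+

lemma zeta_completed: "zeta_lattice i j BL \<Lambda> \<in> completed_tensor BL"
  using z\<Lambda>_completed by (simp add: zeta_eq completed_tensor_def)

lemma has_sum_z\<Lambda>: "((\<lambda>l. inverse l * rep_\<Lambda> l b) has_sum z\<Lambda> b) (\<Lambda> - {0})"
  using has_tensor_sum_imp_has_sum[OF has_tensor_sum_z\<Lambda>, of b] by (simp add: pure_tensor_def)

lemma has_sum_zA: "((\<lambda>l. inverse l * rep_A (f l) b) has_sum zA b) (\<Lambda> - {0})"
  using has_tensor_sum_imp_has_sum[OF has_tensor_sum_zA, of b] by (simp add: pure_tensor_def)

lemma rep_A_linear: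
  assumes "x \<in> A" "y \<in> A"
  shows "rep_A (x + y) b = rep_A x b + rep_A y b" "rep_A (i a * x) b = j (i a) * rep_A x b"
proof -
  interpret K: vector_space "scale_K i" by (rule vector_space_K)
  have B: "\<not> K.dependent BA" "K.span BA = A" using bases(2) by (auto simp: basis_of_def)
  show "rep_A (x + y) b = rep_A x b + rep_A y b"
    using assms B by (simp add: K.representation_add field_embedding_add emb_i emb_j)
  have "K.representation BA (scale_K i a x) b = a * K.representation BA x b"
    using assms B by (simp add: K.representation_scale)
  then show "rep_A (i a * x) b = j (i a) * rep_A x b"
    by (simp add: scale_K_def field_embedding_mult emb_i emb_j)
qed

text \<open>\<open>one_tensor\<close> sums over the basis \<open>BL\<close>, so passing to the sum
  over \<Lambda> is an exchange of sums; it is made for each coordinate \<open>b'\<close> with the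
  F_q-linear functional \<open>rep_A (f x) b'\<close>.\<close>

lemma one_tensor_zeta: "one_tensor i j BL BA f (zeta_lattice i j BL \<Lambda>) = (\<lambda>b. - zA b)"
proof -
  define y where "y = one_tensor i j BL BA f (zeta_lattice i j BL \<Lambda>)"
  have "vanishing (zeta_lattice i j BL \<Lambda>) BL"
    using zeta_completed by (simp add: vanishing_def completed_tensor_def)
  from has_tensor_sum_imp_has_sum[OF tensor_sum_pure(1)[OF this vector_space_K, where B = BA and m = f]]
  have y: "((\<lambda>b. zeta_lattice i j BL \<Lambda> b * rep_A (f b) b') has_sum y b') BL" for b'
    by (simp add: y_def one_tensor_def pure_tensor_def)
  have "y b' = - zA b'" for b'
  proof -
    have BL_\<Lambda>: "BL \<subseteq> \<Lambda>"
    proof -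
      interpret C: vector_space "scale_C i j" by (rule vector_space_C)
      show ?thesis using bases(1) C.span_superset by (auto simp: basis_of_def)
    qed
    have "\<exists>X. ((\<lambda>b. z\<Lambda> b * rep_A (f b) b') has_sum X) BL \<and>
        ((\<lambda>l. inverse l * rep_A (f l) b') has_sum X) (\<Lambda> - {0})"
    proof (rule has_sum_basis_swap[OF vector_space_C bases(1) emb_const absval_const_le])
      fix x y assume "x \<in> \<Lambda>" "y \<in> \<Lambda>"
      then show "rep_A (f (x + y)) b' = rep_A (f x) b' + rep_A (f y) b'"
        using rep_A_linear(1) f_A by (simp add: f_add)
    next
      fix a x assume "x \<in> \<Lambda>"
      then show "rep_A (f (scale_C i j a x)) b' = j (i a) * rep_A (f x) b'"
        using rep_A_linear(2)[OF f_A f_A, of x x a b'] by (simp add: f_mult A_const scale_C_def)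
    qed (use vanishing_inverse_\<Lambda> has_sum_z\<Lambda> absval_const_le in auto)
    then obtain X where X: "((\<lambda>b. z\<Lambda> b * rep_A (f b) b') has_sum X) BL"
        "((\<lambda>l. inverse l * rep_A (f l) b') has_sum X) (\<Lambda> - {0})" by blast
    have "X = zA b'" using X(2) has_sum_zA by (rule has_sum_unique)
    moreover have "((\<lambda>b. zeta_lattice i j BL \<Lambda> b * rep_A (f b) b') has_sum - X) BL"
      using X(1) by (simp add: zeta_eq has_sum_uminus)
    then have "y b' = - X" using y has_sum_unique by blast
    ultimately show ?thesis by simp
  qed
  then show ?thesis by (auto simp: y_def)
qed

section \<open>Evaluation on the unit disc and continuation beyond it\<close>

lemma affine_point_linear:
  assumes P: "P \<in> affine_points i j A"
  shows "x \<in> A \<Longrightarrow> y \<in> A \<Longrightarrow> P (x + y) = P x + P y" "x \<in> A \<Longrightarrow> P (i a * x) = j (i a) * P x"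
  using P A_const by (auto simp: affine_points_def)

text \<open>On the disc elements of \<open>A\<close> take values of absolute value at most 1, which
  permits the exchange with the sum over \<open>BA\<close>. The outer minus sign cancels the sign in
  zeta.\<close>

lemma has_sum_evaluation:
  assumes P: "P \<in> unit_disc i j A"
  shows "((\<lambda>l. inverse l * P (f l)) has_sum - tensor_eval BA (\<lambda>b. - zA b) P) (\<Lambda> - {0})"
proof -
  have P': "P \<in> affine_points i j A" "\<And>a. a \<in> A \<Longrightarrow> absval (P a) \<le> 1"
    using P by (auto simp: unit_disc_def)
  have BA_A: "BA \<subseteq> A"
  proof -
    interpret K: vector_space "scale_K i" by (rule vector_space_K)
    show ?thesis using bases(2) K.span_superset by (auto simp: basis_of_def)
  qed
  have "\<exists>X. ((\<lambda>b. zA b * P b) has_sum X) BA \<and> ((\<lambda>l. inverse l * P (f l)) has_sum X) (\<Lambda> - {0})"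
  proof (rule has_sum_basis_swap[OF vector_space_K bases(2) emb_const absval_const_le])
    show "P (scale_K i a x) = j (i a) * P x" if "x \<in> A" for a x
      using affine_point_linear(2)[OF P'(1) that] by (simp add: scale_K_def)
  qed (use vanishing_inverse_\<Lambda> has_sum_zA P' affine_point_linear(1) f_A BA_A in auto)
  then obtain X where X: "((\<lambda>b. zA b * P b) has_sum X) BA" "((\<lambda>l. inverse l * P (f l)) has_sum X) (\<Lambda> - {0})"
    by blast
  have "((\<lambda>b. - zA b * P b) has_sum - X) BA"
    using X(1) by (simp add: has_sum_uminus)
  then have "tensor_eval BA (\<lambda>b. - zA b) P = - X"
    unfolding tensor_eval_def by (rule infsumI)
  then show ?thesis using X(2) by simp
qed

text \<open>On the disc \<open>P (f x)\<close> is bounded by 1, so the sum over \<Lambda> can be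
  regrouped along a reduced basis \<open>x\<close> with the dual sums as coefficients
  \<open>\<gamma>\<close>. The growth of \<open>x\<close> and the decay of \<open>\<gamma>\<close>
  do not involve \<open>P\<close>, and so remain available off the disc.\<close>

lemma exists_expansion:
  assumes t: "t \<in> A" "1 < absval (j t)"
  shows "\<exists>\<gamma> x. (\<forall>k. x k \<in> \<Lambda>) \<and> (\<exists>C. \<forall>k. absval (x k) \<le> absval (j t) ^ k * C) \<and>
    (\<forall>R c. R \<ge> 1 \<longrightarrow> (\<lambda>k. absval (\<gamma> k) * R ^ (k + c)) \<longlonglongrightarrow> 0) \<and>
    (\<forall>P \<in> unit_disc i j A. \<forall>X. ((\<lambda>l. inverse l * P (f l)) has_sum X) (\<Lambda> - {0}) \<longrightarrow>
       ((\<lambda>k::nat. \<gamma> k * P (f (x k))) has_sum X) UNIV)"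
proof -
  obtain E where "t_lattice (\<lambda>a. j (i a)) (j t) \<Lambda> E"
    using t_lattice_\<Lambda>[OF t] by blast
  then interpret t_lattice "\<lambda>a. j (i a)" "j t" \<Lambda> E .
  show ?thesis
  proof (cases "\<Lambda> = {0}")
    case True
    \<comment> \<open>The sum over the empty set is 0, so zero coefficients will do.\<close>
    then show ?thesis
      by (intro exI[of _ "\<lambda>_. 0"] conjI exI[of _ 1]) (auto dest: has_sum_unique[OF _ has_sum_empty])
  next
    case False
    then obtain \<beta> where \<beta>: "reduced_basis \<beta>" using exists_reduced_basis by blast
    have expansion: "((\<lambda>k. dual_sum \<beta> k * P (f (\<beta> k))) has_sum X) UNIV"
      if P: "P \<in> unit_disc i j A" and X: "((\<lambda>l. inverse l * P (f l)) has_sum X) (\<Lambda> - {0})" for P X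
    proof -
      have P': "P \<in> affine_points i j A" "\<And>a. a \<in> A \<Longrightarrow> absval (P a) \<le> 1"
        using P by (auto simp: unit_disc_def)
      \<comment> \<open>The coefficients are indexed by the basis vectors themselves, since the
        exchange works with a basis as a set.\<close>
      define z where "z b = dual_sum \<beta> (the_inv \<beta> b)" for b
      have z: "z (\<beta> k) = dual_sum \<beta> k" for k
        by (simp add: z_def the_inv_f_f inj_reduced_basis[OF \<beta>])
      have "\<exists>Y. ((\<lambda>b. z b * P (f b)) has_sum Y) (range \<beta>) \<and> ((\<lambda>l. inverse l * P (f l)) has_sum Y) (\<Lambda> - {0})"
      proof (rule has_sum_basis_swap[OF vector_space_axioms _ emb_const absval_const_le, where M = \<Lambda>])
        show "basis_of (\<lambda>a. (*) (j (i a))) (range \<beta>) \<Lambda>"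
          using independent_reduced_basis[OF \<beta>] span_reduced_basis[OF \<beta>] by (simp add: basis_of_def)
        show "P (f (x + y)) = P (f x) + P (f y)" if "x \<in> \<Lambda>" "y \<in> \<Lambda>" for x y
          using that affine_point_linear(1)[OF P'(1)] f_A by (simp add: f_add)
        show "P (f (j (i a) * x)) = j (i a) * P (f x)" if "x \<in> \<Lambda>" for a x
          using that affine_point_linear(2)[OF P'(1)] f_A A_const by (simp add: f_mult)
        show "absval (P (f b)) \<le> 1" if "b \<in> range \<beta>" for b
          using that P'(2) f_A reduced_basis_in[OF \<beta>] by auto
        show "((\<lambda>l. inverse l * j (i (representation (range \<beta>) l b))) has_sum z b) (\<Lambda> - {0})"
          if "b \<in> range \<beta>" for b
          using that dual_sum[OF \<beta>] by (auto simp: z coord_def[OF \<beta>])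
      qed (use vanishing_inverse_\<Lambda> in auto)
      then obtain Y where Y: "((\<lambda>b. z b * P (f b)) has_sum Y) (range \<beta>)"
          "((\<lambda>l. inverse l * P (f l)) has_sum Y) (\<Lambda> - {0})" by blast
      have "Y = X" using Y(2) X by (rule has_sum_unique)
      then show ?thesis
        using Y(1) has_sum_reindex[OF inj_reduced_basis[OF \<beta>], of "\<lambda>b. z b * P (f b)" X]
        by (simp add: o_def z)
    qed
    show ?thesis
      using reduced_basis_in[OF \<beta>] reduced_basis_growth[OF \<beta>] dual_sum_superexponential_decay[OF \<beta>] expansion
      by (intro exI[of _ "dual_sum \<beta>"] exI[of _ \<beta>]) auto
  qed
qed

text \<open>It remains to bound the degree of \<open>f (x k)\<close> in generators of
  \<open>A\<close> by \<open>k\<close> plus a constant. Digits in \<Lambda> give the bound on its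
  absolute value, digits in \<open>A\<close> convert that into a degree.\<close>

lemma analytic:
  "analytic_tensor i j A BA (\<lambda>b. - zA b)"
proof (cases "\<exists>t\<in>A. 1 < absval (j t)")
  case True
  then obtain t where t: "t \<in> A" "1 < absval (j t)" by blast
  define T where "T = absval (j t)"
  obtain \<gamma> x C where x: "\<And>k. x k \<in> \<Lambda>" "\<And>k. absval (x k) \<le> T ^ k * C"
    and decay: "\<And>R c. R \<ge> 1 \<Longrightarrow> (\<lambda>k. absval (\<gamma> k) * R ^ (k + c)) \<longlonglongrightarrow> 0"
    and expansion: "\<And>P X. P \<in> unit_disc i j A \<Longrightarrow> ((\<lambda>l. inverse l * P (f l)) has_sum X) (\<Lambda> - {0}) \<Longrightarrow>
       ((\<lambda>k::nat. \<gamma> k * P (f (x k))) has_sum X) UNIV"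
    using exists_expansion[OF t] unfolding T_def by blast
  obtain EL where "t_lattice (\<lambda>a. j (i a)) (j t) \<Lambda> EL"
    using t_lattice_\<Lambda>[OF t] by blast
  then interpret L: t_lattice "\<lambda>a. j (i a)" "j t" \<Lambda> EL .
  obtain EA where "t_lattice (\<lambda>a. j (i a)) (j t) (j ` A) EA"
    using t_lattice_A[OF t] by blast
  then interpret J: t_lattice "\<lambda>a. j (i a)" "j t" "j ` A" EA .
  obtain DL NL where DL: "finite DL" "DL \<subseteq> \<Lambda>" "NL > 0"
    and digits_L: "\<And>n x. x \<in> \<Lambda> \<Longrightarrow> absval x \<le> NL * T ^ n \<Longrightarrow>
      \<exists>\<epsilon>. (\<forall>a. \<epsilon> a \<in> DL) \<and> x = (\<Sum>a\<le>n. j t ^ a * \<epsilon> a)"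
    using L.exists_digits unfolding T_def by blast
  obtain DJ NJ where DJ: "finite DJ" "DJ \<subseteq> j ` A" "NJ > 0"
    and digits_J: "\<And>n x. x \<in> j ` A \<Longrightarrow> absval x \<le> NJ * T ^ n \<Longrightarrow>
      \<exists>\<epsilon>. (\<forall>a. \<epsilon> a \<in> DJ) \<and> x = (\<Sum>a\<le>n. j t ^ a * \<epsilon> a)"
    using J.exists_digits unfolding T_def by blast
  \<comment> \<open>The digits were found in the image of \<open>A\<close> and are pulled back along
    \<open>j\<close>.\<close>
  obtain D where D: "D \<subseteq> A" "finite D" "DJ = j ` D"
    using finite_subset_image[OF DJ(1,2)] by blast
  have inj_j: "j a = j b \<longleftrightarrow> a = b" for a b
    using field_embedding_eq_0_iff[OF emb_j, of "a - b"] by (simp add: field_embedding_diff emb_j)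
  have digits: "\<exists>\<epsilon>. (\<forall>c. \<epsilon> c \<in> D) \<and> a = (\<Sum>c\<le>n. t ^ c * \<epsilon> c)"
    if a: "a \<in> A" "absval (j a) \<le> NJ * T ^ n" for a n
  proof -
    obtain \<epsilon>' where \<epsilon>': "\<And>c. \<epsilon>' c \<in> j ` D" "j a = (\<Sum>c\<le>n. j t ^ c * \<epsilon>' c)"
      using digits_J[of "j a" n] a D(3) by blast
    then obtain \<epsilon> where \<epsilon>: "\<And>c. \<epsilon> c \<in> D" "\<And>c. \<epsilon>' c = j (\<epsilon> c)"
      unfolding image_iff by metis
    have "j a = j (\<Sum>c\<le>n. t ^ c * \<epsilon> c)"
      unfolding \<epsilon>'(2) \<epsilon>(2) by (simp add: field_embedding_sum field_embedding_mult field_embedding_power emb_j)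
    then show ?thesis using \<epsilon>(1) inj_j by blast
  qed
  have T: "T > 1" using t by (simp add: T_def)
  have T_le: "\<exists>n. r \<le> M * T ^ n" if "M > 0" for r M
  proof -
    obtain n where "r / M < T ^ n" using real_arch_pow[OF T] by blast
    then show ?thesis using that by (intro exI[of _ n]) (simp add: field_simps)
  qed
  \<comment> \<open>\<open>c1\<close> absorbs the constant in the growth of \<open>x k\<close>, and
    \<open>c2\<close> below the values of \<open>f\<close> on the digits of \<Lambda>; both turn
    into a fixed number of extra digits.\<close>
  obtain c1 where c1: "C \<le> NL * T ^ c1" using T_le[OF DL(3)] by blast
  define CF where "CF = Max (insert 0 ((\<lambda>\<epsilon>. absval (j (f \<epsilon>))) ` DL))"
  have CF: "CF \<ge> 0" "\<And>\<epsilon>. \<epsilon> \<in> DL \<Longrightarrow> absval (j (f \<epsilon>)) \<le> CF"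
    unfolding CF_def using DL(1) by auto
  obtain c2 where c2: "CF \<le> NJ * T ^ c2" using T_le[OF DJ(3)] by blast
  \<comment> \<open>By \<open>A\<close>-linearity the expansion of \<open>x k\<close> is carried to
    one of \<open>f (x k)\<close> with digits \<open>f \<epsilon>\<close>, which take finitely many
    values and are bounded by \<open>CF\<close>.\<close>
  have f_le: "absval (j (f (x k))) \<le> NJ * T ^ (k + (c1 + c2))" for k
  proof -
    have "absval (x k) \<le> T ^ k * (NL * T ^ c1)"
      using x(2) by (rule order_trans) (use c1 T in \<open>auto intro!: mult_left_mono\<close>)
    then have "absval (x k) \<le> NL * T ^ (k + c1)" by (simp add: power_add mult_ac)
    then obtain \<epsilon> where \<epsilon>: "\<And>a. \<epsilon> a \<in> DL" "x k = (\<Sum>a\<le>k + c1. j t ^ a * \<epsilon> a)"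
      using digits_L[OF x(1)] by blast
    have \<epsilon>\<Lambda>: "\<epsilon> a \<in> \<Lambda>" for a using \<epsilon>(1) DL(2) by blast
    have mem: "j (t ^ a) * \<epsilon> a \<in> \<Lambda>" for a
      by (intro \<Lambda>_mult A_power t \<epsilon>\<Lambda>)
    have "f (x k) = (\<Sum>a\<le>k + c1. f (j (t ^ a) * \<epsilon> a))"
      unfolding \<epsilon>(2) field_embedding_power[OF emb_j, symmetric] using mem by (intro f_sum)
    also have "\<dots> = (\<Sum>a\<le>k + c1. t ^ a * f (\<epsilon> a))"
      by (intro sum.cong refl f_mult A_power t \<epsilon>\<Lambda>)
    finally have "j (f (x k)) = (\<Sum>a\<le>k + c1. j t ^ a * j (f (\<epsilon> a)))"
      by (simp add: field_embedding_sum field_embedding_mult field_embedding_power emb_j)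
    also have "absval \<dots> \<le> T ^ (k + c1) * CF"
    proof (rule absval_sum_le)
      fix a assume a: "a \<in> {..k + c1}"
      have "absval (j t ^ a) \<le> T ^ (k + c1)"
        unfolding absval_power T_def[symmetric] using a T by (intro power_increasing) auto
      then show "absval (j t ^ a * j (f (\<epsilon> a))) \<le> T ^ (k + c1) * CF"
        unfolding absval_mult using CF \<epsilon>(1) T by (intro mult_mono) auto
    qed (use CF T in auto)
    also have "\<dots> \<le> T ^ (k + c1) * (NJ * T ^ c2)"
      using c2 T by (intro mult_left_mono) auto
    finally show ?thesis by (simp add: power_add mult_ac)
  qed
  have "rigid_analytic i j A (\<lambda>P. \<Sum>\<^sub>\<infinity>k. - \<gamma> k * P (f (x k)))"
  proof (rule rigid_analytic_digit_series[OF emb_i emb_j subalgebra_A t(1) D(2,1)])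
    show "\<exists>n \<epsilon>. (\<forall>c. \<epsilon> c \<in> D) \<and> a = (\<Sum>c\<le>n. t ^ c * \<epsilon> c)" if "a \<in> A" for a
      using T_le[OF DJ(3), of "absval (j a)"] digits[OF that] by blast
    show "\<exists>\<epsilon>. (\<forall>c. \<epsilon> c \<in> D) \<and> f (x k) = (\<Sum>c\<le>k + (c1 + c2). t ^ c * \<epsilon> c)" for k
      by (intro digits f_le f_A x)
    show "(\<lambda>k. absval (- \<gamma> k) * R ^ (k + c)) \<longlonglongrightarrow> 0" if "R \<ge> 1" for R c
      using decay[OF that] by simp
  qed
  moreover have "(\<Sum>\<^sub>\<infinity>k. - \<gamma> k * P (f (x k))) = tensor_eval BA (\<lambda>b. - zA b) P" if "P \<in> unit_disc i j A" for P
  proof -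
    have "((\<lambda>k. - \<gamma> k * P (f (x k))) has_sum tensor_eval BA (\<lambda>b. - zA b) P) UNIV"
      using expansion[OF that has_sum_evaluation[OF that]] by (simp add: has_sum_uminus)
    then show ?thesis by (rule infsumI)
  qed
  ultimately show ?thesis
    unfolding analytic_tensor_def by blast
next
  case False
  then have A_eq: "A = range i" by (rule A_eq_constants)
  define F where "F = tensor_eval BA (\<lambda>b. - zA b)"
  \<comment> \<open>With \<open>A = F_q\<close> a point is determined by its values on constants, so
    there is at most one, and a power series in no variables represents any function on it.\<close>
  have unique: "P = restrict j A" if "P \<in> affine_points i j A" for P
  proof
    show "P a = restrict j A a" for a
      using that A_eq by (cases "a \<in> A") (auto simp: affine_points_def extensional_def)
  qed
  have "algebra_generated i {} = A"
    using is_subalgebra_algebra_generated[OF subalgebra_A, of "{}"] A_eq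
    by (auto intro: algebra_generated.const)
  moreover have index: "multi_indices ({} :: 'k set) = {\<lambda>_. 0}"
    by (auto simp: multi_indices_def)
  ultimately have "rigid_analytic i j A F"
    unfolding rigid_analytic_def
  proof (intro exI[of _ "{}"] conjI allI ballI impI exI[of _ "\<lambda>_. F (restrict j A)"])
    fix P assume "P \<in> affine_points i j A"
    then have "F P = F (restrict j A)" using unique by simp
    then show "((\<lambda>\<nu>. F (restrict j A) * (\<Prod>g\<in>{}. P g ^ \<nu> g)) has_sum F P) (multi_indices {})"
      unfolding index by (intro has_sum_finiteI) auto
  qed (auto simp: index)
  then show ?thesis
    unfolding analytic_tensor_def F_def by blast
qed

end

text \<open>As \<open>tensor_sum\<close> is a definite description, the conclusion also records that
  both series converge to it and that the two elements lie in the completed tensor products; the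
  last conjunct is the analyticity.\<close>

theorem proposition1:
  fixes i :: "'f::{field,finite} \<Rightarrow> 'k::field"
    and j :: "'k \<Rightarrow> 'c::complete_nonarch_field"
    and infty :: "'k \<Rightarrow> int"
    and A BA :: "'k set"
    and \<Lambda> BL :: "'c set"
    and f :: "'c \<Rightarrow> 'k"
  assumes curve: "curve_function_field i" "geometrically_irreducible i"
    and infty: "infty \<in> closed_points i"
    and A: "A = ring_A i infty"
    and C_infty: "is_C_infty infty j"
    and lattice: "period_lattice A j \<Lambda>"
    and bases: "basis_of (scale_C i j) BL \<Lambda>" "basis_of (scale_K i) BA A"
    and f: "A_linear_map A j \<Lambda> f"
  shows "zeta_lattice i j BL \<Lambda> \<in> completed_tensor BL \<and>
    has_tensor_sum (\<lambda>l. pure_tensor i j (scale_C i j) BL (inverse l) l) (\<Lambda> - {0})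
      (\<lambda>b. - zeta_lattice i j BL \<Lambda> b) \<and>
    one_tensor i j BL BA f (zeta_lattice i j BL \<Lambda>) \<in> completed_tensor BA \<and>
    has_tensor_sum (\<lambda>l. pure_tensor i j (scale_K i) BA (inverse l) (f l)) (\<Lambda> - {0})
      (\<lambda>b. - one_tensor i j BL BA f (zeta_lattice i j BL \<Lambda>) b) \<and>
    analytic_tensor i j A BA (one_tensor i j BL BA f (zeta_lattice i j BL \<Lambda>))"
proof -
  interpret lattice_functional i j infty A BA \<Lambda> BL f
    by unfold_locales (fact assms)+
  have "(\<lambda>b. - zA b) \<in> completed_tensor BA"
    using zA_completed by (simp add: completed_tensor_def)
  then show ?thesis
    using zeta_completed has_tensor_sum_z\<Lambda> has_tensor_sum_zA analytic
    unfolding one_tensor_zeta by (simp add: zeta_eq)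
qed

end
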